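(* Let $(X,d)$ be a finite semimetric space with $|X|=n$, given as a weighted graph $\mathcal G=(X,\mathcal E,d)$ with $m=|\mathcal E|$, let $\beta,\gamma\in(0,1]$, and let $\mathcal C=(C_1,\ldots,C_k)$ be an unknown $k$-clustering of $X$ that is $(\beta,\gamma)$-convex in the generalized sense. Then the cluster radii $\epsilon_1,\ldots,\epsilon_k$ can be learned using $O(k\log n)$ SEED queries in time $O\big(m\,\alpha(m,n)+kn\log n\big)$, where $\alpha(m,n)$ is the functional inverse of the Ackermann function.
   Context: Semimetric input: $X$ is a finite set and $d$ is symmetric with $d(x,x)=0$ and $d(x,y)\in(0,\infty]$ for $x\neq y$ (the triangle inequality is not assumed). It is given as an undirected weighted graph $\mathcal G=(X,\mathcal E,d)$ whose edges are the pairs of distinct points at finite distance; $n=|X|$, $m=|\mathcal E|$. For $\epsilon\ge0$, $G_X(\epsilon)$ is the unweighted undirected graph on $X$ in which distinct $x,y$ are adjacent iff $d(x,y)\le\epsilon$. For a graph $G$, $d_G(x,y)$ is the shortest-path distance (number of edges; $\infty$ if there is no path). The length of a path is its number of edges. A $k$-clustering of $X$ is a partition $(C_1,\ldots,C_k)$ of $X$. It is $(\beta,\gamma)$-convex in the generalized sense if for each $i\in[k]$ there is $\epsilon_i>0$ such that: (1) the subgraph of $G_X(\epsilon_i)$ induced by $C_i$ is connected; (2) for all $x\in C_i$, $y\in X\setminus C_i$, $d(x,y)>\beta\epsilon_i$; (3) for every $\epsilon\le\epsilon_i$, if $x,y\in C_i$ and $d_{G_X(\epsilon)}(x,y)<\infty$,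 then every simple path in $G_X(\epsilon)$ between $x$ and $y$ of length at most $(1+\gamma)d_{G_X(\epsilon)}(x,y)$ lies entirely in $C_i$. The radius $\epsilon_i$ of $C_i$ is taken to be the smallest value such that any two points of $C_i$ are connected by a path in $G_X(\epsilon_i)$ (for a singleton cluster, $0$); the three properties hold with this value. A query SEED$(S,i)$, with $S\subseteq X$ and $i\in[k]$, returns an arbitrary point of $C_i\cap S$, or NIL if $C_i\cap S=\emptyset$. In the time model, $d$ can be evaluated in constant time, and the edges incident to a vertex can be listed in constant time per edge. *)

theory Defs
  imports
    "HOL-Library.Extended_Real"
    "HOL-Library.Disjoint_Sets"
begin

section \<open>Semimetric spaces and threshold graphs\<close>

definition semimetric_on :: "'a set \<Rightarrow> ('a \<Rightarrow> 'a \<Rightarrow> ereal) \<Rightarrow> bool" where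
  "semimetric_on X d \<longleftrightarrow>
     (\<forall>x\<in>X. d x x = 0) \<and>
     (\<forall>x\<in>X. \<forall>y\<in>X. d x y = d y x) \<and>
     (\<forall>x\<in>X. \<forall>y\<in>X. x \<noteq> y \<longrightarrow> 0 < d x y)"

definition edges :: "'a set \<Rightarrow> ('a \<Rightarrow> 'a \<Rightarrow> ereal) \<Rightarrow> 'a set set" where
  "edges X d = {{x, y} | x y. x \<in> X \<and> y \<in> X \<and> x \<noteq> y \<and> d x y < \<infinity>}"

definition adjacent :: "'a set \<Rightarrow> ('a \<Rightarrow> 'a \<Rightarrow> ereal) \<Rightarrow> real \<Rightarrow> 'a \<Rightarrow> 'a \<Rightarrow> bool" where
  "adjacent X d \<epsilon> x y \<longleftrightarrow> x \<in> X \<and> y \<in> X \<and> x \<noteq> y \<and> d x y \<le> ereal \<epsilon>"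

text \<open>A path is the list of the vertices it visits, so \<open>p\<close> has \<open>length p - 1\<close> edges.\<close>

definition path_between ::
  "'a set \<Rightarrow> ('a \<Rightarrow> 'a \<Rightarrow> bool) \<Rightarrow> 'a \<Rightarrow> 'a \<Rightarrow> 'a list \<Rightarrow> bool" where
  "path_between V adj x y p \<longleftrightarrow>
     p \<noteq> [] \<and> set p \<subseteq> V \<and> successively adj p \<and> hd p = x \<and> last p = y"

definition path_length :: "'a list \<Rightarrow> nat" where
  "path_length p = length p - 1"

definition graph_dist :: "'a set \<Rightarrow> ('a \<Rightarrow> 'a \<Rightarrow> bool) \<Rightarrow> 'a \<Rightarrow> 'a \<Rightarrow> enat" where
  "graph_dist V adj x y = (INF p \<in> {p. path_between V adj x y p}. enat (path_length p))"

text \<open>Connectedness of the subgraph induced by \<open>C\<close>: the paths may only visit points of \<open>C\<close>.\<close>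

definition induced_connected :: "('a \<Rightarrow> 'a \<Rightarrow> bool) \<Rightarrow> 'a set \<Rightarrow> bool" where
  "induced_connected adj C \<longleftrightarrow> (\<forall>x\<in>C. \<forall>y\<in>C. \<exists>p. path_between C adj x y p)"


section \<open>Convex clusterings\<close>

definition clustering :: "'a set \<Rightarrow> nat \<Rightarrow> (nat \<Rightarrow> 'a set) \<Rightarrow> bool" where
  "clustering X k C \<longleftrightarrow> partition_on X (C ` {..<k}) \<and> inj_on C {..<k}"

definition convex_cluster ::
  "real \<Rightarrow> real \<Rightarrow> 'a set \<Rightarrow> ('a \<Rightarrow> 'a \<Rightarrow> ereal) \<Rightarrow> 'a set \<Rightarrow> real \<Rightarrow> bool" where
  "convex_cluster \<beta> \<gamma> X d C \<epsilon> \<longleftrightarrow>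
     induced_connected (adjacent X d \<epsilon>) C \<and>
     (\<forall>x\<in>C. \<forall>y\<in>X - C. d x y > ereal (\<beta> * \<epsilon>)) \<and>
     (\<forall>\<delta>. 0 \<le> \<delta> \<and> \<delta> \<le> \<epsilon> \<longrightarrow>
       (\<forall>x\<in>C. \<forall>y\<in>C. graph_dist X (adjacent X d \<delta>) x y < \<infinity> \<longrightarrow>
         (\<forall>p. path_between X (adjacent X d \<delta>) x y p \<and> distinct p \<and>
              ereal (real (path_length p)) \<le>
                ereal (1 + \<gamma>) * ereal_of_enat (graph_dist X (adjacent X d \<delta>) x y)
              \<longrightarrow> set p \<subseteq> C)))"

definition convex_clustering ::
  "real \<Rightarrow> real \<Rightarrow> 'a set \<Rightarrow> ('a \<Rightarrow> 'a \<Rightarrow> ereal) \<Rightarrow> nat \<Rightarrow> (nat \<Rightarrow> 'a set) \<Rightarrow> bool" where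
  "convex_clustering \<beta> \<gamma> X d k C \<longleftrightarrow>
     clustering X k C \<and> (\<forall>i<k. \<exists>\<epsilon>>0. convex_cluster \<beta> \<gamma> X d (C i) \<epsilon>)"

text \<open>
  The connecting paths may leave \<open>C\<close>. For a singleton, the one-vertex path makes the radius \<open>0\<close>.
\<close>

definition cluster_radius :: "'a set \<Rightarrow> ('a \<Rightarrow> 'a \<Rightarrow> ereal) \<Rightarrow> 'a set \<Rightarrow> real" where
  "cluster_radius X d C =
     (LEAST \<epsilon>. 0 \<le> \<epsilon> \<and> (\<forall>x\<in>C. \<forall>y\<in>C. \<exists>p. path_between X (adjacent X d \<epsilon>) x y p))"

text \<open>
  The first argument of an oracle is the number of queries asked before. As programs are
  deterministic, quantifying over all such oracles covers every adaptive way of choosing the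
  returned points; \<open>None\<close> is NIL.
\<close>

type_synonym 'a seed_oracle = "nat \<Rightarrow> 'a set \<Rightarrow> nat \<Rightarrow> 'a option"

definition seed_oracle_for ::
  "'a set \<Rightarrow> nat \<Rightarrow> (nat \<Rightarrow> 'a set) \<Rightarrow> 'a seed_oracle \<Rightarrow> bool" where
  "seed_oracle_for X k C seed \<longleftrightarrow>
     (\<forall>t S i. S \<subseteq> X \<and> i < k \<longrightarrow>
        (case seed t S i of None \<Rightarrow> C i \<inter> S = {} | Some p \<Rightarrow> p \<in> C i \<inter> S))"


section \<open>The inverse Ackermann function\<close>

text \<open>
  Tarjan's variant (Efficiency of a good but not linear set union algorithm, 1975), which is also
  the one of Chazelle's minimum spanning tree algorithm. For \<open>m = 0\<close> the value is
  irrelevant, as it only occurs in \<open>m * inverse_ackermann m n\<close>.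
\<close>

fun ackermann :: "nat \<Rightarrow> nat \<Rightarrow> nat" where
  "ackermann 0 j = 2 * j"
| "ackermann (Suc i) 0 = 0"
| "ackermann (Suc i) (Suc 0) = 2"
| "ackermann (Suc i) (Suc (Suc j)) = ackermann i (ackermann (Suc i) (Suc j))"

definition inverse_ackermann :: "nat \<Rightarrow> nat \<Rightarrow> nat" where
  "inverse_ackermann m n =
     (LEAST i. 1 \<le> i \<and> log 2 (real n) < real (ackermann i (4 * nat \<lceil>real m / real n\<rceil>)))"


section \<open>Random access machine programs with oracles\<close>

text \<open>
  Programs work on finitely many unbounded zero-initialised arrays of natural numbers and of
  distances. On numbers there are addition, truncated subtraction and comparison, but no
  multiplication; distances can only be copied and compared. Points are known to a program by their
  positions in a list of the points. Since a fixed program contains only finitely many expressions,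
  charging one time unit for the evaluation of an expression is correct up to a constant factor.
\<close>

datatype iexp =
    Const nat
  | Cell nat iexp
  | Plus iexp iexp
  | Minus iexp iexp

datatype dexp =
    DZero
  | DCell nat iexp

datatype bexp =
    Less iexp iexp
  | DLess dexp dexp
  | Neg bexp
  | Conj bexp bexp

datatype com =
    Skip
  | ISet nat iexp iexp
  | DSet nat iexp dexp
  | Dist nat iexp iexp iexp
  | Neighbours nat iexp
  | Seed nat iexp nat iexp iexp
  | Seq com com
  | Cond bexp com com
  | Loop bexp com

record state =
  ints :: "nat \<Rightarrow> nat \<Rightarrow> nat"
  dists :: "nat \<Rightarrow> nat \<Rightarrow> ereal"
  queries :: nat
  time :: nat

fun ival :: "state \<Rightarrow> iexp \<Rightarrow> nat" where
  "ival s (Const c) = c"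
| "ival s (Cell a e) = ints s a (ival s e)"
| "ival s (Plus e f) = ival s e + ival s f"
| "ival s (Minus e f) = ival s e - ival s f"

fun dval :: "state \<Rightarrow> dexp \<Rightarrow> ereal" where
  "dval s DZero = 0"
| "dval s (DCell b e) = dists s b (ival s e)"

fun bval :: "state \<Rightarrow> bexp \<Rightarrow> bool" where
  "bval s (Less e f) = (ival s e < ival s f)"
| "bval s (DLess e f) = (dval s e < dval s f)"
| "bval s (Neg b) = (\<not> bval s b)"
| "bval s (Conj b c) = (bval s b \<and> bval s c)"

definition tick :: "nat \<Rightarrow> state \<Rightarrow> state" where
  "tick t s = s\<lparr>time := time s + t\<rparr>"

definition iwrite :: "nat \<Rightarrow> nat \<Rightarrow> nat \<Rightarrow> state \<Rightarrow> state" where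
  "iwrite a j v s = s\<lparr>ints := (ints s)(a := (ints s a)(j := v))\<rparr>"

definition dwrite :: "nat \<Rightarrow> nat \<Rightarrow> ereal \<Rightarrow> state \<Rightarrow> state" where
  "dwrite b j v s = s\<lparr>dists := (dists s)(b := (dists s b)(j := v))\<rparr>"

definition iwrite_list :: "nat \<Rightarrow> nat list \<Rightarrow> state \<Rightarrow> state" where
  "iwrite_list a l s = s\<lparr>ints := (ints s)(a :=
     (\<lambda>j. if j = 0 then length l else if j \<le> length l then l ! (j - 1) else ints s a j))\<rparr>"

text \<open>
  \<open>Dist b e x y\<close> evaluates \<open>d\<close> into cell \<open>e\<close> of distance array \<open>b\<close>.
  \<open>Neighbours a x\<close> lists the edges at \<open>x\<close>: cell \<open>0\<close> of array \<open>a\<close>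
  receives their number and the following cells their other endpoints, at one time unit per edge.
  \<open>Seed a l r e i\<close> asks SEED\<open>(S, i)\<close> for the set \<open>S\<close> of the points in the first \<open>l\<close>
  cells of array \<open>a\<close>, reading which takes \<open>l\<close> time units; cell \<open>e\<close> of array \<open>r\<close> receives
  \<open>0\<close> for NIL and \<open>q + 1\<close> for the point with position \<open>q\<close>.
  A program that uses an invalid point or cluster index gets stuck: there is no final state.
\<close>

inductive run ::
  "'a list \<Rightarrow> ('a \<Rightarrow> 'a \<Rightarrow> ereal) \<Rightarrow> (nat \<Rightarrow> nat list) \<Rightarrow> nat \<Rightarrow> 'a seed_oracle \<Rightarrow>
   com \<Rightarrow> state \<Rightarrow> state \<Rightarrow> bool"
  for xs d nbrs k seed where
  Skip: "run xs d nbrs k seed Skip s (tick 1 s)"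
| ISet: "run xs d nbrs k seed (ISet a e f) s (tick 1 (iwrite a (ival s e) (ival s f) s))"
| DSet: "run xs d nbrs k seed (DSet b e f) s (tick 1 (dwrite b (ival s e) (dval s f) s))"
| Dist: "\<lbrakk>ival s x < length xs; ival s y < length xs\<rbrakk> \<Longrightarrow>
    run xs d nbrs k seed (Dist b e x y) s
      (tick 1 (dwrite b (ival s e) (d (xs ! ival s x) (xs ! ival s y)) s))"
| Neighbours: "ival s x < length xs \<Longrightarrow>
    run xs d nbrs k seed (Neighbours a x) s
      (tick (1 + length (nbrs (ival s x))) (iwrite_list a (nbrs (ival s x)) s))"
| Seed_None: "\<lbrakk>\<forall>j < ival s l. ints s a j < length xs; ival s i < k;
      seed (queries s) ((\<lambda>j. xs ! ints s a j) ` {..<ival s l}) (ival s i) = None\<rbrakk> \<Longrightarrow>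
    run xs d nbrs k seed (Seed a l r e i) s
      (tick (1 + ival s l) ((iwrite r (ival s e) 0 s)\<lparr>queries := queries s + 1\<rparr>))"
| Seed_Some: "\<lbrakk>\<forall>j < ival s l. ints s a j < length xs; ival s i < k; q < length xs;
      seed (queries s) ((\<lambda>j. xs ! ints s a j) ` {..<ival s l}) (ival s i) = Some (xs ! q)\<rbrakk> \<Longrightarrow>
    run xs d nbrs k seed (Seed a l r e i) s
      (tick (1 + ival s l) ((iwrite r (ival s e) (q + 1) s)\<lparr>queries := queries s + 1\<rparr>))"
| Seq: "\<lbrakk>run xs d nbrs k seed c s s'; run xs d nbrs k seed c' s' s''\<rbrakk> \<Longrightarrow>
    run xs d nbrs k seed (Seq c c') s s''"
| Cond_True: "\<lbrakk>bval s b; run xs d nbrs k seed c (tick 1 s) s'\<rbrakk> \<Longrightarrow>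
    run xs d nbrs k seed (Cond b c c') s s'"
| Cond_False: "\<lbrakk>\<not> bval s b; run xs d nbrs k seed c' (tick 1 s) s'\<rbrakk> \<Longrightarrow>
    run xs d nbrs k seed (Cond b c c') s s'"
| Loop_False: "\<not> bval s b \<Longrightarrow> run xs d nbrs k seed (Loop b c) s (tick 1 s)"
| Loop_True: "\<lbrakk>bval s b; run xs d nbrs k seed c (tick 1 s) s';
      run xs d nbrs k seed (Loop b c) s' s''\<rbrakk> \<Longrightarrow>
    run xs d nbrs k seed (Loop b c) s s''"

inductive_cases run_elims:
  "run xs d nbrs k seed Skip s t"
  "run xs d nbrs k seed (ISet a e f) s t"
  "run xs d nbrs k seed (DSet b e f) s t"
  "run xs d nbrs k seed (Dist b e x y) s t"
  "run xs d nbrs k seed (Neighbours a x) s t"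
  "run xs d nbrs k seed (Seed a l r e i) s t"
  "run xs d nbrs k seed (Seq c c') s t"
  "run xs d nbrs k seed (Cond b c c') s t"
  "run xs d nbrs k seed (Loop b c) s t"

lemma run_deterministic:
  assumes "distinct xs" "run xs d nbrs k seed c s t" "run xs d nbrs k seed c s t'"
  shows "t' = t"
  using assms(2,3)
proof (induction arbitrary: t' rule: run.induct)
  case Skip
  then show ?case by (rule run_elims(1)) simp
next
  case ISet
  then show ?case by (rule run_elims(2)) simp
next
  case DSet
  then show ?case by (rule run_elims(3)) simp
next
  case Dist
  from Dist.prems show ?case by (rule run_elims(4)) simp
next
  case Neighbours
  from Neighbours.prems show ?case by (rule run_elims(5)) simp
next
  case Seed_None
  from Seed_None.prems show ?case by (rule run_elims(6)) (use Seed_None.hyps in simp_all)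
next
  case Seed_Some
  from Seed_Some.prems show ?case
    by (rule run_elims(6))
      (use Seed_Some.hyps in \<open>simp_all add: nth_eq_iff_index_eq[OF assms(1)]\<close>)
next
  case Seq
  from Seq.prems show ?case by (rule run_elims(7)) (use Seq.IH in blast)
next
  case Cond_True
  from Cond_True.prems show ?case by (rule run_elims(8)) (use Cond_True.IH Cond_True.hyps(1) in simp_all)
next
  case Cond_False
  from Cond_False.prems show ?case by (rule run_elims(8)) (use Cond_False.IH Cond_False.hyps(1) in simp_all)
next
  case Loop_False
  from Loop_False.prems show ?case by (rule run_elims(9)) (use Loop_False in simp_all)
next
  case Loop_True
  from Loop_True.prems show ?case by (rule run_elims(9)) (use Loop_True.IH Loop_True.hyps(1) in simp_all)
qed

text \<open>The graph as it is presented to a program; the order of points and of edges is arbitrary.\<close>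

definition represents ::
  "'a list \<Rightarrow> (nat \<Rightarrow> nat list) \<Rightarrow> 'a set \<Rightarrow> ('a \<Rightarrow> 'a \<Rightarrow> ereal) \<Rightarrow> bool" where
  "represents xs nbrs X d \<longleftrightarrow>
     distinct xs \<and> set xs = X \<and>
     (\<forall>v < length xs. distinct (nbrs v) \<and>
        set (nbrs v) = {w. w < length xs \<and> {xs ! v, xs ! w} \<in> edges X d})"

definition initial_state :: "nat \<Rightarrow> nat \<Rightarrow> state" where
  "initial_state n k =
     iwrite 0 0 n (iwrite 0 1 k
       \<lparr>ints = (\<lambda>_ _. 0), dists = (\<lambda>_ _. 0), queries = 0, time = 0\<rparr>)"

text \<open>The radii are output in distance array \<open>0\<close>.\<close>

definition learns_radii ::
  "state \<Rightarrow> 'a set \<Rightarrow> ('a \<Rightarrow> 'a \<Rightarrow> ereal) \<Rightarrow> nat \<Rightarrow> (nat \<Rightarrow> 'a set) \<Rightarrow> bool" where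
  "learns_radii s X d k C \<longleftrightarrow> (\<forall>i<k. dists s 0 i = ereal (cluster_radius X d (C i)))"

end

theory Submission
  imports Defs
begin

text \<open>
  Since the inverse Ackermann function is at least \<open>1\<close> and a nonempty clustering has \<open>k \<ge> 1\<close>, Prim's
  algorithm with a hollow heap, which takes time \<open>O(m + n log n)\<close>, is fast enough. It need not output
  a spanning tree. If \<open>w i\<close> is the key with which the \<open>i\<close>-th vertex leaves the heap, then no edge below
  \<open>w i\<close> joins the first \<open>i\<close> vertices to the others. Hence the bottleneck distance of the vertices at
  positions \<open>a < c\<close> is the maximum of \<open>w\<close> on \<open>{a<..c}\<close>, also if the graph is disconnected, as \<open>w\<close> may be
  infinite.

  For each cluster, one query yields a seed. Growing an interval from its position across the
  smaller boundary weight lists all points by their bottleneck distance to the seed in linear time.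
  The radius is the largest bottleneck distance of a point of the cluster, which is found by
  bisection with queries for the sets of the points beyond a given rank.
\<close>

section \<open>Weakest preconditions of programs\<close>

text \<open>Bottleneck distance is an ultrametric, so the largest value from one seed to the points
  of a cluster equals the largest value between any two of them; this is why one seed per cluster
  suffices. The queries dominate the cost per cluster: each of the about log n rounds of bisection
  may read n cells, so a linear sweep around the seed fits the budget. The obstacle is the heap.
  Decreasing a key must take constant amortized time; making a fresh node and leaving a hollow one
  behind achieves this without parent pointers or cascading cuts. The forest and its credits do not
  exist in the machine: they are existentially quantified ghosts over the arrays, and only the total
  of the credits surfaces, as a potential worth 40 time units each. Node numbers are never reused,
  so ranks are logarithmic in the number of nodes ever made; this is at most n + n^2, which merely
  doubles the logarithm. The machine can neither multiply nor divide, hence ranks stored as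
  multiples of n and a table of halves.\<close>

locale machine =
  fixes xs :: "'a list" and d :: "'a \<Rightarrow> 'a \<Rightarrow> ereal" and nbrs :: "nat \<Rightarrow> nat list"
    and k :: nat and seed :: "'a seed_oracle"
begin

text \<open>Total correctness: a diverging or stuck program satisfies no postcondition. For distinct
  points the final state is unique by \<open>run_deterministic\<close>.\<close>

definition wp :: "com \<Rightarrow> (state \<Rightarrow> bool) \<Rightarrow> state \<Rightarrow> bool" where
  "wp c Q s \<longleftrightarrow> (\<exists>t. run xs d nbrs k seed c s t \<and> Q t)"

lemma wp_conseq: "wp c Q s \<Longrightarrow> (\<And>t. Q t \<Longrightarrow> Q' t) \<Longrightarrow> wp c Q' s"
  unfolding wp_def by blast

lemma wp_Skip [simp]: "wp Skip Q s \<longleftrightarrow> Q (tick 1 s)"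
  unfolding wp_def by (auto elim: run_elims intro: run.intros)

lemma wp_ISet [simp]: "wp (ISet a e f) Q s \<longleftrightarrow> Q (tick 1 (iwrite a (ival s e) (ival s f) s))"
  unfolding wp_def by (auto elim: run_elims intro: run.intros)

lemma wp_DSet [simp]: "wp (DSet a e f) Q s \<longleftrightarrow> Q (tick 1 (dwrite a (ival s e) (dval s f) s))"
  unfolding wp_def by (auto elim: run_elims intro: run.intros)

lemma wp_Dist [simp]:
  "wp (Dist b e x y) Q s \<longleftrightarrow> ival s x < length xs \<and> ival s y < length xs \<and>
     Q (tick 1 (dwrite b (ival s e) (d (xs ! ival s x) (xs ! ival s y)) s))"
  unfolding wp_def by (auto elim: run_elims intro: run.intros)

lemma wp_Neighbours [simp]:
  "wp (Neighbours a x) Q s \<longleftrightarrow> ival s x < length xs \<and>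
     Q (tick (1 + length (nbrs (ival s x))) (iwrite_list a (nbrs (ival s x)) s))"
  unfolding wp_def by (auto elim: run_elims intro: run.intros)

lemma wp_Seq [simp]: "wp (Seq c c') Q = wp c (wp c' Q)"
  unfolding wp_def fun_eq_iff by (auto elim!: run_elims intro: run.intros)

lemma wp_Cond [simp]:
  "wp (Cond b c c') Q s \<longleftrightarrow> (if bval s b then wp c Q (tick 1 s) else wp c' Q (tick 1 s))"
  unfolding wp_def by (auto elim!: run_elims(8) intro: run.intros(9,10)[simplified])

lemma wp_Loop_unfold:
  "wp (Loop b c) Q s \<longleftrightarrow> (if bval s b then wp c (wp (Loop b c) Q) (tick 1 s) else Q (tick 1 s))"
  unfolding wp_def
  by (auto elim: run_elims(9) intro: run.intros(11,12)[simplified])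

text \<open>The answer of the oracle is unknown, so the continuation has to be established for NIL
  and for every admissible point. An answer lies in the queried set and thus has a position, which
  keeps the program from getting stuck.\<close>

lemma wp_Seed:
  assumes "\<And>j. j < ival s l \<Longrightarrow> ints s a j < length xs" "ival s i < k" "set xs = X"
    and so: "seed_oracle_for X k C seed"
    and none: "(\<And>j. j < ival s l \<Longrightarrow> xs ! ints s a j \<notin> C (ival s i)) \<Longrightarrow>
      Q (tick (1 + ival s l) ((iwrite r (ival s e) 0 s)\<lparr>queries := queries s + 1\<rparr>))"
    and some: "\<And>q j. q < length xs \<Longrightarrow> j < ival s l \<Longrightarrow> xs ! q = xs ! ints s a j \<Longrightarrow> xs ! q \<in> C (ival s i) \<Longrightarrow>
      Q (tick (1 + ival s l) ((iwrite r (ival s e) (q + 1) s)\<lparr>queries := queries s + 1\<rparr>))"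
  shows "wp (Seed a l r e i) Q s"
proof -
  define S where "S = (\<lambda>j. xs ! ints s a j) ` {..<ival s l}"
  have "S \<subseteq> X" using assms(1,3) unfolding S_def by auto
  then have ans: "case seed (queries s) S (ival s i) of None \<Rightarrow> C (ival s i) \<inter> S = {} | Some p \<Rightarrow> p \<in> C (ival s i) \<inter> S"
    using so assms(2) unfolding seed_oracle_for_def by blast
  show ?thesis
  proof (cases "seed (queries s) S (ival s i)")
    case None
    then have "C (ival s i) \<inter> S = {}" using ans by simp
    then have "Q (tick (1 + ival s l) ((iwrite r (ival s e) 0 s)\<lparr>queries := queries s + 1\<rparr>))"
      by (intro none) (auto simp: S_def)
    moreover have "run xs d nbrs k seed (Seed a l r e i) s
      (tick (1 + ival s l) ((iwrite r (ival s e) 0 s)\<lparr>queries := queries s + 1\<rparr>))"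
      by (rule run.Seed_None) (use assms(1,2) None in \<open>auto simp: S_def\<close>)
    ultimately show ?thesis unfolding wp_def by blast
  next
    case (Some p)
    then have p: "p \<in> C (ival s i)" "p \<in> S" using ans by auto
    then obtain j where j: "j < ival s l" "p = xs ! ints s a j" by (auto simp: S_def)
    define q where "q = ints s a j"
    have q: "q < length xs" "p = xs ! q" using assms(1)[OF j(1)] j by (auto simp: q_def)
    have "Q (tick (1 + ival s l) ((iwrite r (ival s e) (q + 1) s)\<lparr>queries := queries s + 1\<rparr>))"
      by (rule some[OF q(1) j(1)]) (use p q j in auto)
    moreover have "run xs d nbrs k seed (Seed a l r e i) s
      (tick (1 + ival s l) ((iwrite r (ival s e) (q + 1) s)\<lparr>queries := queries s + 1\<rparr>))"
      by (rule run.Seed_Some) (use assms(1,2) Some q in \<open>auto simp: S_def\<close>)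
    ultimately show ?thesis unfolding wp_def by blast
  qed
qed

text \<open>The variant need not be a function of the state. This is needed for the credit total of
  the heap, of which the state only guarantees the existence, and for the number of remaining
  bisection rounds.\<close>

lemma wp_Loop_ghost:
  fixes I :: "nat \<Rightarrow> state \<Rightarrow> bool"
  assumes "I m s"
    and step: "\<And>m s. I m s \<Longrightarrow> bval s b \<Longrightarrow> wp c (\<lambda>s'. \<exists>m'<m. I m' s') (tick 1 s)"
    and final: "\<And>m s. I m s \<Longrightarrow> \<not> bval s b \<Longrightarrow> Q (tick 1 s)"
  shows "wp (Loop b c) Q s"
  using assms(1)
proof (induction m arbitrary: s rule: less_induct)
  case (less m)
  show ?case
  proof (cases "bval s b")
    case True
    have "wp c (wp (Loop b c) Q) (tick 1 s)"
      by (rule wp_conseq[OF step[OF less.prems True]]) (use less.IH in blast)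
    then show ?thesis using True wp_Loop_unfold[of b c Q s] by simp
  next
    case False
    then show ?thesis using final[OF less.prems False] wp_Loop_unfold[of b c Q s] by simp
  qed
qed

lemma wp_Loop:
  fixes \<mu> :: "state \<Rightarrow> nat"
  assumes "I s"
    and "\<And>s. I s \<Longrightarrow> bval s b \<Longrightarrow> wp c (\<lambda>s'. I s' \<and> \<mu> s' < \<mu> s) (tick 1 s)"
    and "\<And>s. I s \<Longrightarrow> \<not> bval s b \<Longrightarrow> Q (tick 1 s)"
  shows "wp (Loop b c) Q s"
proof (rule wp_Loop_ghost[where I = "\<lambda>m s. I s \<and> m = \<mu> s" and m = "\<mu> s"])
  fix m s assume "I s \<and> m = \<mu> s" "bval s b"
  then show "wp c (\<lambda>s'. \<exists>m'<m. I s' \<and> m' = \<mu> s') (tick 1 s)"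
    by (intro wp_conseq[OF assms(2)]) auto
qed (use assms in auto)

end

lemma state_simps [simp]:
  "ints (tick t s) = ints s" "dists (tick t s) = dists s"
  "queries (tick t s) = queries s" "time (tick t s) = time s + t"
  "dists (iwrite a j v s) = dists s"
  "queries (iwrite a j v s) = queries s" "time (iwrite a j v s) = time s"
  "ints (dwrite a j e s) = ints s"
  "queries (dwrite a j e s) = queries s" "time (dwrite a j e s) = time s"
  "dists (iwrite_list a l s) = dists s"
  "queries (iwrite_list a l s) = queries s" "time (iwrite_list a l s) = time s"
  by (simp_all add: tick_def iwrite_def dwrite_def iwrite_list_def)

lemma ints_iwrite [simp]: "ints (iwrite a j v s) b = (if b = a then (ints s a)(j := v) else ints s b)"
  by (simp add: iwrite_def)

lemma dists_dwrite [simp]: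
  "dists (dwrite a j e s) b = (if b = a then (dists s a)(j := e) else dists s b)"
  by (simp add: dwrite_def)

lemma ints_iwrite_list [simp]:
  "ints (iwrite_list a l s) b =
     (if b = a then (\<lambda>j. if j = 0 then length l else if j \<le> length l then l ! (j - 1) else ints s a j)
      else ints s b)"
  by (simp add: iwrite_list_def)

lemma queries_update_simps [simp]:
  "ints (s\<lparr>queries := c\<rparr>) = ints s" "dists (s\<lparr>queries := c\<rparr>) = dists s"
  "time (s\<lparr>queries := c\<rparr>) = time s"
  by simp_all

section \<open>Hollow heaps\<close>

text \<open>
  Nodes are numbered from \<open>1\<close>; those with \<open>F x\<close> are full, the others hollow. A root lies on the stack
  of roots or is held in the table of roots by rank. \<open>ch x j\<close> is the child of rank \<open>j\<close> of \<open>x\<close>.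
  When a key decreases, its node becomes hollow and keeps only its two children of highest rank.
\<close>

datatype location = Gone | Stacked | Held | Child nat

definition forest ::
  "nat \<Rightarrow> (nat \<Rightarrow> bool) \<Rightarrow> (nat \<Rightarrow> location) \<Rightarrow> (nat \<Rightarrow> nat) \<Rightarrow> (nat \<Rightarrow> ereal) \<Rightarrow> (nat \<Rightarrow> nat \<Rightarrow> nat) \<Rightarrow> bool"
  where
  "forest N F loc rnk ky ch \<longleftrightarrow>
     (\<forall>x. loc x \<noteq> Gone \<longrightarrow> 0 < x \<and> x \<le> N) \<and>
     (\<forall>x. F x \<longrightarrow> loc x \<noteq> Gone) \<and>
     (\<forall>x. loc x = Held \<longrightarrow> F x) \<and>
     (\<forall>x y. loc y = Child x \<longrightarrow> loc x \<noteq> Gone \<and> rnk y < rnk x \<and> ch x (rnk y) = y \<and> ky x \<le> ky y \<and>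
        (F x \<or> rnk x \<le> rnk y + 2)) \<and>
     (\<forall>x j. loc x \<noteq> Gone \<and> j < rnk x \<and> (F x \<or> rnk x \<le> j + 2) \<longrightarrow>
        loc (ch x j) = Child x \<and> rnk (ch x j) = j)"

lemma forestI:
  assumes "\<And>x. loc x \<noteq> Gone \<Longrightarrow> 0 < x \<and> x \<le> N"
    "\<And>x. F x \<Longrightarrow> loc x \<noteq> Gone"
    "\<And>x. loc x = Held \<Longrightarrow> F x"
    "\<And>x y. loc y = Child x \<Longrightarrow> loc x \<noteq> Gone \<and> rnk y < rnk x \<and> ch x (rnk y) = y \<and> ky x \<le> ky y \<and>
        (F x \<or> rnk x \<le> rnk y + 2)"
    "\<And>x j. loc x \<noteq> Gone \<Longrightarrow> j < rnk x \<Longrightarrow> F x \<or> rnk x \<le> j + 2 \<Longrightarrow>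
        loc (ch x j) = Child x \<and> rnk (ch x j) = j"
  shows "forest N F loc rnk ky ch"
  using assms unfolding forest_def by blast

lemma forestD:
  assumes "forest N F loc rnk ky ch"
  shows "loc x \<noteq> Gone \<Longrightarrow> 0 < x \<and> x \<le> N"
    "F x \<Longrightarrow> loc x \<noteq> Gone"
    "loc x = Held \<Longrightarrow> F x"
    "loc y = Child x \<Longrightarrow> loc x \<noteq> Gone \<and> rnk y < rnk x \<and> ch x (rnk y) = y \<and> ky x \<le> ky y \<and>
        (F x \<or> rnk x \<le> rnk y + 2)"
    "loc x \<noteq> Gone \<Longrightarrow> j < rnk x \<Longrightarrow> F x \<or> rnk x \<le> j + 2 \<Longrightarrow>
        loc (ch x j) = Child x \<and> rnk (ch x j) = j"
  using assms unfolding forest_def by blast+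

text \<open>Keys do not increase towards the root. \<open>forest\<close> has no explicit acyclicity
  clause; climbing ends because ranks strictly increase and are bounded on the finitely many
  nodes.\<close>

lemma forest_root_le:
  assumes "forest N F loc rnk ky ch" "loc x \<noteq> Gone"
    and "\<And>y. loc y = Stacked \<or> loc y = Held \<Longrightarrow> K \<le> ky y"
  shows "K \<le> ky x"
proof -
  obtain B where B: "\<And>y. loc y \<noteq> Gone \<Longrightarrow> rnk y \<le> B"
  proof
    fix y assume "loc y \<noteq> Gone"
    then have "y \<in> {..N}" using forestD(1)[OF assms(1)] by auto
    then show "rnk y \<le> Max (rnk ` {..N})" by simp
  qed
  show ?thesis
    using assms(2)
  proof (induction "B - rnk x" arbitrary: x rule: less_induct)
    case less
    show ?case
    proof (cases "loc x")
      case (Child y)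
      note c = forestD(4)[OF assms(1) Child]
      have "K \<le> ky y"
        by (rule less.hyps) (use c B[of y] in auto)
      then show ?thesis using c by auto
    qed (use less.prems assms(3) in auto)
  qed
qed

section \<open>Subtree sizes and the logarithmic bound on ranks\<close>

definition parent_rel :: "(nat \<Rightarrow> location) \<Rightarrow> (nat \<times> nat) set" where
  "parent_rel loc = {(a, b). loc a = Child b}"

lemma parent_rel_iff [simp]: "(a, b) \<in> parent_rel loc \<longleftrightarrow> loc a = Child b"
  by (simp add: parent_rel_def)

definition descendants :: "nat \<Rightarrow> (nat \<Rightarrow> location) \<Rightarrow> nat \<Rightarrow> nat set" where
  "descendants N loc x = {z \<in> {1..N}. (z, x) \<in> (parent_rel loc)\<^sup>*}"

text \<open>A node has one location and so at most one parent; hence the ancestors of a node form a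
  chain.\<close>

lemma parent_chain:
  assumes "(z, a) \<in> (parent_rel loc)\<^sup>*" "(z, b) \<in> (parent_rel loc)\<^sup>*"
  shows "(a, b) \<in> (parent_rel loc)\<^sup>* \<or> (b, a) \<in> (parent_rel loc)\<^sup>*"
  using assms
proof (induction rule: rtrancl_induct)
  case (step y w)
  then show ?case
    by (metis converse_rtranclE location.inject parent_rel_iff rtrancl.rtrancl_into_rtrancl)
qed simp

lemma rank_chain:
  assumes "forest N F loc rnk ky ch" "(a, b) \<in> (parent_rel loc)\<^sup>*"
  shows "a = b \<or> rnk a < rnk b"
  using assms(2)
proof (induction rule: rtrancl_induct)
  case (step y z)
  then show ?case using forestD(4)[OF assms(1), of y z] by auto
qed simp

text \<open>A common descendant would make the siblings comparable by \<open>parent_chain\<close>.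
  The path from the lower one to the other passes through their parent \<open>x\<close>, whose rank
  would then not exceed that of its own child.\<close>

lemma disjoint_siblings:
  assumes f: "forest N F loc rnk ky ch" and "loc a = Child x" "loc b = Child x" "a \<noteq> b"
  shows "descendants N loc a \<inter> descendants N loc b = {}"
proof -
  have False if "(a, b) \<in> (parent_rel loc)\<^sup>*" "a \<noteq> b" "loc a = Child x" "loc b = Child x" for a b
  proof -
    from that have "(x, b) \<in> (parent_rel loc)\<^sup>*"
      by (metis converse_rtranclE location.inject parent_rel_iff)
    then have "x = b \<or> rnk x < rnk b" by (rule rank_chain[OF f])
    then show False using forestD(4)[OF f that(4)] by auto
  qed
  with assms show ?thesis
    unfolding descendants_def using parent_chain[of _ a loc b] by blast
qed

text \<open>
  As the children of ranks \<open>r - 1\<close> and \<open>r - 2\<close> remain, sizes grow like the Fibonacci numbers.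
\<close>

lemma card_descendants:
  assumes f: "forest N F loc rnk ky ch"
  shows "loc x \<noteq> Gone \<Longrightarrow> 2 ^ (rnk x div 2) \<le> card (descendants N loc x)"
proof (induction "rnk x" arbitrary: x rule: less_induct)
  case less
  have fin: "finite (descendants N loc y)" for y unfolding descendants_def by simp
  have self: "x \<in> descendants N loc x"
    using forestD(1)[OF f less.prems] by (auto simp: descendants_def)
  show ?case
  proof (cases "rnk x < 2")
    case True
    then have "2 ^ (rnk x div 2) = (1::nat)" by (auto simp: less_2_cases_iff)
    moreover have "0 < card (descendants N loc x)"
      using self fin[of x] by (auto simp: card_gt_0_iff)
    ultimately show ?thesis by linarith
  next
    case False
    then obtain r where r: "rnk x = Suc (Suc r)"
      by (metis add_2_eq_Suc le_iff_add not_less)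
    define a b where "a = ch x (Suc r)" and "b = ch x r"
    have a: "loc a = Child x" "rnk a = Suc r" and b: "loc b = Child x" "rnk b = r"
      using forestD(5)[OF f less.prems, of "Suc r"] forestD(5)[OF f less.prems, of r]
      by (simp_all add: r a_def b_def)
    have sub: "descendants N loc y \<subseteq> descendants N loc x" if "loc y = Child x" for y
    proof
      fix z assume "z \<in> descendants N loc y"
      then show "z \<in> descendants N loc x"
        using rtrancl.rtrancl_into_rtrancl[of z y "parent_rel loc" x] that
        by (simp add: descendants_def)
    qed
    have "a \<noteq> b" using a b by auto
    have "2 ^ (r div 2) \<le> card (descendants N loc b)"
      using less.hyps[of b] b r by simp
    moreover have "2 ^ (Suc r div 2) \<le> card (descendants N loc a)"
      using less.hyps[of a] a r by simp
    \<comment> \<open>Both subtrees are bounded by the weaker exponent. Doubling every two ranks is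
      cruder than the growth by the golden ratio, but is still exponential.\<close>
    moreover have "(2::nat) ^ (r div 2) \<le> 2 ^ (Suc r div 2)"
      by (intro power_increasing div_le_mono) auto
    moreover have "card (descendants N loc a) + card (descendants N loc b)
        = card (descendants N loc a \<union> descendants N loc b)"
      using card_Un_disjoint[OF fin fin disjoint_siblings[OF f a(1) b(1) \<open>a \<noteq> b\<close>]] by simp
    moreover have "\<dots> \<le> card (descendants N loc x)"
      using sub[OF a(1)] sub[OF b(1)] by (intro card_mono fin) simp
    moreover have "(2::nat) ^ (rnk x div 2) = 2 * 2 ^ (r div 2)"
      by (simp add: r)
    ultimately show ?thesis by linarith
  qed
qed

text \<open>\<open>N\<close> counts all nodes ever created, hollow and deleted ones included; the
  bound is not in terms of the current size of the heap.\<close>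

lemma forest_rank_bound:
  assumes "forest N F loc rnk ky ch" "loc x \<noteq> Gone"
  shows "2 ^ (rnk x div 2) \<le> N"
proof -
  have "card (descendants N loc x) \<le> card {1..N}"
    by (rule card_mono) (auto simp: descendants_def)
  with card_descendants[OF assms] show ?thesis by simp
qed

text \<open>Every iteration of the consolidation of the heap consumes a credit.\<close>

definition credited :: "(nat \<Rightarrow> bool) \<Rightarrow> (nat \<Rightarrow> location) \<Rightarrow> (nat \<Rightarrow> nat) \<Rightarrow> bool" where
  "credited F loc cr \<longleftrightarrow>
     (\<forall>x. loc x \<noteq> Gone \<and> \<not> F x \<longrightarrow> 1 \<le> cr x) \<and>
     (\<forall>x. loc x = Held \<longrightarrow> 1 \<le> cr x) \<and>
     (\<forall>x. F x \<and> loc x = Stacked \<longrightarrow> 2 \<le> cr x) \<and>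
     (\<forall>x y. F x \<and> loc x = Child y \<and> \<not> F y \<longrightarrow> 2 \<le> cr x)"

section \<open>The heap operations on the abstract forest and their credits\<close>

lemma sum_upd:
  fixes f :: "nat \<Rightarrow> nat"
  assumes "a \<in> A" "finite A"
  shows "sum (f(a := v)) A + f a = sum f A + v"
  using assms by (simp add: sum.remove[of A a])

lemma sum_less_upd:
  fixes f :: "nat \<Rightarrow> nat"
  assumes "a \<in> A" "finite A" "v < f a"
  shows "sum (f(a := v)) A < sum f A"
  using sum_upd[OF assms(1,2), of f v] assms(3) by linarith

text \<open>The credit of the hollow root pays for its removal. Its children become stacked roots
  and need no new credits: full children of a hollow node already carry two, and hollow nodes always
  carry one.\<close>

lemma pop_hollow:
  assumes f: "forest N F loc rnk ky ch" and c: "credited F loc cr"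
    and x: "loc x = Stacked" "\<not> F x"
    and loc': "loc' = (\<lambda>y. if y = x then Gone else if loc y = Child x then Stacked else loc y)"
  shows "forest N F loc' rnk ky ch" "credited F loc' (cr(x := 0))"
    "sum (cr(x := 0)) {1..N} < sum cr {1..N}"
proof -
  show "forest N F loc' rnk ky ch"
  proof (rule forestI)
    fix y
    show "loc' y \<noteq> Gone \<Longrightarrow> 0 < y \<and> y \<le> N"
      using forestD(1)[OF f, of y] by (auto simp: loc' split: if_splits)
    show "F y \<Longrightarrow> loc' y \<noteq> Gone"
      using forestD(2)[OF f, of y] x by (auto simp: loc')
    show "loc' y = Held \<Longrightarrow> F y"
      using forestD(3)[OF f, of y] by (auto simp: loc' split: if_splits)
    fix z
    show "loc' y = Child z \<Longrightarrow> loc' z \<noteq> Gone \<and> rnk y < rnk z \<and> ch z (rnk y) = y \<and> ky z \<le> ky y \<and>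
        (F z \<or> rnk z \<le> rnk y + 2)"
      using forestD(4)[OF f, of y z] by (auto simp: loc' split: if_splits)
    show "loc' y \<noteq> Gone \<Longrightarrow> z < rnk y \<Longrightarrow> F y \<or> rnk y \<le> z + 2 \<Longrightarrow>
        loc' (ch y z) = Child y \<and> rnk (ch y z) = z"
      using forestD(5)[OF f, of y z] x by (auto simp: loc' split: if_splits)
  qed
  show "credited F loc' (cr(x := 0))"
    using c x by (auto simp: loc' credited_def split: if_splits)
  have "x \<in> {1..N}" using forestD(1)[OF f, of x] x by auto
  moreover have "1 \<le> cr x" using c x unfolding credited_def by auto
  ultimately show "sum (cr(x := 0)) {1..N} < sum cr {1..N}" by (intro sum_less_upd) auto
qed

text \<open>The shape of the forest does not depend on where a full root is kept; only the credits
  do.\<close>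

lemma forest_relocate:
  assumes f: "forest N F loc rnk ky ch" and "F x" "l = Stacked \<or> l = Held" "loc x = Stacked \<or> loc x = Held"
  shows "forest N F (loc(x := l)) rnk ky ch"
proof (rule forestI)
  fix y
  show "(loc(x := l)) y \<noteq> Gone \<Longrightarrow> 0 < y \<and> y \<le> N"
    using forestD(1)[OF f, of y] assms by (auto split: if_splits)
  show "F y \<Longrightarrow> (loc(x := l)) y \<noteq> Gone"
    using forestD(2)[OF f, of y] assms by auto
  show "(loc(x := l)) y = Held \<Longrightarrow> F y"
    using forestD(3)[OF f, of y] assms by (auto split: if_splits)
  fix z
  show "(loc(x := l)) y = Child z \<Longrightarrow> (loc(x := l)) z \<noteq> Gone \<and> rnk y < rnk z \<and> ch z (rnk y) = y \<and>
      ky z \<le> ky y \<and> (F z \<or> rnk z \<le> rnk y + 2)"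
    using forestD(4)[OF f, of y z] assms by (auto split: if_splits)
  show "(loc(x := l)) y \<noteq> Gone \<Longrightarrow> z < rnk y \<Longrightarrow> F y \<or> rnk y \<le> z + 2 \<Longrightarrow>
      (loc(x := l)) (ch y z) = Child y \<and> rnk (ch y z) = z"
    using forestD(5)[OF f, of y z] assms by (auto split: if_splits)
qed

text \<open>Of the two credits of a stacked full root, one pays for placing it in the table and the
  other stays with it for a later link.\<close>

lemma place_root:
  assumes f: "forest N F loc rnk ky ch" and c: "credited F loc cr"
    and x: "loc x = Stacked" "F x"
  shows "forest N F (loc(x := Held)) rnk ky ch" "credited F (loc(x := Held)) (cr(x := 1))"
    "sum (cr(x := 1)) {1..N} < sum cr {1..N}"
proof -
  show "forest N F (loc(x := Held)) rnk ky ch"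
    using forest_relocate[OF f, of x Held] x by simp
  show "credited F (loc(x := Held)) (cr(x := 1))"
    using c x by (auto simp: credited_def)
  have "x \<in> {1..N}" using forestD(1)[OF f, of x] x by auto
  moreover have "2 \<le> cr x" using c x unfolding credited_def by auto
  ultimately show "sum (cr(x := 1)) {1..N} < sum cr {1..N}" by (intro sum_less_upd) auto
qed

text \<open>A held root owns one credit and a stacked full one needs two, so returning it to the
  stack costs one.\<close>

lemma push_held:
  assumes f: "forest N F loc rnk ky ch" and c: "credited F loc cr"
    and x: "loc x = Held"
  shows "forest N F (loc(x := Stacked)) rnk ky ch" "credited F (loc(x := Stacked)) (cr(x := cr x + 1))"
    "sum (cr(x := cr x + 1)) {1..N} = sum cr {1..N} + 1"
proof -
  show "forest N F (loc(x := Stacked)) rnk ky ch"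
    using forest_relocate[OF f, of x Stacked] x forestD(3)[OF f] by simp
  show "credited F (loc(x := Stacked)) (cr(x := cr x + 1))"
    using c x by (auto simp: credited_def)
  have "x \<in> {1..N}" using forestD(1)[OF f, of x] x by auto
  then show "sum (cr(x := cr x + 1)) {1..N} = sum cr {1..N} + 1"
    using sum_upd[of x "{1..N}" cr "cr x + 1"] by simp
qed

text \<open>The held root brings one credit and the stacked root two. The winner goes back on the
  stack with two, and the loser needs none as the child of a full node, so one credit is left to pay
  for the link.\<close>

lemma link_roots:
  assumes f: "forest N F loc rnk ky ch" and c: "credited F loc cr"
    and x: "F w" "F l" "loc w = Stacked \<and> loc l = Held \<or> loc w = Held \<and> loc l = Stacked"
    and r: "rnk w = r" "rnk l = r" "ky w \<le> ky l"
    and loc': "loc' = loc(w := Stacked, l := Child w)"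
  shows "forest N F loc' (rnk(w := Suc r)) ky (ch(w := (ch w)(r := l)))"
    "credited F loc' (cr(l := 0, w := 2))"
    "sum (cr(l := 0, w := 2)) {1..N} < sum cr {1..N}"
proof -
  have ne: "w \<noteq> l" using x by auto
  show "forest N F loc' (rnk(w := Suc r)) ky (ch(w := (ch w)(r := l)))"
  proof (rule forestI)
    fix y
    show "loc' y \<noteq> Gone \<Longrightarrow> 0 < y \<and> y \<le> N"
      using forestD(1)[OF f, of y] x by (auto simp: loc' split: if_splits)
    show "F y \<Longrightarrow> loc' y \<noteq> Gone"
      using forestD(2)[OF f, of y] x by (auto simp: loc')
    show "loc' y = Held \<Longrightarrow> F y"
      using forestD(3)[OF f, of y] by (auto simp: loc' split: if_splits)
    fix z
    show "loc' y = Child z \<Longrightarrow> loc' z \<noteq> Gone \<and> (rnk(w := Suc r)) y < (rnk(w := Suc r)) z \<and>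
        (ch(w := (ch w)(r := l))) z ((rnk(w := Suc r)) y) = y \<and> ky z \<le> ky y \<and>
        (F z \<or> (rnk(w := Suc r)) z \<le> (rnk(w := Suc r)) y + 2)"
      using forestD(4)[OF f, of y z] x r ne by (auto simp: loc' split: if_splits)
    show "loc' y \<noteq> Gone \<Longrightarrow> z < (rnk(w := Suc r)) y \<Longrightarrow> F y \<or> (rnk(w := Suc r)) y \<le> z + 2 \<Longrightarrow>
        loc' ((ch(w := (ch w)(r := l))) y z) = Child y \<and>
        (rnk(w := Suc r)) ((ch(w := (ch w)(r := l))) y z) = z"
      using forestD(5)[OF f, of y z] forestD(2)[OF f, of l] x r ne
      by (cases "y = w \<and> z = r") (auto simp: loc' split: if_splits)
  qed
  show "credited F loc' (cr(l := 0, w := 2))"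
    using c x by (auto simp: loc' credited_def split: if_splits)
  have in_N: "w \<in> {1..N}" "l \<in> {1..N}" using forestD(1)[OF f, of w] forestD(1)[OF f, of l] x by auto
  have "3 \<le> cr w + cr l" using c x unfolding credited_def by fastforce
  then show "sum (cr(l := 0, w := 2)) {1..N} < sum cr {1..N}"
    using sum_upd[of w "{1..N}" "cr(l := 0)" 2] sum_upd[of l "{1..N}" cr 0] in_N ne by simp
qed

lemma sum_add_on:
  fixes f :: "nat \<Rightarrow> nat"
  assumes "finite A" "finite B"
  shows "(\<Sum>y\<in>A. if y \<in> B then f y + 2 else f y) \<le> sum f A + 2 * card B"
proof -
  have "(\<Sum>y\<in>A. if y \<in> B then f y + 2 else f y) = (\<Sum>y\<in>A. f y + (if y \<in> B then 2 else 0))"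
    by (rule sum.cong) auto
  also have "\<dots> = sum f A + 2 * card (A \<inter> B)"
    using assms by (simp add: sum.distrib sum.If_cases Int_def)
  also have "\<dots> \<le> sum f A + 2 * card B"
    using assms by (simp add: card_mono)
  finally show ?thesis .
qed

text \<open>Children of a full node may have no credits, but need two as stacked roots. There are at
  most \<open>rnk x\<close> of them, since distinct children have distinct ranks.\<close>

lemma extract_root:
  assumes f: "forest N F loc rnk ky ch" and c: "credited F loc cr"
    and x: "loc x = Held"
    and loc': "loc' = (\<lambda>y. if y = x then Gone else if loc y = Child x then Stacked else loc y)"
    and cr': "cr' = (\<lambda>y. if loc y = Child x then cr y + 2 else cr y)"
  shows "forest N (F(x := False)) loc' rnk ky ch" "credited (F(x := False)) loc' cr'"
    "sum cr' {1..N} \<le> sum cr {1..N} + 2 * rnk x"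
proof -
  have Fx: "F x" using forestD(3)[OF f x] .
  show "forest N (F(x := False)) loc' rnk ky ch"
  proof (rule forestI)
    fix y
    show "loc' y \<noteq> Gone \<Longrightarrow> 0 < y \<and> y \<le> N"
      using forestD(1)[OF f, of y] by (auto simp: loc' split: if_splits)
    show "(F(x := False)) y \<Longrightarrow> loc' y \<noteq> Gone"
      using forestD(2)[OF f, of y] by (auto simp: loc' split: if_splits)
    show "loc' y = Held \<Longrightarrow> (F(x := False)) y"
      using forestD(3)[OF f, of y] by (auto simp: loc' split: if_splits)
    fix z
    show "loc' y = Child z \<Longrightarrow> loc' z \<noteq> Gone \<and> rnk y < rnk z \<and> ch z (rnk y) = y \<and> ky z \<le> ky y \<and>
        ((F(x := False)) z \<or> rnk z \<le> rnk y + 2)"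
      using forestD(4)[OF f, of y z] by (auto simp: loc' split: if_splits)
    show "loc' y \<noteq> Gone \<Longrightarrow> z < rnk y \<Longrightarrow> (F(x := False)) y \<or> rnk y \<le> z + 2 \<Longrightarrow>
        loc' (ch y z) = Child y \<and> rnk (ch y z) = z"
      using forestD(5)[OF f, of y z] x by (auto simp: loc' split: if_splits)
  qed
  show "credited (F(x := False)) loc' cr'"
    using c by (auto simp: loc' cr' credited_def split: if_splits)
  have sub: "{y. loc y = Child x} \<subseteq> ch x ` {..<rnk x}"
    using forestD(4)[OF f, of _ x] by force
  then have "finite {y. loc y = Child x}" "card {y. loc y = Child x} \<le> rnk x"
    using finite_subset card_mono[OF _ sub] card_image_le[of "{..<rnk x}" "ch x"] by fastforce+
  then show "sum cr' {1..N} \<le> sum cr {1..N} + 2 * rnk x"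
    using sum_add_on[of "{1..N}" "{y. loc y = Child x}" cr] by (simp add: cr')
qed

lemma insert_root:
  assumes f: "forest N F loc rnk ky ch" and c: "credited F loc cr"
  shows "forest (Suc N) (F(Suc N := True)) (loc(Suc N := Stacked)) (rnk(Suc N := 0)) (ky(Suc N := K)) ch"
    "credited (F(Suc N := True)) (loc(Suc N := Stacked)) (cr(Suc N := 2))"
    "sum (cr(Suc N := 2)) {1..Suc N} = sum cr {1..N} + 2"
proof -
  have g: "loc (Suc N) = Gone" using forestD(1)[OF f, of "Suc N"] by auto
  have nc: "loc y \<noteq> Child (Suc N)" for y using forestD(4)[OF f, of y "Suc N"] g by auto
  show "forest (Suc N) (F(Suc N := True)) (loc(Suc N := Stacked)) (rnk(Suc N := 0)) (ky(Suc N := K)) ch"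
  proof (rule forestI)
    fix y
    show "(loc(Suc N := Stacked)) y \<noteq> Gone \<Longrightarrow> 0 < y \<and> y \<le> Suc N"
      using forestD(1)[OF f, of y] by (auto split: if_splits)
    show "(F(Suc N := True)) y \<Longrightarrow> (loc(Suc N := Stacked)) y \<noteq> Gone"
      using forestD(2)[OF f, of y] by (auto split: if_splits)
    show "(loc(Suc N := Stacked)) y = Held \<Longrightarrow> (F(Suc N := True)) y"
      using forestD(3)[OF f, of y] by (auto split: if_splits)
    fix z
    show "(loc(Suc N := Stacked)) y = Child z \<Longrightarrow> (loc(Suc N := Stacked)) z \<noteq> Gone \<and>
        (rnk(Suc N := 0)) y < (rnk(Suc N := 0)) z \<and> ch z ((rnk(Suc N := 0)) y) = y \<and>
        (ky(Suc N := K)) z \<le> (ky(Suc N := K)) y \<and>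
        ((F(Suc N := True)) z \<or> (rnk(Suc N := 0)) z \<le> (rnk(Suc N := 0)) y + 2)"
      using forestD(4)[OF f, of y z] nc[of y] by (auto split: if_splits)
    show "(loc(Suc N := Stacked)) y \<noteq> Gone \<Longrightarrow> z < (rnk(Suc N := 0)) y \<Longrightarrow>
        (F(Suc N := True)) y \<or> (rnk(Suc N := 0)) y \<le> z + 2 \<Longrightarrow>
        (loc(Suc N := Stacked)) (ch y z) = Child y \<and> (rnk(Suc N := 0)) (ch y z) = z"
      using forestD(5)[OF f, of y z] g by (auto split: if_splits)
  qed
  show "credited (F(Suc N := True)) (loc(Suc N := Stacked)) (cr(Suc N := 2))"
    using c nc by (auto simp: credited_def)
  show "sum (cr(Suc N := 2)) {1..Suc N} = sum cr {1..N} + 2"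
    by (simp add: sum.cong[of "{1..N}" "{1..N}" "cr(Suc N := 2)" cr])
qed

text \<open>The new node takes over all children but the two of highest rank, which remain under the
  now hollow \<open>u\<close>. Seven credits suffice: one for the hollow \<open>u\<close>, two for
  the new stacked root, and two for each of the at most two children left under a hollow parent. As
  a hollow node must not be held, \<open>u\<close> must not be either.\<close>

lemma decrease_node:
  assumes f: "forest N F loc rnk ky ch" and c: "credited F loc cr"
    and u: "F u" "loc u \<noteq> Held" "K \<le> ky u"
    and loc': "loc' = (\<lambda>y. if y = Suc N then Stacked
        else if loc y = Child u \<and> rnk y < q then Child (Suc N) else loc y)"
    and q: "q = rnk u - 2"
    and F': "F' = F(u := False, Suc N := True)"
    and cr': "cr' = (\<lambda>y. if y = Suc N then 2 else if y = u then cr y + 1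
        else if loc y = Child u \<and> q \<le> rnk y then cr y + 2 else cr y)"
  shows "forest (Suc N) F' loc' (rnk(Suc N := q)) (ky(Suc N := K)) (ch(Suc N := ch u))"
    "credited F' loc' cr'"
    "sum cr' {1..Suc N} \<le> sum cr {1..N} + 7"
proof -
  have q': "q \<le> rnk u" "rnk u \<le> q + 2" using q by linarith+
  have g: "loc (Suc N) = Gone" using forestD(1)[OF f, of "Suc N"] by auto
  have nc: "loc y \<noteq> Child (Suc N)" for y using forestD(4)[OF f, of y "Suc N"] g by auto
  have un: "u \<noteq> Suc N" using forestD(2)[OF f u(1)] g by auto
  have nu: "loc u \<noteq> Child u" using forestD(4)[OF f, of u u] by auto
  show "forest (Suc N) F' loc' (rnk(Suc N := q)) (ky(Suc N := K)) (ch(Suc N := ch u))"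
  proof (rule forestI)
    fix y
    show "loc' y \<noteq> Gone \<Longrightarrow> 0 < y \<and> y \<le> Suc N"
      using forestD(1)[OF f, of y] by (auto simp: loc' split: if_splits)
    show "F' y \<Longrightarrow> loc' y \<noteq> Gone"
      using forestD(2)[OF f, of y] by (auto simp: loc' F' split: if_splits)
    show "loc' y = Held \<Longrightarrow> F' y"
      using forestD(3)[OF f, of y] u by (auto simp: loc' F' split: if_splits)
    fix z
    show "loc' y = Child z \<Longrightarrow> loc' z \<noteq> Gone \<and>
        (rnk(Suc N := q)) y < (rnk(Suc N := q)) z \<and>
        (ch(Suc N := ch u)) z ((rnk(Suc N := q)) y) = y \<and>
        (ky(Suc N := K)) z \<le> (ky(Suc N := K)) y \<and>
        (F' z \<or> (rnk(Suc N := q)) z \<le> (rnk(Suc N := q)) y + 2)"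
    proof -
      assume y: "loc' y = Child z"
      then have yN: "y \<noteq> Suc N" by (auto simp: loc')
      show ?thesis
      proof (cases "loc y = Child u \<and> rnk y < q")
        case True
        then have "z = Suc N" using y yN by (simp add: loc')
        \<comment> \<open>Heap order for the inherited children: their keys are at least the old key
          of \<open>u\<close>, hence at least \<open>K\<close>.\<close>
        moreover have "K \<le> ky y" using forestD(4)[OF f, of y u] True u order_trans by blast
        ultimately show ?thesis
          using forestD(4)[OF f, of y u] True yN by (simp add: loc' F')
      next
        case False
        then have l: "loc y = Child z" using y yN by (simp add: loc' split: if_splits)
        then have "z \<noteq> Suc N" using nc[of y] by auto
        then show ?thesis
          using forestD(4)[OF f l] False l yN q'(2) by (auto simp: loc' F')
      qed
    qed
    show "loc' y \<noteq> Gone \<Longrightarrow> z < (rnk(Suc N := q)) y \<Longrightarrow>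
        F' y \<or> (rnk(Suc N := q)) y \<le> z + 2 \<Longrightarrow>
        loc' ((ch(Suc N := ch u)) y z) = Child y \<and>
        (rnk(Suc N := q)) ((ch(Suc N := ch u)) y z) = z"
    proof -
      assume y: "loc' y \<noteq> Gone" "z < (rnk(Suc N := q)) y" "F' y \<or> (rnk(Suc N := q)) y \<le> z + 2"
      show ?thesis
      proof (cases "y = Suc N")
        case True
        then have "loc (ch u z) = Child u \<and> rnk (ch u z) = z"
          using forestD(5)[OF f forestD(2)[OF f u(1)], of z] u(1) y q'(1) by simp
        then show ?thesis using True y g by (auto simp: loc')
      next
        case False
        then have ly: "loc y \<noteq> Gone" using y by (auto simp: loc' split: if_splits)
        have "loc (ch y z) = Child y \<and> rnk (ch y z) = z"
          using forestD(5)[OF f ly, of z] u(1) y False by (auto simp: F' split: if_splits)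
        \<comment> \<open>Once \<open>u\<close> is hollow, the forest requires only its children of
          the two top ranks, and exactly these were not moved.\<close>
        moreover have "q \<le> z" if "y = u" using that y un q'(2) q by (auto simp: F')
        ultimately show ?thesis using False g by (auto simp: loc')
      qed
    qed
  qed
  show "credited F' loc' cr'"
    using c un by (auto simp: loc' cr' F' credited_def split: if_splits)
  \<comment> \<open>These are the children that stay with \<open>u\<close>. They get two credits
    now, because later they turn into stacked roots when the hollow \<open>u\<close> is popped, and
    \<open>pop_hollow\<close> adds nothing.\<close>
  let ?B = "{y. loc y = Child u \<and> q \<le> rnk y}"
  have sub: "?B \<subseteq> ch u ` {q..<rnk u}"
    using forestD(4)[OF f, of _ u] by force
  have "card ?B \<le> card (ch u ` {q..<rnk u})" by (rule card_mono[OF _ sub]) simp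
  also have "\<dots> \<le> rnk u - q" using card_image_le[of "{q..<rnk u}" "ch u"] by simp
  also have "\<dots> \<le> 2" using q' by simp
  finally have B: "finite ?B" "card ?B \<le> 2"
    using finite_subset[OF sub] by simp_all
  have uN: "u \<in> {1..N}" using forestD(1)[OF f forestD(2)[OF f u(1)]] by simp
  have "sum cr' {1..Suc N} = sum cr' {1..N} + 2" by (simp add: cr')
  also have "sum cr' {1..N} = sum ((\<lambda>y. if y \<in> ?B then cr y + 2 else cr y)(u := cr u + 1)) {1..N}"
    by (rule sum.cong) (auto simp: cr')
  finally have "sum cr' {1..Suc N} + cr u =
      sum ((\<lambda>y. if y \<in> ?B then cr y + 2 else cr y)(u := cr u + 1)) {1..N} + cr u + 2" by simp
  also have "\<dots> = (\<Sum>y = 1..N. if y \<in> ?B then cr y + 2 else cr y) + (cr u + 1) + 2"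
    using sum_upd[OF uN, of "\<lambda>y. if y \<in> ?B then cr y + 2 else cr y" "cr u + 1"] nu by simp
  finally show "sum cr' {1..Suc N} \<le> sum cr {1..N} + 7"
    using sum_add_on[of "{1..N}" ?B cr] B by simp
qed

section \<open>Hollow heaps in arrays\<close>

text \<open>
  A full node is \<open>cur v\<close> for its vertex \<open>v\<close>. There is no multiplication, so the array \<open>rk\<close> holds ranks
  multiplied by the number \<open>n\<close> of vertices, which makes \<open>v + r * n\<close> an address for the child of rank \<open>r\<close>
  of the node of \<open>v\<close>. The children of a hollow node are in \<open>h1\<close> and \<open>h2\<close>, where \<open>0\<close> means none.
\<close>

definition couple ::
  "nat \<Rightarrow> nat \<Rightarrow> (nat \<Rightarrow> bool) \<Rightarrow> (nat \<Rightarrow> location) \<Rightarrow> (nat \<Rightarrow> nat) \<Rightarrow> (nat \<Rightarrow> ereal) \<Rightarrow> (nat \<Rightarrow> nat \<Rightarrow> nat)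
   \<Rightarrow> (nat \<Rightarrow> nat) \<Rightarrow> (nat \<Rightarrow> nat) \<Rightarrow> (nat \<Rightarrow> nat) \<Rightarrow> (nat \<Rightarrow> nat) \<Rightarrow> (nat \<Rightarrow> nat) \<Rightarrow> (nat \<Rightarrow> nat)
   \<Rightarrow> (nat \<Rightarrow> ereal) \<Rightarrow> (nat \<Rightarrow> nat) \<Rightarrow> bool" where
  "couple n N F loc rnk ky ch vert cur rk kid h1 h2 key pos \<longleftrightarrow>
     (\<forall>x. loc x \<noteq> Gone \<longrightarrow> vert x < n) \<and>
     (\<forall>x. F x \<longrightarrow> cur (vert x) = x \<and> pos (vert x) = 0 \<and> rk (vert x) = rnk x * n \<and> ky x = key (vert x) \<and>
        (\<forall>j<rnk x. kid (vert x + j * n) = ch x j)) \<and>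
     (\<forall>x. loc x \<noteq> Gone \<and> \<not> F x \<longrightarrow> cur (vert x) \<noteq> x \<and>
        h1 x = (if 1 \<le> rnk x then ch x (rnk x - 1) else 0) \<and>
        h2 x = (if 2 \<le> rnk x then ch x (rnk x - 2) else 0)) \<and>
     (\<forall>x. F x \<or> N < x \<longrightarrow> h1 x = 0 \<and> h2 x = 0) \<and>
     (\<forall>v<n. cur v \<le> N \<and> (cur v = 0 \<longrightarrow> rk v = 0)) \<and>
     (\<forall>v<n. cur v \<noteq> 0 \<and> pos v = 0 \<longrightarrow> F (cur v) \<and> vert (cur v) = v)"

lemma coupleD:
  assumes "couple n N F loc rnk ky ch vert cur rk kid h1 h2 key pos"
  shows "loc x \<noteq> Gone \<Longrightarrow> vert x < n"
    "F x \<Longrightarrow> cur (vert x) = x" "F x \<Longrightarrow> pos (vert x) = 0" "F x \<Longrightarrow> rk (vert x) = rnk x * n"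
    "F x \<Longrightarrow> ky x = key (vert x)" "F x \<Longrightarrow> j < rnk x \<Longrightarrow> kid (vert x + j * n) = ch x j"
    "loc x \<noteq> Gone \<Longrightarrow> \<not> F x \<Longrightarrow> cur (vert x) \<noteq> x"
    "loc x \<noteq> Gone \<Longrightarrow> \<not> F x \<Longrightarrow> h1 x = (if 1 \<le> rnk x then ch x (rnk x - 1) else 0)"
    "loc x \<noteq> Gone \<Longrightarrow> \<not> F x \<Longrightarrow> h2 x = (if 2 \<le> rnk x then ch x (rnk x - 2) else 0)"
    "F x \<or> N < x \<Longrightarrow> h1 x = 0 \<and> h2 x = 0"
    "v < n \<Longrightarrow> cur v \<le> N" "v < n \<Longrightarrow> cur v = 0 \<Longrightarrow> rk v = 0"
    "v < n \<Longrightarrow> cur v \<noteq> 0 \<Longrightarrow> pos v = 0 \<Longrightarrow> F (cur v) \<and> vert (cur v) = v"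
  using assms unfolding couple_def by blast+

lemma coupleI:
  assumes "\<And>x. loc x \<noteq> Gone \<Longrightarrow> vert x < n"
    "\<And>x. F x \<Longrightarrow> cur (vert x) = x \<and> pos (vert x) = 0 \<and> rk (vert x) = rnk x * n \<and> ky x = key (vert x)"
    "\<And>x j. F x \<Longrightarrow> j < rnk x \<Longrightarrow> kid (vert x + j * n) = ch x j"
    "\<And>x. loc x \<noteq> Gone \<Longrightarrow> \<not> F x \<Longrightarrow> cur (vert x) \<noteq> x \<and>
        h1 x = (if 1 \<le> rnk x then ch x (rnk x - 1) else 0) \<and>
        h2 x = (if 2 \<le> rnk x then ch x (rnk x - 2) else 0)"
    "\<And>x. F x \<or> N < x \<Longrightarrow> h1 x = 0 \<and> h2 x = 0"
    "\<And>v. v < n \<Longrightarrow> cur v \<le> N \<and> (cur v = 0 \<longrightarrow> rk v = 0)"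
    "\<And>v. v < n \<Longrightarrow> cur v \<noteq> 0 \<Longrightarrow> pos v = 0 \<Longrightarrow> F (cur v) \<and> vert (cur v) = v"
  shows "couple n N F loc rnk ky ch vert cur rk kid h1 h2 key pos"
  using assms unfolding couple_def by blast

text \<open>Cells from \<open>T\<close> on hold garbage. Injectivity ensures that popping a root
  leaves no second copy below.\<close>

definition on_stack :: "(nat \<Rightarrow> location) \<Rightarrow> nat \<Rightarrow> (nat \<Rightarrow> nat) \<Rightarrow> bool" where
  "on_stack loc T S \<longleftrightarrow> inj_on S {..<T} \<and> S ` {..<T} = {x. loc x = Stacked}"

text \<open>The candidate \<open>best\<close> for the minimum is held but has left its slot. Empty
  slots contain \<open>0\<close>. The mark \<open>mx\<close> is never lowered; it only bounds the
  addresses that have to be inspected.\<close>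

definition in_slots :: "nat \<Rightarrow> (nat \<Rightarrow> location) \<Rightarrow> (nat \<Rightarrow> nat) \<Rightarrow> (nat \<Rightarrow> nat) \<Rightarrow> nat \<Rightarrow> nat \<Rightarrow> bool" where
  "in_slots n loc rnk slot mx best \<longleftrightarrow>
     (\<forall>x. loc x = Held \<longrightarrow> x = best \<or> slot (rnk x * n) = x \<and> rnk x * n \<le> mx) \<and>
     (\<forall>r. slot (r * n) \<noteq> 0 \<longrightarrow> loc (slot (r * n)) = Held \<and> rnk (slot (r * n)) = r \<and> slot (r * n) \<noteq> best) \<and>
     (best \<noteq> 0 \<longrightarrow> loc best = Held)"

text \<open>The forest is hidden; of the ghosts only the credit total \<open>m\<close> is visible.
  The bound \<open>R\<close> on the ranks limits the sweep over the slots.\<close>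

definition heap ::
  "nat \<Rightarrow> nat \<Rightarrow> nat \<Rightarrow> nat \<Rightarrow> (nat \<Rightarrow> nat) \<Rightarrow> (nat \<Rightarrow> nat) \<Rightarrow> (nat \<Rightarrow> nat) \<Rightarrow> (nat \<Rightarrow> nat) \<Rightarrow> (nat \<Rightarrow> nat) \<Rightarrow> (nat \<Rightarrow> nat)
   \<Rightarrow> (nat \<Rightarrow> ereal) \<Rightarrow> (nat \<Rightarrow> nat) \<Rightarrow> nat \<Rightarrow> (nat \<Rightarrow> nat) \<Rightarrow> (nat \<Rightarrow> nat) \<Rightarrow> nat \<Rightarrow> nat \<Rightarrow> bool" where
  "heap n R N m vert cur rk kid h1 h2 key pos T S slot mx best \<longleftrightarrow>
     (\<exists>F loc rnk ky ch cr. forest N F loc rnk ky ch \<and> credited F loc cr \<and> sum cr {1..N} = m \<and>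
        couple n N F loc rnk ky ch vert cur rk kid h1 h2 key pos \<and> on_stack loc T S \<and>
        in_slots n loc rnk slot mx best) \<and>
     (\<exists>q\<le>R. mx = q * n)"

lemma heapI:
  assumes "forest N F loc rnk ky ch" "credited F loc cr" "sum cr {1..N} = m"
    "couple n N F loc rnk ky ch vert cur rk kid h1 h2 key pos" "on_stack loc T S"
    "in_slots n loc rnk slot mx best" "\<exists>q\<le>R. mx = q * n"
  shows "heap n R N m vert cur rk kid h1 h2 key pos T S slot mx best"
  unfolding heap_def
  by (intro conjI assms(7), rule exI[of _ F], rule exI[of _ loc], rule exI[of _ rnk], rule exI[of _ ky],
      rule exI[of _ ch], rule exI[of _ cr]) (use assms in simp)

lemma heapE:
  assumes "heap n R N m vert cur rk kid h1 h2 key pos T S slot mx best"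
  obtains F loc rnk ky ch cr where
    "forest N F loc rnk ky ch" "credited F loc cr" "sum cr {1..N} = m"
    "couple n N F loc rnk ky ch vert cur rk kid h1 h2 key pos" "on_stack loc T S"
    "in_slots n loc rnk slot mx best" "\<exists>q\<le>R. mx = q * n"
  using assms unfolding heap_def by (elim conjE exE) blast

lemma heap_empty:
  "heap n R 0 0 vert (\<lambda>_. 0) (\<lambda>_. 0) kid (\<lambda>_. 0) (\<lambda>_. 0) key pos 0 S (\<lambda>_. 0) 0 0"
  by (rule heapI[of 0 "\<lambda>_. False" "\<lambda>_. Gone" "\<lambda>_. 0" "\<lambda>_. 0" "\<lambda>_ _. 0" "\<lambda>_. 0"])
    (simp_all add: forest_def credited_def couple_def on_stack_def in_slots_def exI[of _ 0])

text \<open>The number \<open>v + i * n\<close> has the last digit \<open>v\<close> in base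
  \<open>n\<close>, so the child arrays of different vertices do not overlap.\<close>

lemma index_unique:
  fixes v w i j n :: nat
  assumes "v < n" "w < n" "v + i * n = w + j * n"
  shows "v = w \<and> i = j"
proof -
  have "v mod n = w mod n" using arg_cong[OF assms(3), of "\<lambda>x. x mod n"] by simp
  then have "v = w" using assms(1,2) by simp
  moreover from this have "i * n = j * n" using assms(3) by simp
  ultimately show ?thesis using assms(1) by simp
qed

lemma on_stack_pop:
  assumes "on_stack loc T S" "0 < T"
  shows "loc (S (T - 1)) = Stacked" "on_stack (loc(S (T - 1) := Held)) (T - 1) S"
proof -
  have T: "{..<T} = insert (T - 1) {..<T - 1}" using assms(2) by auto
  show 1: "loc (S (T - 1)) = Stacked" using assms unfolding on_stack_def T by blast
  have ne: "S i \<noteq> S (T - 1)" if "i < T - 1" for i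
    using assms that unfolding on_stack_def inj_on_def
    by (metis Suc_pred' lessI lessThan_iff less_SucI nat_neq_iff)
  have "S ` {..<T - 1} = {x. loc x = Stacked} - {S (T - 1)}"
    using assms(1) ne unfolding on_stack_def T by auto
  then show "on_stack (loc(S (T - 1) := Held)) (T - 1) S"
    using assms(1) unfolding on_stack_def by (auto intro: inj_on_subset)
qed

lemma on_stack_push:
  assumes "on_stack loc T S" "loc x \<noteq> Stacked"
  shows "on_stack (loc(x := Stacked)) (Suc T) (S(T := x))"
proof -
  have "x \<notin> S ` {..<T}" using assms unfolding on_stack_def by auto
  moreover have "(S(T := x)) ` {..<Suc T} = insert x (S ` {..<T})"
    by (auto simp: lessThan_Suc image_def split: if_splits)
  moreover have "inj_on (S(T := x)) {..<Suc T}"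
    using assms(1) \<open>x \<notin> S ` {..<T}\<close> unfolding on_stack_def inj_on_def lessThan_Suc by auto
  ultimately show ?thesis using assms(1) unfolding on_stack_def by auto
qed

lemma on_stack_cong:
  assumes "on_stack loc T S" "\<And>i. i < T \<Longrightarrow> S' i = S i" "\<And>x. loc' x = Stacked \<longleftrightarrow> loc x = Stacked"
  shows "on_stack loc' T S'"
  using assms unfolding on_stack_def by (auto simp: inj_on_def image_def)

lemma on_stack_append:
  assumes s: "on_stack loc T S" and "\<And>i. i < T \<Longrightarrow> S' i = S i" "inj_on g {..<q}"
    and "\<And>i. i < q \<Longrightarrow> S' (T + i) = g i" "\<And>i. i < q \<Longrightarrow> loc (g i) \<noteq> Stacked"
    and "\<And>x. loc' x = Stacked \<longleftrightarrow> loc x = Stacked \<or> x \<in> g ` {..<q}"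
  shows "on_stack loc' (T + q) S'"
  using assms(3-6)
proof (induction q arbitrary: loc')
  case 0
  then show ?case using on_stack_cong[OF s assms(2), of loc'] by simp
next
  case (Suc q)
  have 1: "on_stack (\<lambda>x. if x \<in> g ` {..<q} then Stacked else loc x) (T + q) S'"
    by (rule Suc.IH) (use Suc.prems in \<open>auto simp: inj_on_def\<close>)
  have "g q \<notin> g ` {..<q}"
    using inj_onD[OF Suc.prems(1), of q] by fastforce
  then have "on_stack ((\<lambda>x. if x \<in> g ` {..<q} then Stacked else loc x)(g q := Stacked)) (Suc (T + q)) (S'(T + q := g q))"
    by (intro on_stack_push[OF 1]) (use Suc.prems(3)[of q] in auto)
  then show ?case
    unfolding add_Suc_right
    by (rule on_stack_cong) (use Suc.prems(2)[of q] Suc.prems(4) in \<open>auto simp: lessThan_Suc\<close>)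
qed

section \<open>The heap operations on the array representation\<close>

text \<open>A node is recognized as hollow by not being the current node of its vertex. Its at most
  two children can be read off \<open>h1\<close> and \<open>h2\<close>; the first one overwrites the
  popped cell.\<close>

lemma heap_pop_hollow:
  assumes h: "heap n R N m vert cur rk kid h1 h2 key pos T S slot mx best"
    and T: "0 < T" and x: "x = S (T - 1)" "cur (vert x) \<noteq> x"
    and S': "\<And>i. i < T - 1 \<Longrightarrow> S' i = S i" "0 < h1 x \<Longrightarrow> S' (T - 1) = h1 x"
      "0 < h2 x \<Longrightarrow> S' (T - 1 + (if 0 < h1 x then 1 else 0)) = h2 x"
    and T': "T' = T - 1 + (if 0 < h1 x then 1 else 0) + (if 0 < h2 x then 1 else 0)"
  shows "\<exists>m'<m. heap n R N m' vert cur rk kid h1 h2 key pos T' S' slot mx best"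
proof -
  from h obtain F loc rnk ky ch cr where
    f: "forest N F loc rnk ky ch" and c: "credited F loc cr" and m: "sum cr {1..N} = m" and
    cp: "couple n N F loc rnk ky ch vert cur rk kid h1 h2 key pos" and st: "on_stack loc T S" and
    sl: "in_slots n loc rnk slot mx best" and q: "\<exists>q\<le>R. mx = q * n"
    by (rule heapE)
  note pop = on_stack_pop[OF st T, folded x(1)]
  have nF: "\<not> F x" using coupleD(2)[OF cp] x by auto
  define loc' where "loc' = (\<lambda>y. if y = x then Gone else if loc y = Child x then Stacked else loc y)"
  note p = pop_hollow[OF f c pop(1) nF loc'_def]
  have lx: "loc x \<noteq> Gone" using pop by simp
  note h12 = coupleD(8,9)[OF cp lx nF]
  have k1: "loc (ch x (rnk x - 1)) = Child x" "rnk (ch x (rnk x - 1)) = rnk x - 1" if "1 \<le> rnk x"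
    using forestD(5)[OF f lx, of "rnk x - 1"] that by simp_all
  have k2: "loc (ch x (rnk x - 2)) = Child x" "rnk (ch x (rnk x - 2)) = rnk x - 2" if "2 \<le> rnk x"
    using forestD(5)[OF f lx, of "rnk x - 2"] that by (simp_all add: numeral_2_eq_2 Suc_diff_Suc)
  \<comment> \<open>Nodes are numbered from one, so a stored child is never mistaken for the absence
    of one.\<close>
  have pos1: "0 < h1 x \<longleftrightarrow> 1 \<le> rnk x" using h12 k1 forestD(1)[OF f, of "ch x (rnk x - 1)"] by auto
  have pos2: "0 < h2 x \<longleftrightarrow> 2 \<le> rnk x" using h12 k2 forestD(1)[OF f, of "ch x (rnk x - 2)"] by auto
  \<comment> \<open>A hollow node has no children besides those of its two top ranks, so the two
    cells list all of them.\<close>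
  have kids: "loc y = Child x \<longleftrightarrow> 0 < h1 x \<and> y = h1 x \<or> 0 < h2 x \<and> y = h2 x" for y
  proof
    assume y: "loc y = Child x"
    from forestD(4)[OF f y] nF have "rnk y < rnk x" "ch x (rnk y) = y" "rnk x \<le> rnk y + 2" by auto
    then have "rnk y = rnk x - 1 \<and> 1 \<le> rnk x \<or> rnk y = rnk x - 2 \<and> 2 \<le> rnk x" by linarith
    then show "0 < h1 x \<and> y = h1 x \<or> 0 < h2 x \<and> y = h2 x"
      using h12 pos1 pos2 \<open>ch x (rnk y) = y\<close> by auto
  next
    assume "0 < h1 x \<and> y = h1 x \<or> 0 < h2 x \<and> y = h2 x"
    then show "loc y = Child x" using h12 k1 k2 pos1 pos2 by auto
  qed
  have ne: "h1 x \<noteq> h2 x" if "2 \<le> rnk x" using that k1 k2 h12 by auto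
  have st': "on_stack loc' T' S'"
  proof -
    define g where "g = (\<lambda>i::nat. if i = 0 then h1 x else h2 x)"
    define q where "q = (if 2 \<le> rnk x then 2 else if 1 \<le> rnk x then 1 else (0::nat))"
    have "on_stack loc' (T - 1 + q) S'"
    proof (rule on_stack_append[OF pop(2), where g = g])
      show "inj_on g {..<q}" using ne by (auto simp: g_def q_def inj_on_def)
      show "S' (T - 1 + i) = g i" if "i < q" for i
        using that S'(2,3) pos1 pos2 by (auto simp: g_def q_def less_2_cases_iff split: if_splits)
      show "(loc(x := Held)) (g i) \<noteq> Stacked" if "i < q" for i
        using that kids[of "g i"] pos1 pos2 by (auto simp: g_def q_def split: if_splits)
      show "loc' y = Stacked \<longleftrightarrow> (loc(x := Held)) y = Stacked \<or> y \<in> g ` {..<q}" for y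
      proof -
        have "y \<in> g ` {..<q} \<longleftrightarrow> loc y = Child x"
          unfolding kids by (auto simp: g_def q_def pos1 pos2 lessThan_Suc numeral_2_eq_2)
        then show ?thesis using lx by (auto simp: loc'_def pop(1))
      qed
    qed (use S'(1) in auto)
    moreover have "T' = T - 1 + q" unfolding T' q_def using pos1 pos2 by auto
    ultimately show ?thesis by simp
  qed
  have cp': "couple n N F loc' rnk ky ch vert cur rk kid h1 h2 key pos"
  proof (rule coupleI)
    fix y assume "loc' y \<noteq> Gone"
    then have y: "loc y \<noteq> Gone" by (auto simp: loc'_def split: if_splits)
    show "vert y < n" using coupleD(1)[OF cp y] .
    assume "\<not> F y"
    then show "cur (vert y) \<noteq> y \<and> h1 y = (if 1 \<le> rnk y then ch y (rnk y - 1) else 0) \<and>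
        h2 y = (if 2 \<le> rnk y then ch y (rnk y - 2) else 0)"
      using coupleD(7,8,9)[OF cp y] by blast
  qed (use coupleD[OF cp] in blast)+
  have sl': "in_slots n loc' rnk slot mx best"
    using sl pop(1) unfolding in_slots_def loc'_def by (auto split: if_splits)
  show ?thesis
    using heapI[OF p(1,2) refl cp' st' sl' q] p(3) m by blast
qed

lemma heap_place:
  assumes h: "heap n R N m vert cur rk kid h1 h2 key pos T S slot mx best"
    and T: "0 < T" and x: "x = S (T - 1)" "cur (vert x) = x"
    and e: "slot (rk (vert x)) = 0" and b: "best = 0"
    and R: "\<And>r. 2 ^ (r div 2) \<le> N \<Longrightarrow> r \<le> R"
    and mx': "mx' = (if mx < rk (vert x) then rk (vert x) else mx)"
  shows "\<exists>m'<m. heap n R N m' vert cur rk kid h1 h2 key pos (T - 1) S (slot(rk (vert x) := x)) mx' best"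
proof -
  from h obtain F loc rnk ky ch cr where
    f: "forest N F loc rnk ky ch" and c: "credited F loc cr" and m: "sum cr {1..N} = m" and
    cp: "couple n N F loc rnk ky ch vert cur rk kid h1 h2 key pos" and st: "on_stack loc T S" and
    sl: "in_slots n loc rnk slot mx best" and q: "\<exists>q\<le>R. mx = q * n"
    by (rule heapE)
  note pop = on_stack_pop[OF st T, folded x(1)]
  have lx: "loc x \<noteq> Gone" using pop by simp
  have F: "F x" using coupleD(7)[OF cp lx] x by blast
  have n: "0 < n" using coupleD(1)[OF cp lx] by simp
  note rk = coupleD(4)[OF cp F]
  note p = place_root[OF f c pop(1) F]
  have "couple n N F (loc(x := Held)) rnk ky ch vert cur rk kid h1 h2 key pos"
    by (rule coupleI) (use coupleD[OF cp] lx in \<open>auto split: if_splits\<close>)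
  moreover have "in_slots n (loc(x := Held)) rnk (slot(rk (vert x) := x)) mx' best"
    unfolding in_slots_def
  proof (intro conjI allI impI)
    fix z assume z: "(loc(x := Held)) z = Held"
    have "z = best \<or> slot (rnk z * n) = z \<and> rnk z * n \<le> mx \<and> z \<noteq> 0" if "z \<noteq> x"
      using sl z that forestD(1)[OF f, of z] unfolding in_slots_def by auto
    moreover have "mx \<le> mx'" "rnk x * n \<le> mx'" using rk by (auto simp: mx')
    ultimately show "z = best \<or> (slot(rk (vert x) := x)) (rnk z * n) = z \<and> rnk z * n \<le> mx'"
      using e rk by (cases "z = x") auto
  next
    fix q assume "(slot(rk (vert x) := x)) (q * n) \<noteq> 0"
    then have "q = rnk x \<or> q * n \<noteq> rk (vert x) \<and> slot (q * n) \<noteq> 0"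
      using n rk by (auto split: if_splits)
    then show "(loc(x := Held)) ((slot(rk (vert x) := x)) (q * n)) = Held"
      "rnk ((slot(rk (vert x) := x)) (q * n)) = q" "(slot(rk (vert x) := x)) (q * n) \<noteq> best"
      using sl rk b forestD(1)[OF f lx] unfolding in_slots_def by auto
  qed (use b in auto)
  \<comment> \<open>The logarithmic rank bound enters here and keeps every sweep over the table
    short.\<close>
  moreover have "\<exists>q\<le>R. mx' = q * n"
    using q R[OF forest_rank_bound[OF f lx]] rk unfolding mx' by auto
  ultimately show ?thesis
    using heapI[OF p(1,2) refl _ pop(2)] p(3) m by blast
qed

text \<open>The winner returns to the cell from which \<open>x\<close> was popped, so the height of
  the stack is unchanged; progress shows only in the credits. The rank grows by one, that is, the
  stored value by \<open>n\<close>.\<close>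

lemma heap_link:
  assumes h: "heap n R N m vert cur rk kid h1 h2 key pos T S slot mx best"
    and T: "0 < T" and x: "x = S (T - 1)" "cur (vert x) = x"
    and y: "y = slot (rk (vert x))" "0 < y" and b: "best = 0"
    and wl: "w = x \<and> l = y \<or> w = y \<and> l = x" "key (vert w) \<le> key (vert l)"
  shows "\<exists>m'<m. heap n R N m' vert cur (rk(vert w := rk (vert x) + n)) (kid(vert w + rk (vert x) := l))
    h1 h2 key pos T (S(T - 1 := w)) (slot(rk (vert x) := 0)) mx best"
proof -
  from h obtain F loc rnk ky ch cr where
    f: "forest N F loc rnk ky ch" and c: "credited F loc cr" and m: "sum cr {1..N} = m" and
    cp: "couple n N F loc rnk ky ch vert cur rk kid h1 h2 key pos" and st: "on_stack loc T S" and
    sl: "in_slots n loc rnk slot mx best" and q: "\<exists>q\<le>R. mx = q * n"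
    by (rule heapE)
  note pop = on_stack_pop[OF st T, folded x(1)]
  have lx: "loc x \<noteq> Gone" using pop by simp
  have F: "F x" using coupleD(7)[OF cp lx] x by blast
  have n: "0 < n" using coupleD(1)[OF cp lx] by simp
  note rk = coupleD(4)[OF cp F]
  have ly: "loc y = Held" "rnk y = rnk x"
    using sl rk y unfolding in_slots_def by auto
  then have Fy: "F y" using forestD(3)[OF f] by blast
  define r where "r = rnk x"
  have W: "F w" "F l" "loc w = Stacked \<and> loc l = Held \<or> loc w = Held \<and> loc l = Stacked"
    "rnk w = r" "rnk l = r" using wl F Fy pop(1) ly by (auto simp: r_def)
  have ky: "ky w \<le> ky l" using wl(2) coupleD(5)[OF cp] W by simp
  define loc' where "loc' = loc(w := Stacked, l := Child w)"
  note p = link_roots[OF f c W ky loc'_def]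
  have wne: "w \<noteq> l" using W by auto
  \<comment> \<open>A vertex has at most one full node. Thus changing the rank and the children
    stored for the vertex of \<open>w\<close> affects no other full node.\<close>
  have inj: "vert a = vert b \<longleftrightarrow> a = b" if "F a" "F b" for a b
    using coupleD(2)[OF cp that(1)] coupleD(2)[OF cp that(2)] by metis
  have vn: "vert a < n" if "F a" for a using coupleD(1)[OF cp forestD(2)[OF f that]] .
  have cp': "couple n N F loc' (rnk(w := Suc r)) ky (ch(w := (ch w)(r := l)))
      vert cur (rk(vert w := rk (vert x) + n)) (kid(vert w + rk (vert x) := l)) h1 h2 key pos"
  proof (rule coupleI)
    fix z
    { assume "loc' z \<noteq> Gone"
      then have z: "loc z \<noteq> Gone" using W by (auto simp: loc'_def split: if_splits)
      show "vert z < n" using coupleD(1)[OF cp z] .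
      assume "\<not> F z"
      then show "cur (vert z) \<noteq> z \<and>
          h1 z = (if 1 \<le> (rnk(w := Suc r)) z then (ch(w := (ch w)(r := l))) z ((rnk(w := Suc r)) z - 1) else 0) \<and>
          h2 z = (if 2 \<le> (rnk(w := Suc r)) z then (ch(w := (ch w)(r := l))) z ((rnk(w := Suc r)) z - 2) else 0)"
        using coupleD(7,8,9)[OF cp z] W by auto }
    { assume Fz: "F z"
      then show "cur (vert z) = z \<and> pos (vert z) = 0 \<and>
          (rk(vert w := rk (vert x) + n)) (vert z) = (rnk(w := Suc r)) z * n \<and> ky z = key (vert z)"
        using coupleD(2-5)[OF cp Fz] inj[OF Fz W(1)] rk by (auto simp: r_def)
      fix j assume "j < (rnk(w := Suc r)) z"
      then show "(kid(vert w + rk (vert x) := l)) (vert z + j * n) = (ch(w := (ch w)(r := l))) z j"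
        using coupleD(6)[OF cp Fz, of j] index_unique[OF vn[OF Fz] vn[OF W(1)], of j r] inj[OF Fz W(1)] W
        by (auto simp: rk r_def[symmetric] less_Suc_eq split: if_splits) }
    show "F z \<or> N < z \<Longrightarrow> h1 z = 0 \<and> h2 z = 0" using coupleD(10)[OF cp] .
    show "z < n \<Longrightarrow> cur z \<le> N \<and> (cur z = 0 \<longrightarrow> (rk(vert w := rk (vert x) + n)) z = 0)"
      using coupleD(11,12)[OF cp, of z] coupleD(2)[OF cp W(1)] forestD(1)[OF f forestD(2)[OF f W(1)]] by auto
    show "z < n \<Longrightarrow> cur z \<noteq> 0 \<Longrightarrow> pos z = 0 \<Longrightarrow> F (cur z) \<and> vert (cur z) = z"
      using coupleD(13)[OF cp] .
  qed
  have "on_stack loc' T (S(T - 1 := w))"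
  proof -
    have "on_stack ((loc(x := Held))(w := Stacked)) (Suc (T - 1)) (S(T - 1 := w))"
      by (rule on_stack_push[OF pop(2)]) (use W wl pop(1) ly in auto)
    then have "on_stack ((loc(x := Held))(w := Stacked)) T (S(T - 1 := w))" using T by simp
    then show ?thesis
      by (rule on_stack_cong) (use wl W wne pop(1) ly in \<open>auto simp: loc'_def\<close>)
  qed
  moreover have "in_slots n loc' (rnk(w := Suc r)) (slot(rk (vert x) := 0)) mx best"
    unfolding in_slots_def
  proof (intro conjI allI impI)
    fix z assume "loc' z = Held"
    then have z: "loc z = Held" "z \<noteq> w" "z \<noteq> l" by (auto simp: loc'_def split: if_splits)
    then have zs: "z = best \<or> slot (rnk z * n) = z \<and> rnk z * n \<le> mx" using sl unfolding in_slots_def by blast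
    have "z \<noteq> 0" using forestD(1)[OF f, of z] z by auto
    moreover have "z \<noteq> y" using z wl by auto
    ultimately show "z = best \<or> (slot(rk (vert x) := 0)) ((rnk(w := Suc r)) z * n) = z \<and> (rnk(w := Suc r)) z * n \<le> mx"
      using zs z b y(1) by auto
  next
    fix q assume "(slot(rk (vert x) := 0)) (q * n) \<noteq> 0"
    then have 1: "slot (q * n) \<noteq> 0" "q * n \<noteq> rk (vert x)" by (auto split: if_splits)
    then have 2: "loc (slot (q * n)) = Held" "rnk (slot (q * n)) = q"
      using sl unfolding in_slots_def by blast+
    then have "slot (q * n) \<noteq> y" "slot (q * n) \<noteq> x" using ly 1 rk pop(1) by auto
    then show "loc' ((slot(rk (vert x) := 0)) (q * n)) = Held"
      "(rnk(w := Suc r)) ((slot(rk (vert x) := 0)) (q * n)) = q"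
      "(slot(rk (vert x) := 0)) (q * n) \<noteq> best"
      using 1 2 wl b by (auto simp: loc'_def)
  qed (use b in auto)
  ultimately show ?thesis
    using heapI[OF p(1,2) refl cp' _ _ q] p(3) m by blast
qed

lemma heap_slot_full:
  assumes h: "heap n R N m vert cur rk kid h1 h2 key pos T S slot mx best" and x: "0 < slot (r * n)"
  shows "cur (vert (slot (r * n))) = slot (r * n)" "slot (r * n) \<noteq> best"
proof -
  from h obtain F loc rnk ky ch cr where
    f: "forest N F loc rnk ky ch" and
    cp: "couple n N F loc rnk ky ch vert cur rk kid h1 h2 key pos" and
    sl: "in_slots n loc rnk slot mx best"
    by (rule heapE)
  have held: "loc (slot (r * n)) = Held" and ne: "slot (r * n) \<noteq> best"
    using sl x unfolding in_slots_def by auto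
  show "cur (vert (slot (r * n))) = slot (r * n)"
    using coupleD(2)[OF cp forestD(3)[OF f held]] .
  show "slot (r * n) \<noteq> best" by (rule ne)
qed

text \<open>Covers all outcomes of moving one slot entry towards \<open>best\<close>. Keys are not
  compared here: either of two competing roots may win, and minimality is tracked separately. Only a
  root that goes back to the stack costs a credit.\<close>

lemma heap_hold:
  assumes h: "heap n R N m vert cur rk kid h1 h2 key pos T S slot mx best"
    and n: "0 < n" and x: "x = slot (r * n)"
    and T': "0 < x \<Longrightarrow> 0 < best \<Longrightarrow> T' = T + 1 \<and> S' = S(T := if best' = x then best else x)"
      "x = 0 \<or> best = 0 \<Longrightarrow> T' = T \<and> S' = S"
    and best': "x = 0 \<Longrightarrow> best' = best" "0 < x \<Longrightarrow> best = 0 \<Longrightarrow> best' = x" "best' = best \<or> best' = x"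
  shows "\<exists>m'\<le>m + 1. heap n R N m' vert cur rk kid h1 h2 key pos T' S' (slot(r * n := 0)) mx best'"
proof -
  from h obtain F loc rnk ky ch cr where
    f: "forest N F loc rnk ky ch" and c: "credited F loc cr" and m: "sum cr {1..N} = m" and
    cp: "couple n N F loc rnk ky ch vert cur rk kid h1 h2 key pos" and st: "on_stack loc T S" and
    sl: "in_slots n loc rnk slot mx best" and q: "\<exists>q\<le>R. mx = q * n"
    by (rule heapE)
  have lx: "loc x = Held \<and> rnk x = r \<and> x \<noteq> best" if "0 < x"
    using sl that x unfolding in_slots_def by auto
  have lb: "loc best = Held" if "0 < best"
    using sl that unfolding in_slots_def by auto
  have inj: "slot (q * n) = x \<Longrightarrow> 0 < x \<Longrightarrow> q = r" for q
    using sl lx unfolding in_slots_def by auto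
  show "\<exists>m'\<le>m + 1. heap n R N m' vert cur rk kid h1 h2 key pos T' S' (slot(r * n := 0)) mx best'"
  proof (cases "0 < x \<and> 0 < best")
    case False
    have "in_slots n loc rnk (slot(r * n := 0)) mx best'"
    proof (cases "x = 0")
      case True
      then show ?thesis using sl x best'(1) by (auto simp: fun_upd_idem)
    next
      case F2: False
      then have 1: "best = 0" "best' = x" using False best'(2) by auto
      have nz: "z \<noteq> 0" if "loc z = Held" for z using forestD(1)[OF f, of z] that by auto
      show ?thesis
        unfolding in_slots_def
      proof (intro conjI allI impI)
        fix z assume z: "loc z = Held"
        then show "z = best' \<or> (slot(r * n := 0)) (rnk z * n) = z \<and> rnk z * n \<le> mx"
          using sl 1 nz[OF z] x unfolding in_slots_def by auto
      next
        fix q assume a: "(slot(r * n := 0)) (q * n) \<noteq> 0"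
        then have "slot (q * n) \<noteq> x" using inj[of q] F2 by (auto split: if_splits)
        then show "loc ((slot(r * n := 0)) (q * n)) = Held" "rnk ((slot(r * n := 0)) (q * n)) = q"
          "(slot(r * n := 0)) (q * n) \<noteq> best'"
          using sl a 1 unfolding in_slots_def by (auto split: if_splits)
      qed (use lx F2 1 in auto)
    qed
    from heapI[OF f c m cp st this q] show ?thesis using T'(2) False by (intro exI[of _ m]) auto
  next
    case True
    define l where "l = (if best' = x then best else x)"
    have l: "loc l = Held" "l \<noteq> best'" and b': "loc best' = Held" "best' \<noteq> 0"
      using lx lb True best'(3) by (auto simp: l_def)
    have bl: "z = best' \<or> z = l \<longleftrightarrow> z = x \<or> z = best" for z using True best'(3) by (auto simp: l_def)
    note p = push_held[OF f c l(1)]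
    have lg: "F l" using forestD(3)[OF f l(1)] .
    have "couple n N F (loc(l := Stacked)) rnk ky ch vert cur rk kid h1 h2 key pos"
      by (rule coupleI) (use coupleD[OF cp] l lg in \<open>auto split: if_splits\<close>)
    moreover have "on_stack (loc(l := Stacked)) T' S'"
      using on_stack_push[OF st, of l] l T'(1) True by (simp add: l_def)
    moreover have "in_slots n (loc(l := Stacked)) rnk (slot(r * n := 0)) mx best'"
      unfolding in_slots_def
    proof (intro conjI allI impI)
      fix z assume z: "(loc(l := Stacked)) z = Held"
      then have "loc z = Held" "z \<noteq> l" by (auto split: if_splits)
      moreover have "z \<noteq> x" if "z \<noteq> best'" using bl[of z] that calculation by auto
      moreover have "z \<noteq> best" if "z \<noteq> best'" using bl[of z] that calculation by auto
      moreover have "z = best \<or> slot (rnk z * n) = z \<and> rnk z * n \<le> mx"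
        using sl calculation(1) unfolding in_slots_def by blast
      ultimately show "z = best' \<or> (slot(r * n := 0)) (rnk z * n) = z \<and> rnk z * n \<le> mx"
        using x by (cases "rnk z * n = r * n") auto
    next
      fix q assume a: "(slot(r * n := 0)) (q * n) \<noteq> 0"
      then have "slot (q * n) \<noteq> x" using inj[of q] True by (auto split: if_splits)
      moreover have "slot (q * n) \<noteq> best" using sl a unfolding in_slots_def by (auto split: if_splits)
      ultimately have "slot (q * n) \<noteq> best'" "slot (q * n) \<noteq> l" using bl[of "slot (q * n)"] by auto
      then show "(loc(l := Stacked)) ((slot(r * n := 0)) (q * n)) = Held" "rnk ((slot(r * n := 0)) (q * n)) = q"
        "(slot(r * n := 0)) (q * n) \<noteq> best'"
        using sl a unfolding in_slots_def by (auto split: if_splits)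
    qed (use b' l in auto)
    ultimately show ?thesis using heapI[OF p(1,2) refl _ _ _ q] p(3) m by auto
  qed
qed

text \<open>With all slots empty, every root is \<open>best\<close> or lies on the stack, where it
  is full and its key is at least that of \<open>best\<close>. Heap order carries the bound to all
  nodes.\<close>

lemma heap_minimum:
  assumes h: "heap n R N m vert cur rk kid h1 h2 key pos T S slot mx best"
    and e: "\<And>r. r * n \<le> mx \<Longrightarrow> slot (r * n) = 0"
    and S: "\<And>i. i < T \<Longrightarrow> cur (vert (S i)) = S i \<and> 0 < best \<and> key (vert best) \<le> key (vert (S i))"
    and v: "v < n" "cur v \<noteq> 0" "pos v = 0"
  shows "0 < best" "key (vert best) \<le> key v"
proof -
  from h obtain F loc rnk ky ch cr where
    f: "forest N F loc rnk ky ch" and c: "credited F loc cr" and m: "sum cr {1..N} = m" and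
    cp: "couple n N F loc rnk ky ch vert cur rk kid h1 h2 key pos" and st: "on_stack loc T S" and
    sl: "in_slots n loc rnk slot mx best" and q: "\<exists>q\<le>R. mx = q * n"
    by (rule heapE)
  note cv = coupleD(13)[OF cp v]
  then have lv: "loc (cur v) \<noteq> Gone" using forestD(2)[OF f] by blast
  have held: "y = best" if "loc y = Held" for y
  proof -
    have "y \<noteq> 0" using forestD(1)[OF f, of y] that by auto
    then show ?thesis using sl e[of "rnk y"] that unfolding in_slots_def by metis
  qed
  have root: "0 < best \<and> key (vert best) \<le> ky y" if y: "loc y = Stacked \<or> loc y = Held" for y
  proof (cases "loc y = Held")
    case True
    then show ?thesis
      using held[OF True] coupleD(5)[OF cp forestD(3)[OF f True]] forestD(1)[OF f, of y] by auto
  next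
    case False
    then obtain i where i: "i < T" "y = S i" using st y unfolding on_stack_def by blast
    have "F y" using coupleD(7)[OF cp, of y] S[OF i(1)] i(2) y by fastforce
    then show ?thesis using coupleD(5)[OF cp] S[OF i(1)] i(2) by auto
  qed
  have "key (vert best) \<le> ky (cur v)"
    by (rule forest_root_le[OF f lv]) (use root in blast)
  then show "key (vert best) \<le> key v" using coupleD(5)[OF cp, of "cur v"] cv by auto
  show "0 < best"
  proof (rule ccontr)
    assume "\<not> 0 < best"
    then have "loc y \<noteq> Stacked \<and> loc y \<noteq> Held" for y using root by blast
    \<comment> \<open>A nonempty forest has a root: with all keys set to \<open>0\<close> it stays
      heap ordered, and without roots \<open>forest_root_le\<close> would hold vacuously for the
      bound \<open>1\<close>.\<close>
    moreover have "forest N F loc rnk (\<lambda>_. 0) ch"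
      by (rule forestI) (use forestD[OF f] in \<open>blast | simp\<close>)+
    ultimately have "1 \<le> (0::ereal)"
      using forest_root_le[of N F loc rnk "\<lambda>_. 0" ch "cur v" 1] lv by blast
    then show False by simp
  qed
qed

lemma heap_slots_empty:
  assumes h: "heap n R N m vert cur rk kid h1 h2 key pos T S slot mx best"
    and e: "\<And>r. r * n \<le> mx \<Longrightarrow> slot (r * n) = 0"
  shows "slot (r * n) = 0"
proof (rule ccontr)
  from h obtain F loc rnk ky ch cr where sl: "in_slots n loc rnk slot mx best" by (rule heapE)
  assume "slot (r * n) \<noteq> 0"
  then have "loc (slot (r * n)) = Held" "rnk (slot (r * n)) = r" "slot (r * n) \<noteq> best"
    using sl unfolding in_slots_def by blast+
  then have "r * n \<le> mx" using sl unfolding in_slots_def by metis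
  then show False using e[of r] \<open>slot (r * n) \<noteq> 0\<close> by simp
qed

text \<open>The new stack and the position \<open>p\<close> stay universally quantified, as the
  program produces them only after the rank is known. Marking the vertex by a nonzero position lifts
  the demand that its current node be full.\<close>

lemma heap_extract:
  assumes h: "heap n R N m vert cur rk kid h1 h2 key pos T S slot mx best"
    and e: "\<And>r. slot (r * n) = 0" and b: "0 < best"
    and R: "\<And>r. 2 ^ (r div 2) \<le> N \<Longrightarrow> r \<le> R"
  obtains q where "vert best < n" "cur (vert best) = best" "pos (vert best) = 0"
    "rk (vert best) = q * n" "q \<le> R"
    "\<And>p S'. 0 < p \<Longrightarrow> (\<And>i. i < T \<Longrightarrow> S' i = S i) \<Longrightarrow>
      (\<And>i. i < q \<Longrightarrow> S' (T + i) = kid (vert best + i * n)) \<Longrightarrow>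
      \<exists>m'\<le>m + 2 * R. heap n R N m' vert cur rk kid h1 h2 key (pos(vert best := p)) (T + q) S' slot mx 0"
proof -
  from h obtain F loc rnk ky ch cr where
    f: "forest N F loc rnk ky ch" and c: "credited F loc cr" and m: "sum cr {1..N} = m" and
    cp: "couple n N F loc rnk ky ch vert cur rk kid h1 h2 key pos" and st: "on_stack loc T S" and
    sl: "in_slots n loc rnk slot mx best" and mx: "\<exists>q\<le>R. mx = q * n"
    by (rule heapE)
  have lb: "loc best = Held" using sl b unfolding in_slots_def by simp
  then have lg: "loc best \<noteq> Gone" by simp
  have F: "F best" using forestD(3)[OF f lb] .
  have held: "y = best" if "loc y = Held" for y
  proof -
    have "y \<noteq> 0" using forestD(1)[OF f, of y] that by auto
    then show ?thesis using sl e[of "rnk y"] that unfolding in_slots_def by metis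
  qed
  define loc' where "loc' = (\<lambda>y. if y = best then Gone else if loc y = Child best then Stacked else loc y)"
  define cr' where "cr' = (\<lambda>y. if loc y = Child best then cr y + 2 else cr y)"
  note p = extract_root[OF f c lb loc'_def cr'_def]
  have rb: "rnk best \<le> R" using R forest_rank_bound[OF f lg] by blast
  show thesis
  proof (rule that)
    show "vert best < n" "cur (vert best) = best" "pos (vert best) = 0" "rk (vert best) = rnk best * n"
      using coupleD(1)[OF cp lg] coupleD(2,3,4)[OF cp F] by auto
    show "rnk best \<le> R" by (rule rb)
    fix p :: nat and S' assume p0: "0 < p" and S': "\<And>i. i < T \<Longrightarrow> S' i = S i"
      "\<And>i. i < rnk best \<Longrightarrow> S' (T + i) = kid (vert best + i * n)"
    have kids: "loc (ch best j) = Child best \<and> rnk (ch best j) = j" if "j < rnk best" for j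
      using forestD(5)[OF f lg that] F by simp
    have cp': "couple n N (F(best := False)) loc' rnk ky ch vert cur rk kid h1 h2 key (pos(vert best := p))"
    proof (rule coupleI)
      fix z
      have inj: "vert z \<noteq> vert best" if "F z" "z \<noteq> best"
        using coupleD(2)[OF cp that(1)] coupleD(2)[OF cp F] that(2) by metis
      { assume "loc' z \<noteq> Gone"
        then have z: "loc z \<noteq> Gone" "z \<noteq> best" by (auto simp: loc'_def split: if_splits)
        show "vert z < n" using coupleD(1)[OF cp z(1)] .
        assume "\<not> (F(best := False)) z"
        then show "cur (vert z) \<noteq> z \<and> h1 z = (if 1 \<le> rnk z then ch z (rnk z - 1) else 0) \<and>
            h2 z = (if 2 \<le> rnk z then ch z (rnk z - 2) else 0)"
          using coupleD(7,8,9)[OF cp z(1)] z(2) by simp }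
      { assume "(F(best := False)) z"
        then have z: "F z" "z \<noteq> best" by (auto split: if_splits)
        show "cur (vert z) = z \<and> (pos(vert best := p)) (vert z) = 0 \<and> rk (vert z) = rnk z * n \<and> ky z = key (vert z)"
          using coupleD(2-5)[OF cp z(1)] inj[OF z] by simp
        fix j assume "j < rnk z"
        then show "kid (vert z + j * n) = ch z j" using coupleD(6)[OF cp z(1)] by blast }
      show "(F(best := False)) z \<or> N < z \<Longrightarrow> h1 z = 0 \<and> h2 z = 0"
        using coupleD(10)[OF cp, of z] by (auto split: if_splits)
      show "z < n \<Longrightarrow> cur z \<le> N \<and> (cur z = 0 \<longrightarrow> rk z = 0)"
        using coupleD(11,12)[OF cp, of z] by auto
      assume z: "z < n" "cur z \<noteq> 0" "(pos(vert best := p)) z = 0"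
      then have "z \<noteq> vert best" "pos z = 0" using p0 by (auto split: if_splits)
      then show "(F(best := False)) (cur z) \<and> vert (cur z) = z"
        using coupleD(13)[OF cp z(1,2)] by auto
    qed
    have "on_stack loc' (T + rnk best) S'"
    proof (rule on_stack_append[OF st S'(1), where g = "ch best"])
      show "inj_on (ch best) {..<rnk best}" using kids by (auto simp: inj_on_def) metis
      show "S' (T + i) = ch best i" if "i < rnk best" for i
        using S'(2)[OF that] coupleD(6)[OF cp F that] by simp
      show "loc (ch best i) \<noteq> Stacked" if "i < rnk best" for i using kids[OF that] by simp
      show "loc' y = Stacked \<longleftrightarrow> loc y = Stacked \<or> y \<in> ch best ` {..<rnk best}" for y
      proof -
        have "loc y = Child best \<longleftrightarrow> y \<in> ch best ` {..<rnk best}"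
          using kids forestD(4)[OF f, of y best] by force
        then show ?thesis using lb forestD(4)[OF f, of best best] by (auto simp: loc'_def)
      qed
    qed
    moreover have "in_slots n loc' rnk slot mx 0"
      unfolding in_slots_def using held e by (auto simp: loc'_def split: if_splits)
    moreover have "sum cr' {1..N} \<le> m + 2 * R" using p(3) m rb by simp
    ultimately show "\<exists>m'\<le>m + 2 * R. heap n R N m' vert cur rk kid h1 h2 key (pos(vert best := p)) (T + rnk best) S' slot mx 0"
      using heapI[OF p(1,2) refl cp' _ _ mx] by blast
  qed
qed

text \<open>Insertion and decrease are one operation. For a vertex without a node the stored rank is
  \<open>0\<close>, so nothing is written to \<open>h1\<close> and \<open>h2\<close> and the
  truncated rank stays \<open>0\<close>. Empty slots and \<open>best = 0\<close> mean that no root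
  is held, as \<open>decrease_node\<close> requires.\<close>

lemma heap_put:
  assumes h: "heap n R N m vert cur rk kid h1 h2 key pos T S slot mx 0"
    and e: "\<And>r. slot (r * n) = 0"
    and u: "u < n" "pos u = 0" "0 < cur u \<Longrightarrow> K \<le> key u"
    and h1': "h1' = (if 0 < rk u then h1(cur u := kid (u + (rk u - n))) else h1)"
    and h2': "h2' = (if n < rk u then h2(cur u := kid (u + (rk u - (n + n)))) else h2)"
  shows "\<exists>m'\<le>m + 7. heap n R (Suc N) m' (vert(Suc N := u)) (cur(u := Suc N)) (rk(u := rk u - (n + n)))
    kid h1' h2' (key(u := K)) pos (Suc T) (S(T := Suc N)) slot mx 0"
proof -
  from h obtain F loc rnk ky ch cr where
    f: "forest N F loc rnk ky ch" and c: "credited F loc cr" and m: "sum cr {1..N} = m" and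
    cp: "couple n N F loc rnk ky ch vert cur rk kid h1 h2 key pos" and st: "on_stack loc T S" and
    sl: "in_slots n loc rnk slot mx 0" and mx: "\<exists>q\<le>R. mx = q * n"
    by (rule heapE)
  have nh: "loc y \<noteq> Held" for y
  proof
    assume y: "loc y = Held"
    then have "y \<noteq> 0" using forestD(1)[OF f, of y] by auto
    then show False using sl e[of "rnk y"] y unfolding in_slots_def by metis
  qed
  have g: "loc (Suc N) = Gone" using forestD(1)[OF f, of "Suc N"] by auto
  have FN: "\<not> F (Suc N)" using forestD(2)[OF f, of "Suc N"] g by auto
  show ?thesis
  proof (cases "cur u = 0")
    case True
    note p = insert_root(1)[OF f c, of K] insert_root(2,3)[OF f c]
    have rk0: "rk u = 0" using coupleD(12)[OF cp u(1) True] .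
    have neu: "vert z \<noteq> u" if "F z" for z
      using coupleD(2)[OF cp that] True forestD(1)[OF f forestD(2)[OF f that]] by auto
    have "couple n (Suc N) (F(Suc N := True)) (loc(Suc N := Stacked)) (rnk(Suc N := 0)) (ky(Suc N := K)) ch
        (vert(Suc N := u)) (cur(u := Suc N)) (rk(u := rk u - (n + n))) kid h1' h2' (key(u := K)) pos"
    proof (rule coupleI)
      fix z
      { assume z0: "(loc(Suc N := Stacked)) z \<noteq> Gone"
        then show "(vert(Suc N := u)) z < n" using coupleD(1)[OF cp, of z] u(1) by (auto split: if_splits)
        assume "\<not> (F(Suc N := True)) z"
        then have z: "\<not> F z" "z \<noteq> Suc N" "loc z \<noteq> Gone" using z0 by (auto split: if_splits)
        show "(cur(u := Suc N)) ((vert(Suc N := u)) z) \<noteq> z \<and>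
          h1' z = (if 1 \<le> (rnk(Suc N := 0)) z then ch z ((rnk(Suc N := 0)) z - 1) else 0) \<and>
          h2' z = (if 2 \<le> (rnk(Suc N := 0)) z then ch z ((rnk(Suc N := 0)) z - 2) else 0)"
          using coupleD(7,8,9)[OF cp z(3,1)] z(2) by (simp add: h1' h2' rk0) }
      { assume z: "(F(Suc N := True)) z"
        then show "(cur(u := Suc N)) ((vert(Suc N := u)) z) = z \<and> pos ((vert(Suc N := u)) z) = 0 \<and>
          (rk(u := rk u - (n + n))) ((vert(Suc N := u)) z) = (rnk(Suc N := 0)) z * n \<and>
          (ky(Suc N := K)) z = (key(u := K)) ((vert(Suc N := u)) z)"
          using coupleD(2-5)[OF cp, of z] neu[of z] u rk0 by (cases "z = Suc N") simp_all
        fix j assume "j < (rnk(Suc N := 0)) z"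
        then show "kid ((vert(Suc N := u)) z + j * n) = ch z j"
          using coupleD(6)[OF cp, of z j] z by (auto split: if_splits) }
      show "(F(Suc N := True)) z \<or> Suc N < z \<Longrightarrow> h1' z = 0 \<and> h2' z = 0"
        using coupleD(10)[OF cp, of z] by (auto simp: h1' h2' rk0 split: if_splits)
      show "z < n \<Longrightarrow> (cur(u := Suc N)) z \<le> Suc N \<and> ((cur(u := Suc N)) z = 0 \<longrightarrow> (rk(u := rk u - (n + n))) z = 0)"
        using coupleD(11,12)[OF cp, of z] by auto
      show "z < n \<Longrightarrow> (cur(u := Suc N)) z \<noteq> 0 \<Longrightarrow> pos z = 0 \<Longrightarrow>
          (F(Suc N := True)) ((cur(u := Suc N)) z) \<and> (vert(Suc N := u)) ((cur(u := Suc N)) z) = z"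
        using coupleD(13)[OF cp, of z] coupleD(11)[OF cp, of z] by auto
    qed
    moreover have "on_stack (loc(Suc N := Stacked)) (Suc T) (S(T := Suc N))"
      by (rule on_stack_push[OF st]) (simp add: g)
    moreover have "in_slots n (loc(Suc N := Stacked)) (rnk(Suc N := 0)) slot mx 0"
      unfolding in_slots_def using nh e by auto
    ultimately have "heap n R (Suc N) (m + 2) (vert(Suc N := u)) (cur(u := Suc N)) (rk(u := rk u - (n + n)))
        kid h1' h2' (key(u := K)) pos (Suc T) (S(T := Suc N)) slot mx 0"
      using heapI[OF p(1,2)] p(3) m mx by simp
    then show ?thesis by (intro exI[of _ "m + 2"]) simp
  next
    case False
    define a where "a = cur u"
    have Fo: "F a" "vert a = u" using coupleD(13)[OF cp u(1) False u(2)] by (auto simp: a_def)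
    have ko: "K \<le> ky a" using u(3) False coupleD(5)[OF cp Fo(1)] Fo by simp
    have rko: "rk u = rnk a * n" using coupleD(4)[OF cp Fo(1)] Fo by simp
    have kido: "kid (u + j * n) = ch a j" if "j < rnk a" for j
      using coupleD(6)[OF cp Fo(1) that] Fo by simp
    define q where "q = rnk a - 2"
    define loc' where "loc' = (\<lambda>y. if y = Suc N then Stacked
        else if loc y = Child a \<and> rnk y < q then Child (Suc N) else loc y)"
    define F' where "F' = F(a := False, Suc N := True)"
    define cr' where "cr' = (\<lambda>y. if y = Suc N then 2 else if y = a then cr y + 1
        else if loc y = Child a \<and> q \<le> rnk y then cr y + 2 else cr y)"
    note p = decrease_node[OF f c Fo(1) nh ko loc'_def q_def F'_def cr'_def]
    have oN: "a \<noteq> Suc N" "a \<le> N" using FN Fo forestD(1)[OF f forestD(2)[OF f Fo(1)]] by auto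
    have neu: "vert z \<noteq> u" if "F z" "z \<noteq> a" for z
      using coupleD(2)[OF cp that(1)] that(2) by (auto simp: a_def)
    \<comment> \<open>Truncated subtraction commutes with the scaling by \<open>n\<close>, also for
      ranks below two.\<close>
    have rkq: "rk u - (n + n) = q * n" unfolding rko q_def by (simp add: diff_mult_distrib)
    have n: "0 < n" using u by simp
    have h1o: "h1' a = (if 1 \<le> rnk a then ch a (rnk a - 1) else 0)"
    proof (cases "rnk a = 0")
      case True
      then show ?thesis using coupleD(10)[OF cp, of a] Fo by (simp add: h1' rko)
    next
      case False
      then have "u + (rk u - n) = u + (rnk a - 1) * n" by (simp add: rko diff_mult_distrib)
      then show ?thesis using kido[of "rnk a - 1"] False n by (simp add: h1' rko a_def[symmetric])
    qed
    have h2o: "h2' a = (if 2 \<le> rnk a then ch a (rnk a - 2) else 0)"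
    proof (cases "rnk a < 2")
      case True
      \<comment> \<open>On scaled ranks, \<open>n < rk u\<close> is the test for rank at least two.
        Otherwise nothing is written, and the cell still holds \<open>0\<close>, as for every full
        node.\<close>
      then have "\<not> n < rk u" by (auto simp: rko less_2_cases_iff)
      then show ?thesis using True coupleD(10)[OF cp, of a] Fo by (simp add: h2')
    next
      case False
      then have "n < rk u" using n by (simp add: rko)
      moreover have "u + (rk u - (n + n)) = u + (rnk a - 2) * n" using rkq by (simp add: q_def)
      ultimately show ?thesis
        using kido[of "rnk a - 2"] False by (simp add: h2' a_def[symmetric])
    qed
    have hne: "h1' z = h1 z" "h2' z = h2 z" if "z \<noteq> a" for z
      using that by (auto simp: h1' h2' a_def)
    have "couple n (Suc N) F' loc' (rnk(Suc N := q)) (ky(Suc N := K)) (ch(Suc N := ch a))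
        (vert(Suc N := u)) (cur(u := Suc N)) (rk(u := rk u - (n + n))) kid h1' h2' (key(u := K)) pos"
    proof (rule coupleI)
      fix z
      { assume z0: "loc' z \<noteq> Gone"
        then show "(vert(Suc N := u)) z < n"
          using coupleD(1)[OF cp, of z] u(1) by (auto simp: loc'_def split: if_splits)
        assume "\<not> F' z"
        then have z: "z \<noteq> Suc N" "z = a \<or> \<not> F z" "loc z \<noteq> Gone"
          using z0 by (auto simp: F'_def loc'_def split: if_splits)
        show "(cur(u := Suc N)) ((vert(Suc N := u)) z) \<noteq> z \<and>
          h1' z = (if 1 \<le> (rnk(Suc N := q)) z then (ch(Suc N := ch a)) z ((rnk(Suc N := q)) z - 1) else 0) \<and>
          h2' z = (if 2 \<le> (rnk(Suc N := q)) z then (ch(Suc N := ch a)) z ((rnk(Suc N := q)) z - 2) else 0)"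
        proof (cases "z = a")
          case True
          then show ?thesis using h1o h2o oN Fo by simp
        next
          case False
          then show ?thesis using coupleD(7,8,9)[OF cp z(3)] z(1,2) hne[of z] by auto
        qed }
      { assume z: "F' z"
        show "(cur(u := Suc N)) ((vert(Suc N := u)) z) = z \<and> pos ((vert(Suc N := u)) z) = 0 \<and>
          (rk(u := rk u - (n + n))) ((vert(Suc N := u)) z) = (rnk(Suc N := q)) z * n \<and>
          (ky(Suc N := K)) z = (key(u := K)) ((vert(Suc N := u)) z)"
        proof (cases "z = Suc N")
          case True
          then show ?thesis using u(2) rkq by simp
        next
          case False
          then have "F z" "z \<noteq> a" using z by (auto simp: F'_def split: if_splits)
          then show ?thesis using coupleD(2-5)[OF cp \<open>F z\<close>] neu[of z] False by simp
        qed
        fix j assume j: "j < (rnk(Suc N := q)) z"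
        show "kid ((vert(Suc N := u)) z + j * n) = (ch(Suc N := ch a)) z j"
        proof (cases "z = Suc N")
          case True
          then show ?thesis using j kido[of j] by (simp add: q_def)
        next
          case False
          then show ?thesis using coupleD(6)[OF cp, of z j] z j by (auto simp: F'_def split: if_splits)
        qed }
      show "F' z \<or> Suc N < z \<Longrightarrow> h1' z = 0 \<and> h2' z = 0"
        using coupleD(10)[OF cp, of z] hne[of z] oN by (auto simp: F'_def split: if_splits)
      show "z < n \<Longrightarrow> (cur(u := Suc N)) z \<le> Suc N \<and> ((cur(u := Suc N)) z = 0 \<longrightarrow> (rk(u := rk u - (n + n))) z = 0)"
        using coupleD(11,12)[OF cp, of z] by auto
      show "z < n \<Longrightarrow> (cur(u := Suc N)) z \<noteq> 0 \<Longrightarrow> pos z = 0 \<Longrightarrow>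
          F' ((cur(u := Suc N)) z) \<and> (vert(Suc N := u)) ((cur(u := Suc N)) z) = z"
        using coupleD(13)[OF cp, of z] coupleD(11)[OF cp, of z] Fo by (auto simp: F'_def)
    qed
    moreover have "on_stack loc' (Suc T) (S(T := Suc N))"
    proof -
      have "on_stack (loc(Suc N := Stacked)) (Suc T) (S(T := Suc N))"
        by (rule on_stack_push[OF st]) (simp add: g)
      then show ?thesis by (rule on_stack_cong) (auto simp: loc'_def)
    qed
    moreover have "in_slots n loc' (rnk(Suc N := q)) slot mx 0"
      unfolding in_slots_def using nh e by (auto simp: loc'_def)
    ultimately show ?thesis
      using heapI[OF p(1,2) refl _ _ _ mx] p(3) m by blast
  qed
qed

section \<open>The program\<close>

text \<open>
  Cell \<open>c\<close> of array \<open>0\<close> serves as variable \<open>c\<close>. Names with \<open>v\<close>, \<open>a\<close>, \<open>d\<close> stand for variables, arrays of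
  numbers, and arrays of distances.
\<close>

abbreviation (input) vn :: nat where "vn \<equiv> 0"
abbreviation (input) vk :: nat where "vk \<equiv> 1"
abbreviation (input) vj :: nat where "vj \<equiv> 2"
abbreviation (input) vp :: nat where "vp \<equiv> 3"
abbreviation (input) vN :: nat where "vN \<equiv> 4"
abbreviation (input) vT :: nat where "vT \<equiv> 5"
abbreviation (input) vmax :: nat where "vmax \<equiv> 6"
abbreviation (input) vbest :: nat where "vbest \<equiv> 7"
abbreviation (input) vx :: nat where "vx \<equiv> 8"
abbreviation (input) vy :: nat where "vy \<equiv> 9"
abbreviation (input) vv :: nat where "vv \<equiv> 10"
abbreviation (input) vt :: nat where "vt \<equiv> 11"
abbreviation (input) vr :: nat where "vr \<equiv> 12"
abbreviation (input) vu :: nat where "vu \<equiv> 13"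

abbreviation (input) aord :: nat where "aord \<equiv> 2"
abbreviation (input) apos :: nat where "apos \<equiv> 3"
abbreviation (input) acur :: nat where "acur \<equiv> 4"
abbreviation (input) avert :: nat where "avert \<equiv> 5"
abbreviation (input) ark :: nat where "ark \<equiv> 6"
abbreviation (input) akid :: nat where "akid \<equiv> 7"
abbreviation (input) ah1 :: nat where "ah1 \<equiv> 8"
abbreviation (input) ah2 :: nat where "ah2 \<equiv> 9"
abbreviation (input) astack :: nat where "astack \<equiv> 10"
abbreviation (input) aslot :: nat where "aslot \<equiv> 11"
abbreviation (input) anbr :: nat where "anbr \<equiv> 15"

abbreviation (input) dkey :: nat where "dkey \<equiv> 2"
abbreviation (input) dlink :: nat where "dlink \<equiv> 3"
abbreviation (input) dtmp :: nat where "dtmp \<equiv> 5"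

abbreviation var :: "nat \<Rightarrow> iexp" where "var c \<equiv> Cell 0 (Const c)"
abbreviation set_var :: "nat \<Rightarrow> iexp \<Rightarrow> com" (infix "::=" 62) where "c ::= e \<equiv> ISet 0 (Const c) e"
abbreviation seq :: "com \<Rightarrow> com \<Rightarrow> com" (infixr ";;" 60) where "c ;; c' \<equiv> Seq c c'"

abbreviation (input) vi :: nat where "vi \<equiv> 14"
abbreviation (input) vlo :: nat where "vlo \<equiv> 15"
abbreviation (input) vhi :: nat where "vhi \<equiv> 16"
abbreviation (input) vmid :: nat where "vmid \<equiv> 17"
abbreviation (input) vleft :: nat where "vleft \<equiv> 18"
abbreviation (input) vright :: nat where "vright \<equiv> 19"
abbreviation (input) vidx :: nat where "vidx \<equiv> 20"
abbreviation (input) va :: nat where "va \<equiv> 21"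

abbreviation (input) ahalf :: nat where "ahalf \<equiv> 12"
abbreviation (input) anear :: nat where "anear \<equiv> 13"
abbreviation (input) ares :: nat where "ares \<equiv> 14"

abbreviation (input) dthr :: nat where "dthr \<equiv> 4"
abbreviation (input) dcur :: nat where "dcur \<equiv> 6"

definition Equal :: "iexp \<Rightarrow> iexp \<Rightarrow> bexp" where
  "Equal e f = Conj (Neg (Less e f)) (Neg (Less f e))"

lemma bval_Equal [simp]: "bval s (Equal e f) \<longleftrightarrow> ival s e = ival s f"
  by (auto simp: Equal_def)

definition push :: "iexp \<Rightarrow> com" where
  "push e = (ISet astack (var vT) e ;; vT ::= Plus (var vT) (Const 1))"

definition consolidate_step :: com where
  "consolidate_step =
     (vT ::= Minus (var vT) (Const 1) ;;
      vx ::= Cell astack (var vT) ;;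
      vv ::= Cell avert (var vx) ;;
      Cond (Equal (Cell acur (var vv)) (var vx))
        (vr ::= Cell ark (var vv) ;;
         vy ::= Cell aslot (var vr) ;;
         Cond (Less (Const 0) (var vy))
           (ISet aslot (var vr) (Const 0) ;;
            Cond (DLess (DCell dkey (Cell avert (var vy))) (DCell dkey (var vv)))
              (vt ::= var vx ;; vx ::= var vy ;; vy ::= var vt) Skip ;;
            push (var vx) ;;
            vv ::= Cell avert (var vx) ;;
            ISet akid (Plus (var vv) (var vr)) (var vy) ;;
            ISet ark (var vv) (Plus (var vr) (var vn)))
           (ISet aslot (var vr) (var vx) ;;
            Cond (Less (var vmax) (var vr)) (vmax ::= var vr) Skip))
        (Cond (Less (Const 0) (Cell ah1 (var vx))) (push (Cell ah1 (var vx))) Skip ;;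
         Cond (Less (Const 0) (Cell ah2 (var vx))) (push (Cell ah2 (var vx))) Skip))"

definition consolidate :: com where
  "consolidate = Loop (Less (Const 0) (var vT)) consolidate_step"

definition gather_step :: com where
  "gather_step =
     (vx ::= Cell aslot (var vr) ;;
      ISet aslot (var vr) (Const 0) ;;
      Cond (Less (Const 0) (var vx))
        (Cond (Less (Const 0) (var vbest))
          (Cond (DLess (DCell dkey (Cell avert (var vx))) (DCell dkey (Cell avert (var vbest))))
            (push (var vbest) ;; vbest ::= var vx)
            (push (var vx)))
          (vbest ::= var vx))
        Skip ;;
      vr ::= Plus (var vr) (var vn))"

definition gather :: com where
  "gather = (vr ::= Const 0 ;; Loop (Neg (Less (var vmax) (var vr))) gather_step)"

text \<open>The top two children are saved under the old node before \<open>acur\<close> is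
  redirected, which makes that node hollow. The other children pass to the new node without copying,
  since \<open>akid\<close> is addressed by the vertex.\<close>

definition put :: com where
  "put =
     (Cond (Less (Const 0) (Cell ark (var vu)))
        (ISet ah1 (Cell acur (var vu)) (Cell akid (Plus (var vu) (Minus (Cell ark (var vu)) (var vn))))) Skip ;;
      Cond (Less (var vn) (Cell ark (var vu)))
        (ISet ah2 (Cell acur (var vu))
          (Cell akid (Plus (var vu) (Minus (Cell ark (var vu)) (Plus (var vn) (var vn)))))) Skip ;;
      ISet ark (var vu) (Minus (Cell ark (var vu)) (Plus (var vn) (var vn))) ;;
      vN ::= Plus (var vN) (Const 1) ;;
      ISet avert (var vN) (var vu) ;;
      ISet acur (var vu) (var vN) ;;
      DSet dkey (var vu) (DCell dtmp (Const 0)) ;;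
      push (var vN))"

text \<open>Positions are stored plus one, so \<open>apos\<close> below one means unvisited.\<close>

definition scan_step :: com where
  "scan_step =
     (vt ::= Plus (var vt) (Const 1) ;;
      vu ::= Cell anbr (var vt) ;;
      Cond (Less (Cell apos (var vu)) (Const 1))
        (Dist dtmp (Const 0) (var vv) (var vu) ;;
         Cond (Less (Cell acur (var vu)) (Const 1)) put
           (Cond (DLess (DCell dtmp (Const 0)) (DCell dkey (var vu))) put Skip))
        Skip)"

definition scan :: com where
  "scan = (vt ::= Const 0 ;; Loop (Less (var vt) (Cell anbr (Const 0))) scan_step)"

definition push_kids :: com where
  "push_kids = Loop (Less (var vr) (Cell ark (var vv)))
     (push (Cell akid (Plus (var vv) (var vr))) ;; vr ::= Plus (var vr) (var vn))"

definition extract_min :: com where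
  "extract_min =
     (vv ::= Cell avert (var vbest) ;;
      vbest ::= Const 0 ;;
      vr ::= Const 0 ;;
      push_kids ;;
      ISet aord (var vj) (var vv) ;;
      DSet dlink (var vj) (DCell dkey (var vv)) ;;
      vj ::= Plus (var vj) (Const 1) ;;
      ISet apos (var vv) (var vj) ;;
      Neighbours anbr (var vv))"

text \<open>
  If the heap is empty, the next unvisited vertex lies in a new component, so its distance to the
  last visited vertex is infinite, as it has to be for its link weight. The key of the first vertex
  is arbitrary, as \<open>w 0\<close> is never used.
\<close>

definition restart :: com where
  "restart =
     (Cond (Less (Cell apos (var vp)) (Const 1))
        (vu ::= var vp ;;
         Cond (Less (Const 0) (var vj))
           (Dist dtmp (Const 0) (Cell aord (Minus (var vj) (Const 1))) (var vu)) Skip ;;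
         put)
        Skip ;;
      vp ::= Plus (var vp) (Const 1))"

definition prim_step :: com where
  "prim_step =
     (consolidate ;;
      gather ;;
      Cond (Less (Const 0) (var vbest))
        (extract_min ;; scan) restart)"

definition prim :: com where
  "prim = Loop (Less (var vj) (var vn)) prim_step"

text \<open>
  The array \<open>anear\<close> is filled from its end, so that the points beyond a given rank form a prefix,
  as the seed queries need it.
\<close>

definition expand_step :: com where
  "expand_step =
     (vidx ::= Minus (var vidx) (Const 1) ;;
      Cond (Conj (Less (Const 0) (var vleft))
          (Neg (Conj (Less (var vright) (var vn)) (DLess (DCell dlink (var vright)) (DCell dlink (var vleft))))))
        (Cond (DLess (DCell dcur (Const 0)) (DCell dlink (var vleft)))
           (DSet dcur (Const 0) (DCell dlink (var vleft))) Skip ;;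
         vleft ::= Minus (var vleft) (Const 1) ;;
         ISet anear (var vidx) (Cell aord (var vleft)))
        (Cond (DLess (DCell dcur (Const 0)) (DCell dlink (var vright)))
           (DSet dcur (Const 0) (DCell dlink (var vright))) Skip ;;
         ISet anear (var vidx) (Cell aord (var vright)) ;;
         vright ::= Plus (var vright) (Const 1)) ;;
      DSet dthr (var vidx) (DCell dcur (Const 0)))"

definition expand :: com where
  "expand =
     (vleft ::= var va ;;
      vright ::= Plus (var va) (Const 1) ;;
      vidx ::= Minus (var vn) (Const 1) ;;
      DSet dcur (Const 0) DZero ;;
      ISet anear (var vidx) (Cell aord (var va)) ;;
      DSet dthr (var vidx) DZero ;;
      Loop (Less (Const 0) (var vidx)) expand_step)"

text \<open>The first cluster point of \<open>anear\<close> has an index in \<open>[lo, hi)\<close>.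
  NIL for the first \<open>mid\<close> cells moves it to \<open>[mid, hi)\<close>, any other answer
  to \<open>[lo, mid)\<close>.\<close>

definition bisect_step :: com where
  "bisect_step =
     (vmid ::= Plus (var vlo) (Cell ahalf (Minus (var vhi) (var vlo))) ;;
      Seed anear (var vmid) ares (Const 0) (var vi) ;;
      Cond (Less (Cell ares (Const 0)) (Const 1)) (vlo ::= var vmid) (vhi ::= var vmid))"

definition bisect :: com where
  "bisect =
     (vlo ::= Const 0 ;;
      vhi ::= var vn ;;
      Loop (Less (Plus (var vlo) (Const 1)) (var vhi)) bisect_step)"

text \<open>The two subtractions of one undo the shifts in the encoding of answers and of
  positions.\<close>

definition learn_radius :: com where
  "learn_radius =
     (Seed aord (var vn) ares (Const 0) (var vi) ;;
      va ::= Minus (Cell apos (Minus (Cell ares (Const 0)) (Const 1))) (Const 1) ;;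
      expand ;;
      bisect ;;
      DSet 0 (var vi) (DCell dthr (var vlo)) ;;
      vi ::= Plus (var vi) (Const 1))"

definition learn_radii :: com where
  "learn_radii = (vi ::= Const 0 ;; Loop (Less (var vi) (var vk)) learn_radius)"

text \<open>The table replaces division by two: cells \<open>2 * t\<close> and
  \<open>2 * t + 1\<close> receive \<open>t\<close>.\<close>

definition halves :: com where
  "halves =
     (vt ::= Const 0 ;;
      Loop (Less (var vt) (var vn))
        (ISet ahalf (Plus (var vt) (var vt)) (var vt) ;;
         ISet ahalf (Plus (Plus (var vt) (var vt)) (Const 1)) (var vt) ;;
         vt ::= Plus (var vt) (Const 1)))"

text \<open>With fewer than two points all radii are \<open>0\<close>, which the zero-initialised
  output already says; since the logarithm is \<open>0\<close> there, no query would be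
  affordable.\<close>

definition learn :: com where
  "learn = Cond (Less (Const 1) (var vn)) (prim ;; halves ;; learn_radii) Skip"

section \<open>Operations on the heap\<close>

text \<open>Frame condition: \<open>A\<close>, \<open>V\<close> and \<open>D\<close> are the arrays,
  variables and distance arrays that may change. Array \<open>0\<close> is compared cell by cell as
  it holds the variables; time is left free.\<close>

definition agree :: "nat set \<Rightarrow> nat set \<Rightarrow> nat set \<Rightarrow> state \<Rightarrow> state \<Rightarrow> bool" where
  "agree A V D s t \<longleftrightarrow> (\<forall>a. a \<noteq> 0 \<and> a \<notin> A \<longrightarrow> ints t a = ints s a) \<and>
     (\<forall>c. c \<notin> V \<longrightarrow> ints t 0 c = ints s 0 c) \<and>
     (\<forall>b. b \<notin> D \<longrightarrow> dists t b = dists s b) \<and> queries t = queries s"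

lemma agree_refl [simp]: "agree A V D s s" by (simp add: agree_def)

lemma agree_trans [trans]: "agree A V D s t \<Longrightarrow> agree A V D t u \<Longrightarrow> agree A V D s u"
  by (simp add: agree_def)

definition heap_state :: "nat \<Rightarrow> nat \<Rightarrow> state \<Rightarrow> bool" where
  "heap_state R m s \<longleftrightarrow> heap (ints s 0 vn) R (ints s 0 vN) m (ints s avert) (ints s acur) (ints s ark)
     (ints s akid) (ints s ah1) (ints s ah2) (dists s dkey) (ints s apos) (ints s 0 vT) (ints s astack)
     (ints s aslot) (ints s 0 vmax) (ints s 0 vbest)"

context machine begin

lemma consolidate_step:
  assumes h: "heap_state R m s" and T: "0 < ints s 0 vT" and b: "ints s 0 vbest = 0"
    and R: "\<And>r. 2 ^ (r div 2) \<le> ints s 0 vN \<Longrightarrow> r \<le> R"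
  shows "wp consolidate_step (\<lambda>t. (\<exists>m'<m. heap_state R m' t) \<and> time t \<le> time s + 30 \<and>
    agree {ark, akid, astack, aslot} {vT, vmax, vx, vy, vv, vt, vr} {} s t) s"
proof -
  define x where "x = ints s astack (ints s 0 vT - 1)"
  note hs = h[unfolded heap_state_def]
  note b' = b[simplified]
  show ?thesis
  proof (cases "ints s acur (ints s avert x) = x")
    case False
    define T1 where "T1 = ints s 0 vT - 1 + (if 0 < ints s ah1 x then 1 else 0)"
    define T2 where "T2 = T1 + (if 0 < ints s ah2 x then 1 else 0)"
    define S1 where "S1 = (if 0 < ints s ah1 x then (ints s astack)(ints s 0 vT - 1 := ints s ah1 x) else ints s astack)"
    define S2 where "S2 = (if 0 < ints s ah2 x then S1(T1 := ints s ah2 x) else S1)"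
    have "\<exists>m'<m. heap (ints s 0 vn) R (ints s 0 vN) m' (ints s avert) (ints s acur) (ints s ark)
     (ints s akid) (ints s ah1) (ints s ah2) (dists s dkey) (ints s apos) T2 S2
     (ints s aslot) (ints s 0 vmax) (ints s 0 vbest)"
      by (rule heap_pop_hollow[OF hs T x_def False]) (auto simp: T1_def T2_def S1_def S2_def)
    then show ?thesis
      using False T unfolding consolidate_step_def push_def
      by (cases "0 < ints s ah1 x"; cases "0 < ints s ah2 x")
        (simp_all add: x_def[symmetric] x_def[symmetric, simplified] T1_def T2_def S1_def S2_def
          heap_state_def agree_def)
  next
    case True
    define r where "r = ints s ark (ints s avert x)"
    define y where "y = ints s aslot r"
    show ?thesis
    proof (cases "y = 0")
      case e: True
      from heap_place[OF hs T x_def True e[unfolded y_def r_def] b R refl]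
      show ?thesis
        using True T e unfolding consolidate_step_def push_def
        by (simp add: x_def[symmetric] x_def[symmetric, simplified] r_def[symmetric] y_def[symmetric]
            heap_state_def agree_def b b' split: if_splits)
    next
      case ne: False
      note link = heap_link[OF hs T x_def True y_def[unfolded r_def] _ b]
      show ?thesis
      proof (cases "dists s dkey (ints s avert y) < dists s dkey (ints s avert x)")
        case le: True
        from link[of y x] le ne
        show ?thesis
          using True T ne le unfolding consolidate_step_def push_def
          by (simp add: x_def[symmetric] x_def[symmetric, simplified] r_def[symmetric] y_def[symmetric]
              heap_state_def agree_def b b')
      next
        case le: False
        from link[of x y] le ne
        show ?thesis
          using True T ne le unfolding consolidate_step_def push_def
          by (simp add: x_def[symmetric] x_def[symmetric, simplified] r_def[symmetric] y_def[symmetric]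
              heap_state_def agree_def b b')
      qed
    qed
  qed
qed

text \<open>The potential \<open>time + 40 * credits\<close> does not increase in the loop: an
  iteration takes at most 31 units and destroys at least one credit. The same credits bound the
  number of iterations.\<close>

lemma consolidate:
  assumes h: "heap_state R m s" and b: "ints s 0 vbest = 0"
    and R: "\<And>r. 2 ^ (r div 2) \<le> ints s 0 vN \<Longrightarrow> r \<le> R"
  shows "wp consolidate (\<lambda>t. (\<exists>m'. heap_state R m' t \<and> time t + 40 * m' \<le> time s + 40 * m + 1) \<and>
    ints t 0 vT = 0 \<and> agree {ark, akid, astack, aslot} {vT, vmax, vx, vy, vv, vt, vr} {} s t) s" (is "wp _ ?Q _")
proof -
  let ?I = "\<lambda>m' t. heap_state R m' t \<and> time t + 40 * m' \<le> time s + 40 * m \<and>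
      agree {ark, akid, astack, aslot} {vT, vmax, vx, vy, vv, vt, vr} {} s t"
  show ?thesis unfolding consolidate_def
  proof (rule wp_Loop_ghost[where I = ?I])
    show "?I m s"
      using h by simp
  next
    fix m' t
    assume I: "?I m' t"
      and c: "bval t (Less (Const 0) (var vT))"
    have a: "ints t 0 vbest = 0" "ints t 0 vN = ints s 0 vN" using I b by (auto simp: agree_def)
    show "wp consolidate_step (\<lambda>u. \<exists>m''<m'. ?I m'' u) (tick 1 t)"
    proof (rule wp_conseq[OF consolidate_step[of R m']])
      show "heap_state R m' (tick 1 t)" using I by (simp add: heap_state_def)
      show "0 < ints (tick 1 t) 0 vT" using c by simp
      show "ints (tick 1 t) 0 vbest = 0" using a by simp
      show "2 ^ (r div 2) \<le> ints (tick 1 t) 0 vN \<Longrightarrow> r \<le> R" for r using R a by simp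
      fix u assume u: "(\<exists>m''<m'. heap_state R m'' u) \<and> time u \<le> time (tick 1 t) + 30 \<and>
        agree {ark, akid, astack, aslot} {vT, vmax, vx, vy, vv, vt, vr} {} (tick 1 t) u"
      then obtain m'' where m'': "m'' < m'" "heap_state R m'' u" by blast
      have "agree {ark, akid, astack, aslot} {vT, vmax, vx, vy, vv, vt, vr} {} t u"
        using u by (simp add: agree_def)
      then show "\<exists>m''<m'. ?I m'' u"
        using m'' u I agree_trans by (intro exI[of _ m'']) auto
    qed
  next
    fix m' t
    assume "?I m' t"
      "\<not> bval t (Less (Const 0) (var vT))"
    then show "?Q (tick 1 t)"
      by (auto simp: heap_state_def agree_def)
  qed
qed

end

text \<open>Fullness has to be expressed through \<open>acur\<close> and \<open>avert\<close>,
  because the forest is hidden in \<open>heap_state\<close>.\<close>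

definition least_held :: "state \<Rightarrow> bool" where
  "least_held s \<longleftrightarrow> (0 < ints s 0 vbest \<longrightarrow> ints s acur (ints s avert (ints s 0 vbest)) = ints s 0 vbest) \<and>
     (\<forall>i < ints s 0 vT. ints s acur (ints s avert (ints s astack i)) = ints s astack i \<and> 0 < ints s 0 vbest \<and>
        dists s dkey (ints s avert (ints s 0 vbest)) \<le> dists s dkey (ints s avert (ints s astack i)))"

context machine begin

lemma gather_step:
  assumes h: "heap_state R m s" and n: "0 < ints s 0 vn" and r: "ints s 0 vr = q * ints s 0 vn"
    and lh: "least_held s"
    and e: "\<And>q'. q' < q \<Longrightarrow> ints s aslot (q' * ints s 0 vn) = 0"
  shows "wp gather_step (\<lambda>t. (\<exists>m'\<le>m + 1. heap_state R m' t) \<and> ints t 0 vr = Suc q * ints t 0 vn \<and>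
    least_held t \<and> (\<forall>q'<Suc q. ints t aslot (q' * ints t 0 vn) = 0) \<and> time t \<le> time s + 30 \<and>
    agree {astack, aslot} {vT, vbest, vx, vr} {} s t) s"
proof -
  define x where "x = ints s aslot (q * ints s 0 vn)"
  note hs = h[unfolded heap_state_def]
  have e': "\<And>q'. q' < Suc q \<Longrightarrow> q' \<noteq> q \<Longrightarrow> ints s aslot (q' * ints s 0 vn) = 0" using e by simp
  show ?thesis
  proof (cases "0 < x")
    case False
    have "\<exists>m'\<le>m + 1. heap (ints s 0 vn) R (ints s 0 vN) m' (ints s avert) (ints s acur) (ints s ark)
     (ints s akid) (ints s ah1) (ints s ah2) (dists s dkey) (ints s apos) (ints s 0 vT) (ints s astack)
     ((ints s aslot)(q * ints s 0 vn := 0)) (ints s 0 vmax) (ints s 0 vbest)"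
      by (rule heap_hold(1)[OF hs n x_def]) (use False in auto)
    then show ?thesis
      using False e' r lh unfolding gather_step_def push_def
      by (simp add: x_def[symmetric] heap_state_def agree_def least_held_def)
  next
    case True
    have cx: "ints s acur (ints s avert x) = x" and xb: "x \<noteq> ints s 0 vbest"
      using heap_slot_full[OF hs, of q] True by (simp_all add: x_def)
    show ?thesis
    proof (cases "0 < ints s 0 vbest")
      case b: False
      have "\<exists>m'\<le>m + 1. heap (ints s 0 vn) R (ints s 0 vN) m' (ints s avert) (ints s acur) (ints s ark)
       (ints s akid) (ints s ah1) (ints s ah2) (dists s dkey) (ints s apos) (ints s 0 vT) (ints s astack)
       ((ints s aslot)(q * ints s 0 vn := 0)) (ints s 0 vmax) x"
        by (rule heap_hold(1)[OF hs n x_def]) (use True b in auto)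
      then show ?thesis
        using True b cx e' r lh unfolding gather_step_def push_def
        by (simp add: x_def[symmetric] heap_state_def agree_def least_held_def)
    next
      case b: True
      show ?thesis
      proof (cases "dists s dkey (ints s avert x) < dists s dkey (ints s avert (ints s 0 vbest))")
        case le: True
        have "\<exists>m'\<le>m + 1. heap (ints s 0 vn) R (ints s 0 vN) m' (ints s avert) (ints s acur) (ints s ark)
         (ints s akid) (ints s ah1) (ints s ah2) (dists s dkey) (ints s apos) (Suc (ints s 0 vT))
         ((ints s astack)(ints s 0 vT := ints s 0 vbest))
         ((ints s aslot)(q * ints s 0 vn := 0)) (ints s 0 vmax) x"
          by (rule heap_hold(1)[OF hs n x_def]) (use True b in auto)
        then show ?thesis
          using True b le cx e' r lh unfolding gather_step_def push_def
          by (auto simp add: x_def[symmetric] heap_state_def agree_def least_held_def less_Suc_eq)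
      next
        case le: False
        have "\<exists>m'\<le>m + 1. heap (ints s 0 vn) R (ints s 0 vN) m' (ints s avert) (ints s acur) (ints s ark)
         (ints s akid) (ints s ah1) (ints s ah2) (dists s dkey) (ints s apos) (Suc (ints s 0 vT))
         ((ints s astack)(ints s 0 vT := x))
         ((ints s aslot)(q * ints s 0 vn := 0)) (ints s 0 vmax) (ints s 0 vbest)"
          by (rule heap_hold(1)[OF hs n x_def]) (use True b xb in auto)
        then show ?thesis
          using True b le cx e' r lh unfolding gather_step_def push_def
          by (auto simp add: x_def[symmetric] heap_state_def agree_def least_held_def less_Suc_eq)
      qed
    qed
  qed
qed

text \<open>Ranks are at most \<open>R\<close>, so at most \<open>R + 1\<close> slots are visited,
  and each returns at most one root to the stack at the price of one credit.\<close>

lemma gather: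
  assumes h: "heap_state R m s" and n: "0 < ints s 0 vn"
    and z: "ints s 0 vT = 0" "ints s 0 vbest = 0"
  shows "wp gather (\<lambda>t. (\<exists>m'\<le>m + R + 1. heap_state R m' t) \<and>
    (\<forall>q. ints t aslot (q * ints t 0 vn) = 0) \<and>
    (\<forall>v < ints t 0 vn. ints t acur v \<noteq> 0 \<and> ints t apos v = 0 \<longrightarrow> 0 < ints t 0 vbest \<and>
       dists t dkey (ints t avert (ints t 0 vbest)) \<le> dists t dkey v) \<and>
    time t \<le> time s + 40 * (R + 1) + 2 \<and>
    agree {astack, aslot} {vT, vbest, vx, vr} {} s t) s" (is "wp _ ?Q _")
proof -
  define n where "n = ints s 0 vn"
  define mx where "mx = ints s 0 vmax"
  have n0: "0 < n" using assms(2) by (simp add: n_def)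
  obtain qm where qm: "qm \<le> R" "mx = qm * n"
    using h unfolding heap_state_def mx_def n_def by (elim heapE) blast
  define I where "I = (\<lambda>t. \<exists>q m'. ints t 0 vr = q * n \<and> m' \<le> m + q \<and> q \<le> R + 1 \<and> heap_state R m' t \<and> least_held t \<and>
    (\<forall>q'<q. ints t aslot (q' * n) = 0) \<and> time t \<le> time s + 1 + 40 * q \<and>
    agree {astack, aslot} {vT, vbest, vx, vr} {} s t)"
  have "wp (Loop (Neg (Less (var vmax) (var vr))) gather_step) ?Q (tick 1 (iwrite 0 vr 0 s))"
  proof (rule wp_Loop[where I = I and \<mu> = "\<lambda>t. Suc mx - ints t 0 vr"])
    show "I (tick 1 (iwrite 0 vr 0 s))"
      unfolding I_def using h z
      by (intro exI[of _ 0] exI[of _ m]) (simp add: heap_state_def least_held_def agree_def)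
  next
    fix t assume "I t" and c: "bval t (Neg (Less (var vmax) (var vr)))"
    then obtain q m' where I: "ints t 0 vr = q * n" "m' \<le> m + q" "heap_state R m' t" "least_held t"
      "\<And>q'. q' < q \<Longrightarrow> ints t aslot (q' * n) = 0" "time t \<le> time s + 1 + 40 * q"
      and a: "agree {astack, aslot} {vT, vbest, vx, vr} {} s t"
      unfolding I_def by blast
    have nt: "ints t 0 vn = n" "ints t 0 vmax = mx" using a by (simp_all add: agree_def n_def mx_def)
    have "q * n \<le> mx" using c I(1) nt by simp
    then have "q \<le> R" using qm n0 by (metis le_trans mult_le_cancel2)
    show "wp gather_step (\<lambda>u. I u \<and> Suc mx - ints u 0 vr < Suc mx - ints t 0 vr) (tick 1 t)"
    proof (rule wp_conseq[OF gather_step[of R m' _ q]])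
      show "heap_state R m' (tick 1 t)" using I(3) by (simp add: heap_state_def)
      show "least_held (tick 1 t)" using I(4) by (simp add: least_held_def)
      show "0 < ints (tick 1 t) 0 vn" using nt n0 by simp
      show "ints (tick 1 t) 0 vr = q * ints (tick 1 t) 0 vn" using I(1) nt by simp
      show "ints (tick 1 t) aslot (q' * ints (tick 1 t) 0 vn) = 0" if "q' < q" for q'
        using I(5)[OF that] nt by simp
      fix u assume u: "(\<exists>m''\<le>m' + 1. heap_state R m'' u) \<and> ints u 0 vr = Suc q * ints u 0 vn \<and>
        least_held u \<and> (\<forall>q'<Suc q. ints u aslot (q' * ints u 0 vn) = 0) \<and> time u \<le> time (tick 1 t) + 30 \<and>
        agree {astack, aslot} {vT, vbest, vx, vr} {} (tick 1 t) u"
      then obtain m'' where m'': "m'' \<le> m' + 1" "heap_state R m'' u" by blast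
      have au: "agree {astack, aslot} {vT, vbest, vx, vr} {} t u" using u by (simp add: agree_def)
      have nu: "ints u 0 vn = n" using au nt by (simp add: agree_def)
      have "I u" unfolding I_def
        using m'' u nu I \<open>q \<le> R\<close> agree_trans[OF a au]
        by (intro exI[of _ "Suc q"] exI[of _ m'']) auto
      moreover have "Suc mx - ints u 0 vr < Suc mx - ints t 0 vr"
        using u nu n0 I(1) \<open>q * n \<le> mx\<close> by simp
      ultimately show "I u \<and> Suc mx - ints u 0 vr < Suc mx - ints t 0 vr" by blast
    qed
  next
    fix t assume "I t" and c: "\<not> bval t (Neg (Less (var vmax) (var vr)))"
    then obtain q m' where I: "ints t 0 vr = q * n" "m' \<le> m + q" "heap_state R m' t" "least_held t"
      "\<And>q'. q' < q \<Longrightarrow> ints t aslot (q' * n) = 0" "time t \<le> time s + 1 + 40 * q" "q \<le> R + 1"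
      and a: "agree {astack, aslot} {vT, vbest, vx, vr} {} s t"
      unfolding I_def by blast
    have nt: "ints t 0 vn = n" "ints t 0 vmax = mx" using a by (simp_all add: agree_def n_def mx_def)
    have "mx < q * n" using c I(1) nt by simp
    then have e: "ints t aslot (r * n) = 0" if "r * n \<le> mx" for r
      using I(5)[of r] that n0 by (metis le_less_trans mult_less_cancel2)
    note hs = I(3)[unfolded heap_state_def nt]
    have e2: "ints t aslot (r * n) = 0" for r by (rule heap_slots_empty[OF hs e])
    have e3: "0 < ints t 0 vbest" "dists t dkey (ints t avert (ints t 0 vbest)) \<le> dists t dkey v"
      if "v < n" "ints t acur v \<noteq> 0" "ints t apos v = 0" for v
      using heap_minimum[OF hs e _ that] I(4) unfolding least_held_def by blast+
    have "heap_state R m' (tick 1 t)" using I(3) by (simp add: heap_state_def)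
    moreover have "m' \<le> m + R + 1" using I(2,7) by simp
    moreover have "time t \<le> time s + 1 + 40 * (R + 1)" using I(6,7) by simp
    moreover have "agree {astack, aslot} {vT, vbest, vx, vr} {} s (tick 1 t)" using a by (simp add: agree_def)
    ultimately show "?Q (tick 1 t)"
      using e2 e3 nt by auto
  qed
  then show ?thesis unfolding gather_def by simp
qed

lemma put:
  assumes h: "heap_state R m s" and u: "u = ints s 0 vu" "u < ints s 0 vn" "ints s apos u = 0"
      "0 < ints s acur u \<Longrightarrow> dists s dtmp 0 \<le> dists s dkey u"
    and e: "\<And>q. ints s aslot (q * ints s 0 vn) = 0" and b: "ints s 0 vbest = 0"
  shows "wp put (\<lambda>t. (\<exists>m'\<le>m + 7. heap_state R m' t) \<and>
    ints t acur = (ints s acur)(u := Suc (ints s 0 vN)) \<and>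
    dists t dkey = (dists s dkey)(u := dists s dtmp 0) \<and> ints t 0 vN = Suc (ints s 0 vN) \<and>
    time t \<le> time s + 30 \<and>
    agree {acur, avert, ark, ah1, ah2, astack} {vN, vT} {dkey} s t) s"
proof -
  define H1 where "H1 = (if 0 < ints s ark u then (ints s ah1)(ints s acur u := ints s akid (u + (ints s ark u - ints s 0 vn))) else ints s ah1)"
  define H2 where "H2 = (if ints s 0 vn < ints s ark u then (ints s ah2)(ints s acur u := ints s akid (u + (ints s ark u - (ints s 0 vn + ints s 0 vn)))) else ints s ah2)"
  note hp = heap_put[OF h[unfolded heap_state_def b] e u(2-4) H1_def H2_def]
  show ?thesis
    using hp b unfolding put_def push_def
    by (cases "0 < ints s ark u"; cases "ints s 0 vn < ints s ark u")
      (simp_all add: u(1)[symmetric] heap_state_def agree_def H1_def H2_def fun_upd_def)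
qed

end

section \<open>Prim's algorithm\<close>

locale semimetric_machine = machine xs d nbrs k seed
  for xs :: "'a list" and d nbrs k seed +
  fixes X :: "'a set"
  assumes represents: "represents xs nbrs X d" and semimetric: "semimetric_on X d"
begin

definition dst :: "nat \<Rightarrow> nat \<Rightarrow> ereal" where "dst u v = d (xs ! u) (xs ! v)"

lemma nth_eq_iff: "u < length xs \<Longrightarrow> v < length xs \<Longrightarrow> xs ! u = xs ! v \<longleftrightarrow> u = v"
  using represents by (simp add: represents_def nth_eq_iff_index_eq)

lemma in_X [simp]: "u < length xs \<Longrightarrow> xs ! u \<in> X"
  using represents by (auto simp: represents_def)

lemma dst_sym: "u < length xs \<Longrightarrow> v < length xs \<Longrightarrow> dst u v = dst v u"
  using semimetric by (simp add: semimetric_on_def dst_def)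

lemma set_nbrs: "v < length xs \<Longrightarrow> set (nbrs v) = {w. w < length xs \<and> w \<noteq> v \<and> dst v w < \<infinity>}"
proof -
  assume v: "v < length xs"
  have "{xs ! v, xs ! w} \<in> edges X d \<longleftrightarrow> w \<noteq> v \<and> dst v w < \<infinity>" if w: "w < length xs" for w
  proof
    assume "{xs ! v, xs ! w} \<in> edges X d"
    then obtain a b where "{xs ! v, xs ! w} = {a, b}" "a \<noteq> b" "d a b < \<infinity>"
      by (auto simp: edges_def)
    then have "xs ! v = a \<and> xs ! w = b \<or> xs ! v = b \<and> xs ! w = a" by (auto simp: doubleton_eq_iff)
    then show "w \<noteq> v \<and> dst v w < \<infinity>"
      using \<open>a \<noteq> b\<close> \<open>d a b < \<infinity>\<close> dst_sym[OF v w] by (auto simp: dst_def)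
  next
    assume "w \<noteq> v \<and> dst v w < \<infinity>"
    then show "{xs ! v, xs ! w} \<in> edges X d"
      unfolding edges_def using v w nth_eq_iff[OF v w] in_X by (fastforce simp: dst_def)
  qed
  then show ?thesis using represents v unfolding represents_def by auto
qed

lemma length_nbrs: "v < length xs \<Longrightarrow> length (nbrs v) \<le> length xs"
proof -
  assume v: "v < length xs"
  then have "length (nbrs v) = card (set (nbrs v))"
    using represents distinct_card[of "nbrs v"] by (auto simp: represents_def)
  also have "\<dots> \<le> card {..<length xs}" by (rule card_mono) (auto simp: set_nbrs[OF v])
  finally show ?thesis by simp
qed

text \<open>The key of a vertex in the heap is its distance to the visited set \<open>A\<close>,
  attained there. A vertex that was never inserted stands for distance infinity.\<close>

definition frontier :: "nat set \<Rightarrow> state \<Rightarrow> nat \<Rightarrow> bool" where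
  "frontier A s u \<longleftrightarrow> (if ints s acur u = 0 then \<forall>a\<in>A. dst a u = \<infinity>
     else (\<exists>a\<in>A. dists s dkey u = dst a u) \<and> (\<forall>a\<in>A. dists s dkey u \<le> dst a u))"

lemma frontier_tick [simp]: "frontier A (tick c s) u \<longleftrightarrow> frontier A s u"
  by (simp add: frontier_def)

lemma frontier_iwrite [simp]: "a \<noteq> acur \<Longrightarrow> frontier A (iwrite a c x s) u \<longleftrightarrow> frontier A s u"
  by (simp add: frontier_def)

lemma heap_state_tick [simp]: "heap_state R m (tick c s) \<longleftrightarrow> heap_state R m s"
  by (simp add: heap_state_def)

abbreviation scanned :: "state \<Rightarrow> state \<Rightarrow> bool" where
  "scanned \<equiv> agree {acur, avert, ark, ah1, ah2, astack} {vN, vT, vt, vu} {dkey, dtmp}"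

text \<open>Taking the minimum with the distance from \<open>v\<close> is idempotent. The assumption
  \<open>fr\<close> therefore admits both stages of \<open>u\<close>, and \<open>scan\<close> need
  not argue that a neighbour is met only once.\<close>

lemma scan_step:
  assumes h: "heap_state R m s" and b: "ints s 0 vbest = 0" and n: "ints s 0 vn = length xs"
    and e: "\<And>q. ints s aslot (q * ints s 0 vn) = 0"
    and v: "v = ints s 0 vv" "v < length xs"
    and u: "u = ints s anbr (Suc (ints s 0 vt))" "u < length xs"
    and fr: "ints s apos u = 0 \<Longrightarrow> frontier A s u \<or> frontier (insert v A) s u"
  shows "wp scan_step (\<lambda>t. (\<exists>m'\<le>m + 7. heap_state R m' t) \<and> ints t 0 vt = Suc (ints s 0 vt) \<and>
    (ints s apos u = 0 \<longrightarrow> frontier (insert v A) t u) \<and>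
    (\<forall>w. w \<noteq> u \<longrightarrow> ints t acur w = ints s acur w \<and> dists t dkey w = dists s dkey w) \<and>
    (ints s acur u \<noteq> 0 \<longrightarrow> ints t acur u \<noteq> 0) \<and>
    ints t 0 vN \<le> ints s 0 vN + 1 \<and> time t \<le> time s + 40 \<and> scanned s t) s" (is "wp _ ?Q _")
proof -
  define s1 where "s1 = tick 1 (iwrite 0 vu u (tick 1 (iwrite 0 vt (Suc (ints s 0 vt)) s)))"
  define s2 where "s2 = tick 1 (dwrite dtmp 0 (dst v u) (tick 1 s1))"
  have s1: "ints s1 a = (if a = 0 then (ints s 0)(vt := Suc (ints s 0 vt), vu := u) else ints s a)"
    "dists s1 = dists s" "time s1 = time s + 2" "queries s1 = queries s" for a
    by (auto simp: s1_def)
  have s2: "ints s2 = ints s1" "dists s2 a = (if a = dtmp then (dists s dtmp)(0 := dst v u) else dists s a)"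
    "time s2 = time s + 4" "queries s2 = queries s" for a
    by (auto simp: s2_def s1)
  \<comment> \<open>A decrease passes one more test than an insertion, so the states before
    \<open>put\<close> differ by one tick.\<close>
  have do_put: "wp put ?Q s'"
    if s': "s' = tick 1 s2 \<or> s' = tick 1 (tick 1 s2)" and "ints s apos u = 0"
      and le: "ints s acur u = 0 \<or> dst v u < dists s dkey u" for s'
  proof (rule wp_conseq[OF put[of R m _ u]])
    have *: "ints s' = ints s1" "dists s' = dists s2" "time s' \<le> time s + 6" "queries s' = queries s"
      using s' s2 by auto
    show "heap_state R m s'" using h by (simp add: heap_state_def * s1 s2)
    show "u = ints s' 0 vu" "u < ints s' 0 vn" "ints s' apos u = 0" "ints s' 0 vbest = 0"
      using that u n b by (simp_all add: * s1 s2)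
    show "0 < ints s' acur u \<Longrightarrow> dists s' dtmp 0 \<le> dists s' dkey u"
      using le by (auto simp: * s1 s2)
    show "ints s' aslot (q * ints s' 0 vn) = 0" for q using e by (simp add: * s1)
    fix t assume t: "(\<exists>m'\<le>m + 7. heap_state R m' t) \<and>
      ints t acur = (ints s' acur)(u := Suc (ints s' 0 vN)) \<and>
      dists t dkey = (dists s' dkey)(u := dists s' dtmp 0) \<and> ints t 0 vN = Suc (ints s' 0 vN) \<and>
      time t \<le> time s' + 30 \<and>
      agree {acur, avert, ark, ah1, ah2, astack} {vN, vT} {dkey} s' t"
    have "frontier (insert v A) t u"
      using fr[OF \<open>ints s apos u = 0\<close>] le t
      by (auto simp: frontier_def * s1 s2 split: if_splits intro: order.trans[OF less_imp_le])
    moreover have "scanned s t" using t by (simp add: agree_def * s1 s2)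
    ultimately show "?Q t" using t * by (auto simp: s1 s2 agree_def)
  qed
  show ?thesis
  proof (cases "ints s apos u = 0")
    case False
    moreover have "\<exists>m'\<le>m + 7. heap_state R m' (tick 1 (tick 1 s1))"
      using h by (intro exI[of _ m]) (simp add: heap_state_def s1)
    ultimately show ?thesis unfolding scan_step_def
      by (simp add: s1_def u(1)[symmetric] heap_state_def agree_def)
  next
    case pos: True
    show ?thesis
    proof (cases "ints s acur u = 0 \<or> dst v u < dists s dkey u")
      case True
      then show ?thesis
        using pos v(2) u(2) do_put[OF _ pos True, of "tick 1 s2"] do_put[OF _ pos True, of "tick 1 (tick 1 s2)"]
        unfolding scan_step_def
        by (cases "ints s acur u = 0") (simp_all add: s1_def s2_def dst_def u(1)[symmetric] v(1)[symmetric])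
    next
      case False
      have "\<exists>m'\<le>m + 7. heap_state R m' (tick 1 (tick 1 (tick 1 s2)))"
        using h by (intro exI[of _ m]) (simp add: heap_state_def s1 s2)
      moreover have "frontier (insert v A) (tick 1 (tick 1 (tick 1 s2))) u"
        using fr[OF pos] False by (auto simp: frontier_def s1 s2 not_less)
      ultimately have "?Q (tick 1 (tick 1 (tick 1 s2)))"
        by (simp add: agree_def s1 s2)
      then show ?thesis
        using pos v(2) u(2) False unfolding scan_step_def
        by (simp add: s1_def s2_def dst_def u(1)[symmetric] v(1)[symmetric])
    qed
  qed
qed

text \<open>During the scan the frontier refers to \<open>insert v A\<close> for the neighbours
  already listed and for all non-neighbours, and to \<open>A\<close> for the others.\<close>

lemma scan:
  assumes h: "heap_state R m s" and b: "ints s 0 vbest = 0" and n: "ints s 0 vn = length xs"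
    and e: "\<And>q. ints s aslot (q * ints s 0 vn) = 0"
    and v: "v = ints s 0 vv" "v < length xs" "ints s apos v \<noteq> 0"
    and nb: "ints s anbr 0 = length (nbrs v)" "\<And>i. i < length (nbrs v) \<Longrightarrow> ints s anbr (Suc i) = nbrs v ! i"
    and fr: "\<And>u. u < length xs \<Longrightarrow> ints s apos u = 0 \<Longrightarrow> frontier A s u"
  shows "wp scan (\<lambda>t. (\<exists>m'\<le>m + 7 * length (nbrs v). heap_state R m' t) \<and>
    (\<forall>u<length xs. ints s apos u = 0 \<longrightarrow> frontier (insert v A) t u) \<and>
    (\<forall>u. ints s acur u \<noteq> 0 \<longrightarrow> ints t acur u \<noteq> 0) \<and>
    ints t 0 vN \<le> ints s 0 vN + length (nbrs v) \<and> time t \<le> time s + 50 * length (nbrs v) + 2 \<and> scanned s t) s" (is "wp _ ?Q _")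
proof -
  define l where "l = length (nbrs v)"
  define I where "I = (\<lambda>t. \<exists>i m'. ints t 0 vt = i \<and> i \<le> l \<and> m' \<le> m + 7 * i \<and> heap_state R m' t \<and>
    (\<forall>u<length xs. ints s apos u = 0 \<longrightarrow>
       frontier (if u \<in> set (take i (nbrs v)) \<or> u \<notin> set (nbrs v) then insert v A else A) t u) \<and>
    (\<forall>u. ints s acur u \<noteq> 0 \<longrightarrow> ints t acur u \<noteq> 0) \<and>
    ints t 0 vN \<le> ints s 0 vN + i \<and> time t \<le> time s + 1 + 50 * i \<and> scanned s t)"
  have "wp (Loop (Less (var vt) (Cell anbr (Const 0))) scan_step) ?Q
    (tick 1 (iwrite 0 vt 0 s))"
  proof (rule wp_Loop[where I = I and \<mu> = "\<lambda>t. l - ints t 0 vt"])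
    \<comment> \<open>A non-neighbour other than \<open>v\<close> has infinite distance to
      \<open>v\<close>, so adding \<open>v\<close> changes nothing for it.\<close>
    have "frontier (insert v A) s u" if u: "u < length xs" "ints s apos u = 0" "u \<notin> set (nbrs v)" for u
    proof -
      have "u \<noteq> v" using u v by auto
      then have "dst v u = \<infinity>" using u set_nbrs[OF v(2)] by (auto simp: less_top)
      then show ?thesis using fr[OF u(1,2)] by (auto simp: frontier_def)
    qed
    then show "I (tick 1 (iwrite 0 vt 0 s))"
      unfolding I_def using h fr
      by (rule_tac exI[of _ 0], rule_tac exI[of _ m]) (auto simp: heap_state_def agree_def)
  next
    fix t assume "I t" and c: "bval t (Less (var vt) (Cell anbr (Const 0)))"
    then obtain m' where I: "ints t 0 vt \<le> l" "m' \<le> m + 7 * ints t 0 vt" "heap_state R m' t"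
      "\<And>u. u<length xs \<Longrightarrow> ints s apos u = 0 \<Longrightarrow>
       frontier (if u \<in> set (take (ints t 0 vt) (nbrs v)) \<or> u \<notin> set (nbrs v) then insert v A else A) t u"
      "\<And>u. ints s acur u \<noteq> 0 \<Longrightarrow> ints t acur u \<noteq> 0"
      "ints t 0 vN \<le> ints s 0 vN + ints t 0 vt" "time t \<le> time s + 1 + 50 * ints t 0 vt" and a: "scanned s t"
      unfolding I_def by blast
    define i where "i = ints t 0 vt"
    have at: "ints t anbr = ints s anbr" "ints t apos = ints s apos" "ints t aslot = ints s aslot"
      "ints t 0 vn = ints s 0 vn" "ints t 0 vbest = 0" "ints t 0 vv = v"
      using a b v by (simp_all add: agree_def)
    have il: "i < l" using c at nb(1) by (simp add: i_def l_def)
    define u where "u = nbrs v ! i"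
    have uin: "u \<in> set (nbrs v)" using il by (simp add: u_def l_def)
    then have ul: "u < length xs" using set_nbrs[OF v(2)] by auto
    have tk: "set (take (Suc i) (nbrs v)) = insert u (set (take i (nbrs v)))"
      using il by (simp add: take_Suc_conv_app_nth u_def l_def)
    show "wp scan_step (\<lambda>w. I w \<and> l - ints w 0 vt < l - ints t 0 vt) (tick 1 t)"
    proof (rule wp_conseq[OF scan_step[of R m' _ v u A]])
      show "heap_state R m' (tick 1 t)" using I(3) by (simp add: heap_state_def)
      show "ints (tick 1 t) 0 vbest = 0" "ints (tick 1 t) 0 vn = length xs"
        "\<And>q. ints (tick 1 t) aslot (q * ints (tick 1 t) 0 vn) = 0" "v = ints (tick 1 t) 0 vv"
        using at n e by simp_all
      show "v < length xs" "u < length xs" by fact+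
      show "u = ints (tick 1 t) anbr (Suc (ints (tick 1 t) 0 vt))"
        using at nb(2)[of i] il by (simp add: u_def i_def l_def)
      show "frontier A (tick 1 t) u \<or> frontier (insert v A) (tick 1 t) u" if "ints (tick 1 t) apos u = 0"
        using I(4)[OF ul] that at by (auto simp: frontier_def split: if_splits)
      fix w assume w: "(\<exists>m''\<le>m' + 7. heap_state R m'' w) \<and> ints w 0 vt = Suc (ints (tick 1 t) 0 vt) \<and>
        (ints (tick 1 t) apos u = 0 \<longrightarrow> frontier (insert v A) w u) \<and>
        (\<forall>y. y \<noteq> u \<longrightarrow> ints w acur y = ints (tick 1 t) acur y \<and> dists w dkey y = dists (tick 1 t) dkey y) \<and>
        (ints (tick 1 t) acur u \<noteq> 0 \<longrightarrow> ints w acur u \<noteq> 0) \<and>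
        ints w 0 vN \<le> ints (tick 1 t) 0 vN + 1 \<and> time w \<le> time (tick 1 t) + 40 \<and> scanned (tick 1 t) w"
      then obtain m'' where m'': "m'' \<le> m' + 7" "heap_state R m'' w" by blast
      have aw: "scanned t w" using w by (simp add: agree_def)
      have fw: "frontier (if y \<in> set (take (Suc i) (nbrs v)) \<or> y \<notin> set (nbrs v) then insert v A else A) w y"
        if y: "y < length xs" "ints s apos y = 0" for y
      proof (cases "y = u")
        case True
        then show ?thesis using w y at tk by simp
      next
        case False
        then have "ints w acur y = ints t acur y" "dists w dkey y = dists t dkey y" using w by auto
        then show ?thesis using I(4)[OF y] False tk by (simp add: frontier_def i_def[symmetric])
      qed
      have cw: "ints w acur y \<noteq> 0" if "ints s acur y \<noteq> 0" for y
        using I(5)[OF that] w by (cases "y = u") auto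
      have "I w" unfolding I_def
      proof (rule exI[of _ "Suc i"], rule exI[of _ m''], intro conjI)
        show "ints w 0 vt = Suc i" using w by (simp add: i_def)
        show "Suc i \<le> l" using il by simp
        show "m'' \<le> m + 7 * Suc i" using m''(1) I(2) by (simp add: i_def)
        show "heap_state R m'' w" by fact
        show "ints w 0 vN \<le> ints s 0 vN + Suc i" using w I(6) by (simp add: i_def)
        show "time w \<le> time s + 1 + 50 * Suc i" using w I(7) by (simp add: i_def)
        show "scanned s w" by (rule agree_trans[OF a aw])
      qed (use fw cw in blast)+
      then show "I w \<and> l - ints w 0 vt < l - ints t 0 vt" using w il by (simp add: i_def)
    qed
  next
    fix t assume "I t" and c: "\<not> bval t (Less (var vt) (Cell anbr (Const 0)))"
    then obtain m' where I: "ints t 0 vt \<le> l" "m' \<le> m + 7 * ints t 0 vt" "heap_state R m' t"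
      "\<And>u. u<length xs \<Longrightarrow> ints s apos u = 0 \<Longrightarrow>
       frontier (if u \<in> set (take (ints t 0 vt) (nbrs v)) \<or> u \<notin> set (nbrs v) then insert v A else A) t u"
      "\<And>u. ints s acur u \<noteq> 0 \<Longrightarrow> ints t acur u \<noteq> 0"
      "ints t 0 vN \<le> ints s 0 vN + ints t 0 vt" "time t \<le> time s + 1 + 50 * ints t 0 vt" and a: "scanned s t"
      unfolding I_def by blast
    have "ints t anbr = ints s anbr" using a by (simp add: agree_def)
    then have il: "ints t 0 vt = l" using c nb(1) I(1) by (simp add: l_def)
    have "frontier (insert v A) (tick 1 t) u" if "u < length xs" "ints s apos u = 0" for u
      using I(4)[OF that] il by (auto simp: frontier_def l_def split: if_splits)
    moreover have "heap_state R m' (tick 1 t)" using I(3) by (simp add: heap_state_def)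
    moreover have "scanned s (tick 1 t)" using a by (simp add: agree_def)
    ultimately show "?Q (tick 1 t)"
      using I il by (auto simp: l_def)
  qed
  then show ?thesis unfolding scan_def by simp
qed

lemma push_kids:
  assumes r: "ints s 0 vr = 0" "ints s ark (ints s 0 vv) = q * ints s 0 vn" "0 < ints s 0 vn"
  shows "wp push_kids (\<lambda>t. ints t 0 vT = ints s 0 vT + q \<and>
    (\<forall>i<ints s 0 vT. ints t astack i = ints s astack i) \<and>
    (\<forall>i<q. ints t astack (ints s 0 vT + i) = ints s akid (ints s 0 vv + i * ints s 0 vn)) \<and>
    time t \<le> time s + 10 * q + 1 \<and> agree {astack} {vT, vr} {} s t) s" (is "wp _ ?Q _")
proof -
  let ?I = "\<lambda>t. \<exists>j\<le>q. ints t 0 vr = j * ints s 0 vn \<and> ints t 0 vT = ints s 0 vT + j \<and>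
    (\<forall>i<ints s 0 vT. ints t astack i = ints s astack i) \<and>
    (\<forall>i<j. ints t astack (ints s 0 vT + i) = ints s akid (ints s 0 vv + i * ints s 0 vn)) \<and>
    time t \<le> time s + 10 * j \<and> agree {astack} {vT, vr} {} s t"
  show ?thesis unfolding push_kids_def
  proof (rule wp_Loop[where I = ?I
      and \<mu> = "\<lambda>t. ints s 0 vT + q - ints t 0 vT"])
    show "?I s"
      using r(1) by (intro exI[of _ 0]) simp
  next
    fix t assume "?I t"
      and c: "bval t (Less (var vr) (Cell ark (var vv)))"
    then obtain j where j: "j \<le> q" "ints t 0 vr = j * ints s 0 vn" "ints t 0 vT = ints s 0 vT + j"
      "\<forall>i<ints s 0 vT. ints t astack i = ints s astack i"
      "\<forall>i<j. ints t astack (ints s 0 vT + i) = ints s akid (ints s 0 vv + i * ints s 0 vn)"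
      "time t \<le> time s + 10 * j" and a: "agree {astack} {vT, vr} {} s t" by blast
    have at: "ints t ark = ints s ark" "ints t 0 vv = ints s 0 vv" "ints t akid = ints s akid" "ints t 0 vn = ints s 0 vn"
      using a by (simp_all add: agree_def)
    have "j < q" using c j(2) r at by simp
    then show "wp (push (Cell akid (Plus (var vv) (var vr))) ;; vr ::= Plus (var vr) (var vn))
      (\<lambda>u. ?I u \<and>
        ints s 0 vT + q - ints u 0 vT < ints s 0 vT + q - ints t 0 vT) (tick 1 t)"
      using j a at by (auto simp: push_def agree_def less_Suc_eq intro!: exI[of _ "Suc j"])
  next
    fix t assume "?I t"
      and c: "\<not> bval t (Less (var vr) (Cell ark (var vv)))"
    then obtain j where j: "j \<le> q" "ints t 0 vr = j * ints s 0 vn" "ints t 0 vT = ints s 0 vT + j"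
      "\<forall>i<ints s 0 vT. ints t astack i = ints s astack i"
      "\<forall>i<j. ints t astack (ints s 0 vT + i) = ints s akid (ints s 0 vv + i * ints s 0 vn)"
      "time t \<le> time s + 10 * j" and a: "agree {astack} {vT, vr} {} s t" by blast
    have "ints t ark = ints s ark" "ints t 0 vv = ints s 0 vv"
      using a by (simp_all add: agree_def)
    then have "q * ints s 0 vn \<le> j * ints s 0 vn" using c j(2) r(2) by (auto simp: not_less)
    then have "j = q" using r(3) j(1) by simp
    then show "?Q (tick 1 t)"
      using j a by (auto simp: agree_def)
  qed
qed

lemma extract_min:
  assumes h: "heap_state R m s" and b: "0 < ints s 0 vbest" and n: "ints s 0 vn = length xs"
    and e: "\<And>q. ints s aslot (q * ints s 0 vn) = 0"
    and R: "\<And>r. 2 ^ (r div 2) \<le> ints s 0 vN \<Longrightarrow> r \<le> R"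
    and v: "v = ints s avert (ints s 0 vbest)"
  shows "wp extract_min (\<lambda>t. (\<exists>m'\<le>m + 2 * R. heap_state R m' t) \<and> ints t 0 vv = v \<and> ints t 0 vbest = 0 \<and>
    ints t 0 vj = Suc (ints s 0 vj) \<and> ints t aord = (ints s aord)(ints s 0 vj := v) \<and>
    dists t dlink = (dists s dlink)(ints s 0 vj := dists s dkey v) \<and>
    ints t apos = (ints s apos)(v := Suc (ints s 0 vj)) \<and>
    ints t anbr 0 = length (nbrs v) \<and> (\<forall>i<length (nbrs v). ints t anbr (Suc i) = nbrs v ! i) \<and>
    time t \<le> time s + 10 * R + length (nbrs v) + 15 \<and>
    agree {astack, aord, apos, anbr} {vT, vr, vv, vbest, vj} {dlink} s t) s" (is "wp _ ?Q _")
    "v < length xs" "ints s acur v \<noteq> 0" "ints s apos v = 0"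
proof -
  obtain q where
    vn: "v < ints s 0 vn" "ints s acur v = ints s 0 vbest" "ints s apos v = 0" and
    q: "ints s ark v = q * ints s 0 vn" "q \<le> R" and
    ex: "\<And>p S'. 0 < p \<Longrightarrow> (\<And>i. i < ints s 0 vT \<Longrightarrow> S' i = ints s astack i) \<Longrightarrow>
      (\<And>i. i < q \<Longrightarrow> S' (ints s 0 vT + i) = ints s akid (v + i * ints s 0 vn)) \<Longrightarrow>
      \<exists>m'\<le>m + 2 * R. heap (ints s 0 vn) R (ints s 0 vN) m' (ints s avert) (ints s acur) (ints s ark)
        (ints s akid) (ints s ah1) (ints s ah2) (dists s dkey) ((ints s apos)(v := p)) (ints s 0 vT + q) S'
        (ints s aslot) (ints s 0 vmax) 0"
    unfolding v by (rule heap_extract[OF h[unfolded heap_state_def] e b R]) blast+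
  show vl: "v < length xs" and "ints s acur v \<noteq> 0" "ints s apos v = 0" using vn b n by auto
  define s1 where "s1 = tick 1 (iwrite 0 vr 0 (tick 1 (iwrite 0 vbest 0 (tick 1 (iwrite 0 vv v s)))))"
  have s1: "ints s1 a = (if a = 0 then (ints s 0)(vv := v, vbest := 0, vr := 0) else ints s a)"
    "dists s1 = dists s" "time s1 = time s + 3" "queries s1 = queries s" for a
    by (auto simp: s1_def)
  have "wp push_kids (wp (ISet aord (var vj) (var vv) ;;
      DSet dlink (var vj) (DCell dkey (var vv)) ;;
      vj ::= Plus (var vj) (Const 1) ;;
      ISet apos (var vv) (var vj) ;;
      Neighbours anbr (var vv)) ?Q) s1"
  proof (rule wp_conseq[OF push_kids[of s1 q]])
    show "ints s1 0 vr = 0" "ints s1 ark (ints s1 0 vv) = q * ints s1 0 vn" "0 < ints s1 0 vn"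
      using q vn by (simp_all add: s1)
    fix t assume t: "ints t 0 vT = ints s1 0 vT + q \<and>
      (\<forall>i<ints s1 0 vT. ints t astack i = ints s1 astack i) \<and>
      (\<forall>i<q. ints t astack (ints s1 0 vT + i) = ints s1 akid (ints s1 0 vv + i * ints s1 0 vn)) \<and>
      time t \<le> time s1 + 10 * q + 1 \<and> agree {astack} {vT, vr} {} s1 t"
    have at: "ints t a = ints s a" if "a \<noteq> 0" "a \<noteq> astack" for a
      using t that by (simp add: agree_def s1)
    have av: "ints t 0 c = ints s1 0 c" if "c \<noteq> vT" "c \<noteq> vr" for c
      using t that by (simp add: agree_def s1)
    have dt: "dists t a = dists s a" "queries t = queries s" for a
      using t by (simp_all add: agree_def s1)
    have hh: "\<exists>m'\<le>m + 2 * R. heap (ints s 0 vn) R (ints s 0 vN) m' (ints s avert) (ints s acur) (ints s ark)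
        (ints s akid) (ints s ah1) (ints s ah2) (dists s dkey) ((ints s apos)(v := Suc (ints s 0 vj)))
        (ints s 0 vT + q) (ints t astack) (ints s aslot) (ints s 0 vmax) 0"
      by (rule ex) (use t in \<open>auto simp: s1\<close>)
    show "wp (ISet aord (var vj) (var vv) ;;
      DSet dlink (var vj) (DCell dkey (var vv)) ;;
      vj ::= Plus (var vj) (Const 1) ;;
      ISet apos (var vv) (var vj) ;;
      Neighbours anbr (var vv)) ?Q t"
      using hh t q(2) vl by (simp add: heap_state_def agree_def at av dt s1)
  qed
  then show "wp extract_min ?Q s"
    unfolding extract_min_def by (simp add: s1_def v[symmetric])
qed

text \<open>What remains of a minimum spanning tree: \<open>w i\<close> is the least weight across
  the cut after the first \<open>i\<close> vertices, attained by an edge into the next vertex. The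
  other endpoint of that edge is not recorded.\<close>

definition prim_order :: "(nat \<Rightarrow> nat) \<Rightarrow> (nat \<Rightarrow> ereal) \<Rightarrow> nat \<Rightarrow> bool" where
  "prim_order ord w j \<longleftrightarrow> inj_on ord {..<j} \<and> ord ` {..<j} \<subseteq> {..<length xs} \<and>
     (\<forall>i<j. 0 < i \<longrightarrow> (\<exists>a<i. w i = dst (ord a) (ord i)) \<and>
       (\<forall>a<i. \<forall>v<length xs. v \<notin> ord ` {..<i} \<longrightarrow> w i \<le> dst (ord a) v))"

lemma prim_order_extend:
  assumes "prim_order ord w j" "v < length xs" "v \<notin> ord ` {..<j}"
    and "0 < j \<Longrightarrow> \<exists>a\<in>ord ` {..<j}. K = dst a v"
    and "\<And>a u. a \<in> ord ` {..<j} \<Longrightarrow> u < length xs \<Longrightarrow> u \<notin> ord ` {..<j} \<Longrightarrow> K \<le> dst a u"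
  shows "prim_order (ord(j := v)) (w(j := K)) (Suc j)"
proof -
  have im: "(ord(j := v)) ` {..<i} = ord ` {..<i}" if "i \<le> j" for i
    using that by (auto simp: image_def)
  have im2: "(ord(j := v)) ` {..<Suc j} = insert v (ord ` {..<j})"
    by (auto simp: lessThan_Suc image_def split: if_splits)
  have "inj_on (ord(j := v)) {..<Suc j}"
    using assms(1,3) unfolding prim_order_def lessThan_Suc by (auto simp: inj_on_def)
  moreover have "(\<exists>a<i. (w(j := K)) i = dst ((ord(j := v)) a) ((ord(j := v)) i)) \<and>
       (\<forall>a<i. \<forall>u<length xs. u \<notin> (ord(j := v)) ` {..<i} \<longrightarrow> (w(j := K)) i \<le> dst ((ord(j := v)) a) u)"
    if i: "i < Suc j" "0 < i" for i
  proof (cases "i = j")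
    case True
    then obtain a where "a < j" "K = dst (ord a) v" using assms(4) i by auto
    then show ?thesis using True assms(5) im[of j] by (intro conjI exI[of _ a]) auto
  next
    case False
    then have "i < j" using i by simp
    then obtain a where "a < i" "w i = dst (ord a) (ord i)"
      using assms(1) i unfolding prim_order_def by blast
    then show ?thesis
      using \<open>i < j\<close> assms(1) i im[of i] unfolding prim_order_def by (intro conjI exI[of _ a]) auto
  qed
  ultimately show ?thesis
    using assms(1,2) unfolding prim_order_def im2 by auto
qed

lemma prim_order_image:
  assumes "prim_order ord w (length xs)"
  shows "ord ` {..<length xs} = {..<length xs}"
  using assms unfolding prim_order_def by (intro card_subset_eq) (auto simp: card_image)

text \<open>The exceptional disjunct concerns the very first vertex: it is in the heap while nothing
  is visited, so its key cannot be a distance to the visited set. The last clause makes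
  \<open>vp\<close> a one-way pointer in the search for new components.\<close>

definition prim_inv :: "state \<Rightarrow> bool" where
  "prim_inv s \<longleftrightarrow> ints s 0 vn = length xs \<and> prim_order (ints s aord) (dists s dlink) (ints s 0 vj) \<and>
     (\<forall>i<ints s 0 vj. ints s apos (ints s aord i) = Suc i) \<and>
     (\<forall>v<length xs. ints s apos v \<noteq> 0 \<longrightarrow> v \<in> ints s aord ` {..<ints s 0 vj}) \<and>
     (\<forall>v<length xs. ints s apos v = 0 \<longrightarrow> frontier (ints s aord ` {..<ints s 0 vj}) s v \<or>
        ints s 0 vj = 0 \<and> v = 0 \<and> ints s acur v \<noteq> 0) \<and>
     ints s 0 vp \<le> length xs \<and> (\<forall>v<ints s 0 vp. ints s apos v \<noteq> 0 \<or> ints s acur v \<noteq> 0)"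

lemma prim_invD:
  assumes "prim_inv s"
  shows "ints s 0 vn = length xs" "prim_order (ints s aord) (dists s dlink) (ints s 0 vj)"
    "i < ints s 0 vj \<Longrightarrow> ints s apos (ints s aord i) = Suc i"
    "v < length xs \<Longrightarrow> ints s apos v \<noteq> 0 \<Longrightarrow> v \<in> ints s aord ` {..<ints s 0 vj}"
    "v < length xs \<Longrightarrow> ints s apos v = 0 \<Longrightarrow> frontier (ints s aord ` {..<ints s 0 vj}) s v \<or>
        ints s 0 vj = 0 \<and> v = 0 \<and> ints s acur v \<noteq> 0"
    "ints s 0 vp \<le> length xs" "v < ints s 0 vp \<Longrightarrow> ints s apos v \<noteq> 0 \<or> ints s acur v \<noteq> 0"
  using assms unfolding prim_inv_def by blast+

lemma frontier_cong:
  "ints t acur = ints s acur \<Longrightarrow> dists t dkey = dists s dkey \<Longrightarrow> frontier A t u \<longleftrightarrow> frontier A s u"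
  by (simp add: frontier_def)

lemma prim_inv_cong:
  assumes "prim_inv s" "ints t aord = ints s aord" "ints t apos = ints s apos" "ints t acur = ints s acur"
    "dists t dkey = dists s dkey" "dists t dlink = dists s dlink"
    "ints t 0 vn = ints s 0 vn" "ints t 0 vj = ints s 0 vj" "ints t 0 vp = ints s 0 vp"
  shows "prim_inv t"
  using assms unfolding prim_inv_def by (simp add: frontier_cong[OF assms(4,5)])

definition degree_sum :: "state \<Rightarrow> nat" where
  "degree_sum s = (\<Sum>i<ints s 0 vj. length (nbrs (ints s aord i)))"

lemma prim_order_length:
  assumes "prim_order ord w j" shows "j \<le> length xs"
proof -
  have "j = card (ord ` {..<j})" using assms by (simp add: prim_order_def card_image)
  also have "\<dots> \<le> card {..<length xs}" using assms by (intro card_mono) (auto simp: prim_order_def)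
  finally show ?thesis by simp
qed

lemma degree_sum_le:
  assumes "prim_inv s" shows "degree_sum s \<le> length xs * length xs"
proof -
  note po = prim_invD(2)[OF assms]
  have "degree_sum s \<le> (\<Sum>i<ints s 0 vj. length xs)"
    unfolding degree_sum_def using po by (intro sum_mono length_nbrs) (auto simp: prim_order_def)
  also have "\<dots> \<le> length xs * length xs" using prim_order_length[OF po] by simp
  finally show ?thesis .
qed

abbreviation prim_agree :: "state \<Rightarrow> state \<Rightarrow> bool" where
  "prim_agree \<equiv> agree ({2..11} \<union> {anbr}) {2..13} {dkey, dlink, dtmp}"

lemma agree_mono: "agree A V D s t \<Longrightarrow> A \<subseteq> A' \<Longrightarrow> V \<subseteq> V' \<Longrightarrow> D \<subseteq> D' \<Longrightarrow> agree A' V' D' s t"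
  unfolding agree_def by blast

text \<open>Every node comes from a step of \<open>vp\<close> or from a scanned edge, which bounds
  \<open>vN\<close>. In the time potential, each visited vertex and each step of \<open>vp\<close>
  is charged in proportion to \<open>R + 1\<close>, and each scanned edge a constant.\<close>

definition prim_state :: "nat \<Rightarrow> nat \<Rightarrow> nat \<Rightarrow> state \<Rightarrow> bool" where
  "prim_state R B m s \<longleftrightarrow> heap_state R m s \<and> prim_inv s \<and> ints s 0 vbest = 0 \<and>
     (\<forall>q. ints s aslot (q * ints s 0 vn) = 0) \<and> ints s 0 vN \<le> ints s 0 vp + degree_sum s \<and>
     time s + 40 * m \<le> B + 500 * ((ints s 0 vj + ints s 0 vp) * (R + 1) + degree_sum s)"

text \<open>A scanned edge costs one unit for its listing, 50 for the scan and seven credits of 40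
  units: 331 in total, within the 500 allotted. The \<open>2 * R\<close> credits for the children of
  the minimum are covered by the share of the new vertex.\<close>

lemma prim_extract:
  assumes P: "prim_inv s" and h: "heap_state R m s" and b: "0 < ints s 0 vbest"
    and e: "\<And>q. ints s aslot (q * ints s 0 vn) = 0"
    and R: "\<And>r. 2 ^ (r div 2) \<le> ints s 0 vN \<Longrightarrow> r \<le> R"
    and N: "ints s 0 vN \<le> ints s 0 vp + degree_sum s"
    and mn: "\<And>v. v < length xs \<Longrightarrow> ints s acur v \<noteq> 0 \<Longrightarrow> ints s apos v = 0 \<Longrightarrow>
       dists s dkey (ints s avert (ints s 0 vbest)) \<le> dists s dkey v"
    and tm: "time s + 40 * m + 220 * (R + 1) + 23 \<le> B + 500 * ((Suc (ints s 0 vj) + ints s 0 vp) * (R + 1) + degree_sum s)"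
  shows "wp (extract_min ;; scan) (\<lambda>t. (\<exists>m'. prim_state R B m' t) \<and> ints t 0 vj = Suc (ints s 0 vj) \<and>
    ints t 0 vp = ints s 0 vp \<and> prim_agree s t) s" (is "wp _ ?Q _")
proof -
  define j where "j = ints s 0 vj"
  define A where "A = ints s aord ` {..<j}"
  define v where "v = ints s avert (ints s 0 vbest)"
  note n = prim_invD(1)[OF P]
  note ex = extract_min[OF h b n e R v_def]
  note po = prim_invD(2)[OF P, folded j_def]
  have vA: "v \<notin> A"
    using prim_invD(3)[OF P] ex(4) by (auto simp: A_def j_def)
  have uA: "ints s apos u = 0" if "u < length xs" "u \<notin> A" for u
    using prim_invD(4)[OF P that(1)] that(2) by (auto simp: A_def j_def)
  \<comment> \<open>If the exceptional disjunct of \<open>prim_inv\<close> held for some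
    \<open>u\<close> other than \<open>v\<close>, then \<open>v\<close> would be in the heap with a
    key attained on the empty set.\<close>
  have fr: "frontier A s u" if "u < length xs" "ints s apos u = 0" "u \<noteq> v \<or> 0 < j" for u
  proof (rule ccontr)
    assume nf: "\<not> frontier A s u"
    then have u: "j = 0" "u = 0" using prim_invD(5)[OF P that(1,2)] by (auto simp: A_def j_def)
    then have "v \<noteq> 0" using that by auto
    then have "frontier A s v" using prim_invD(5)[OF P ex(2,4)] by (auto simp: A_def j_def)
    then show False using ex(3) u by (simp add: frontier_def A_def)
  qed
  have po': "prim_order ((ints s aord)(j := v)) ((dists s dlink)(j := dists s dkey v)) (Suc j)"
  proof (rule prim_order_extend[OF po ex(2), folded A_def])
    show "v \<notin> A" by (rule vA)
    show "0 < j \<Longrightarrow> \<exists>a\<in>A. dists s dkey v = dst a v"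
      using fr[OF ex(2,4)] ex(3) by (auto simp: frontier_def)
    fix a u assume a: "a \<in> A" and u: "u < length xs" "u \<notin> A"
    then have "0 < j" by (auto simp: A_def)
    then have f: "frontier A s u" using fr[OF u(1) uA[OF u]] by simp
    show "dists s dkey v \<le> dst a u"
    proof (cases "ints s acur u = 0")
      case True
      then show ?thesis using f a by (simp add: frontier_def)
    next
      case False
      then have "dists s dkey u \<le> dst a u" using f a by (simp add: frontier_def)
      moreover have "dists s dkey v \<le> dists s dkey u"
        using mn[OF u(1) False uA[OF u]] by (simp add: v_def)
      ultimately show ?thesis by simp
    qed
  qed
  have "wp extract_min (wp scan ?Q) s"
  proof (rule wp_conseq[OF ex(1)])
    fix s3 assume s3: "(\<exists>m'\<le>m + 2 * R. heap_state R m' s3) \<and> ints s3 0 vv = v \<and> ints s3 0 vbest = 0 \<and>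
      ints s3 0 vj = Suc (ints s 0 vj) \<and> ints s3 aord = (ints s aord)(ints s 0 vj := v) \<and>
      dists s3 dlink = (dists s dlink)(ints s 0 vj := dists s dkey v) \<and>
      ints s3 apos = (ints s apos)(v := Suc (ints s 0 vj)) \<and>
      ints s3 anbr 0 = length (nbrs v) \<and> (\<forall>i<length (nbrs v). ints s3 anbr (Suc i) = nbrs v ! i) \<and>
      time s3 \<le> time s + 10 * R + length (nbrs v) + 15 \<and>
      agree {astack, aord, apos, anbr} {vT, vr, vv, vbest, vj} {dlink} s s3"
    then obtain m3 where m3: "m3 \<le> m + 2 * R" "heap_state R m3 s3" by blast
    have a3: "ints s3 0 vn = length xs" "ints s3 aslot = ints s aslot" "ints s3 acur = ints s acur"
      "dists s3 dkey = dists s dkey" "ints s3 0 vN = ints s 0 vN" "ints s3 0 vp = ints s 0 vp"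
      using s3 n by (simp_all add: agree_def)
    show "wp scan ?Q s3"
    proof (rule wp_conseq[OF scan[of R m3 s3 v A]])
      show "heap_state R m3 s3" "ints s3 0 vbest = 0" "ints s3 0 vn = length xs" "v = ints s3 0 vv" "v < length xs"
        "ints s3 apos v \<noteq> 0" "ints s3 anbr 0 = length (nbrs v)"
        using m3 s3 a3 ex(2) by simp_all
      show "ints s3 aslot (q * ints s3 0 vn) = 0" for q using e[of q] a3 n by simp
      show "ints s3 anbr (Suc i) = nbrs v ! i" if "i < length (nbrs v)" for i using s3 that by blast
      show "frontier A s3 u" if "u < length xs" "ints s3 apos u = 0" for u
        using fr[OF that(1)] that s3 frontier_cong[OF a3(3,4)] by (auto split: if_splits)
      fix t assume t: "(\<exists>m'\<le>m3 + 7 * length (nbrs v). heap_state R m' t) \<and>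
        (\<forall>u<length xs. ints s3 apos u = 0 \<longrightarrow> frontier (insert v A) t u) \<and>
        (\<forall>u. ints s3 acur u \<noteq> 0 \<longrightarrow> ints t acur u \<noteq> 0) \<and>
        ints t 0 vN \<le> ints s3 0 vN + length (nbrs v) \<and> time t \<le> time s3 + 50 * length (nbrs v) + 2 \<and> scanned s3 t"
      then obtain m4 where m4: "m4 \<le> m3 + 7 * length (nbrs v)" "heap_state R m4 t" by blast
      have at: "ints t aord = (ints s aord)(j := v)" "ints t apos = (ints s apos)(v := Suc j)"
        "dists t dlink = (dists s dlink)(j := dists s dkey v)" "ints t 0 vj = Suc j"
        "ints t 0 vp = ints s 0 vp" "ints t 0 vn = length xs" "ints t aslot = ints s aslot" "ints t 0 vbest = 0"
        using t s3 a3 by (simp_all add: agree_def j_def)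
      have im: "((ints s aord)(j := v)) ` {..<Suc j} = insert v A"
        by (auto simp: A_def lessThan_Suc image_def split: if_splits)
      have deg: "degree_sum t = degree_sum s + length (nbrs v)"
        unfolding degree_sum_def at j_def[symmetric] by simp
      have cm: "ints t acur u \<noteq> 0" if "ints s acur u \<noteq> 0" for u
        using t that unfolding a3(3)[symmetric] by blast
      have "prim_inv t"
        unfolding prim_inv_def at im
      proof (intro conjI allI impI)
        fix i assume "i < Suc j"
        then show "((ints s apos)(v := Suc j)) (((ints s aord)(j := v)) i) = Suc i"
          using prim_invD(3)[OF P, of i] vA by (auto simp: A_def j_def)
      next
        fix u assume u: "u < length xs" "((ints s apos)(v := Suc j)) u \<noteq> 0"
        then show "u \<in> insert v A"
          using uA[of u] by (auto split: if_splits)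
      next
        fix u assume "u < length xs" "((ints s apos)(v := Suc j)) u = 0"
        then show "frontier (insert v A) t u \<or> Suc j = 0 \<and> u = 0 \<and> ints t acur u \<noteq> 0"
          using t s3 by (simp add: j_def)
      next
        fix u assume "u < ints s 0 vp"
        then show "((ints s apos)(v := Suc j)) u \<noteq> 0 \<or> ints t acur u \<noteq> 0"
          using prim_invD(7)[OF P, of u] cm[of u] by auto
      qed (use po' prim_invD(6)[OF P] in auto)
      moreover have "time t + 40 * m4 \<le> time s + 40 * m + 220 * (R + 1) + 23 + 500 * length (nbrs v)"
        using t s3 m3(1) m4(1) by auto
      then have "time t + 40 * m4 \<le> B + 500 * ((Suc j + ints s 0 vp) * (R + 1) + degree_sum t)"
        using tm deg by (simp add: j_def)
      moreover have "ints t 0 vN \<le> ints t 0 vp + degree_sum t" using t a3 N deg at by simp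
      ultimately have "prim_state R B m4 t"
        unfolding prim_state_def using m4 e n at by simp
      moreover have "prim_agree s s3"
        by (rule agree_mono[of "{astack, aord, apos, anbr}" "{vT, vr, vv, vbest, vj}" "{dlink}"]) (use s3 in auto)
      moreover have "prim_agree s3 t"
        by (rule agree_mono[of "{acur, avert, ark, ah1, ah2, astack}" "{vN, vT, vt, vu}" "{dkey, dtmp}"])
          (use t in auto)
      ultimately show "?Q t"
        using at agree_trans by (auto simp: j_def)
    qed
  qed
  then show ?thesis by simp
qed

text \<open>The pointer advances even if its vertex is already visited, so there are at most
  \<open>length xs\<close> restarts. It cannot have passed the last vertex: all vertices below it
  are visited, as the heap is empty, but fewer than \<open>length xs\<close> are.\<close>

lemma prim_restart:
  assumes P: "prim_inv s" and h: "heap_state R m s" and b: "ints s 0 vbest = 0" and j: "ints s 0 vj < length xs"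
    and e: "\<And>q. ints s aslot (q * ints s 0 vn) = 0"
    and N: "ints s 0 vN \<le> ints s 0 vp + degree_sum s"
    and mn: "\<And>v. v < length xs \<Longrightarrow> ints s acur v \<noteq> 0 \<Longrightarrow> ints s apos v \<noteq> 0"
    and tm: "time s + 40 * m + 350 \<le> B + 500 * ((ints s 0 vj + Suc (ints s 0 vp)) * (R + 1) + degree_sum s)"
  shows "wp restart (\<lambda>t. (\<exists>m'. prim_state R B m' t) \<and> ints t 0 vj = ints s 0 vj \<and>
    ints t 0 vp = Suc (ints s 0 vp) \<and> Suc (ints s 0 vp) \<le> length xs \<and> prim_agree s t) s" (is "wp _ ?Q _")
proof -
  define j where "j = ints s 0 vj"
  define p where "p = ints s 0 vp"
  define A where "A = ints s aord ` {..<j}"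
  note n = prim_invD(1)[OF P]
  note po = prim_invD(2)[OF P, folded j_def]
  have fr: "frontier A s u \<and> ints s acur u = 0" if "u < length xs" "ints s apos u = 0" for u
    using prim_invD(5)[OF P that] mn[OF that(1)] that(2) by (auto simp: A_def j_def)
  have p: "p < length xs"
  proof (rule ccontr)
    assume "\<not> p < length xs"
    then have "ints s apos v \<noteq> 0" if "v < length xs" for v
      using prim_invD(7)[OF P, of v] mn[OF that] that by (auto simp: p_def)
    then have "{..<length xs} \<subseteq> A" using prim_invD(4)[OF P] by (auto simp: A_def j_def)
    then have "card {..<length xs} \<le> card A" by (intro card_mono) (auto simp: A_def)
    also have "\<dots> \<le> j" unfolding A_def by (metis card_image_le card_lessThan finite_lessThan)
    finally show False using j by (simp add: j_def)
  qed
  show ?thesis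
  proof (cases "ints s apos p = 0")
    case False
    have "prim_inv (iwrite 0 vp (Suc p) s)"
      unfolding prim_inv_def using P p False
      by (auto simp: prim_inv_def p_def less_Suc_eq)
    then have "prim_inv (tick 1 (iwrite 0 vp (Suc p) (tick 1 (tick 1 s))))"
      by (rule prim_inv_cong) simp_all
    then have "prim_state R B m (tick 1 (iwrite 0 vp (Suc p) (tick 1 (tick 1 s))))"
      unfolding prim_state_def using h b e N tm n
      by (simp add: heap_state_def degree_sum_def p_def)
    then show ?thesis
      using False p unfolding restart_def by (auto simp: p_def[symmetric] agree_def)
  next
    case True
    define s1 where "s1 = tick 1 (tick 1 (iwrite 0 vu p (tick 1 s)))"
    define s2 where "s2 = (if 0 < j then tick 1 (dwrite dtmp 0 (dst (ints s aord (j - 1)) p) s1) else tick 1 s1)"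
    have s2: "ints s2 a = (if a = 0 then (ints s 0)(vu := p) else ints s a)"
      "b \<noteq> dtmp \<Longrightarrow> dists s2 b = dists s b" "time s2 = time s + 4" "queries s2 = queries s"
      "0 < j \<Longrightarrow> dists s2 dtmp 0 = dst (ints s aord (j - 1)) p" for a b
      by (auto simp: s2_def s1_def)
    have "wp put (wp (vp ::= Plus (var vp) (Const 1)) ?Q) s2"
    proof (rule wp_conseq[OF put[of R m _ p]])
      show "heap_state R m s2" using h by (simp add: heap_state_def s2)
      show "p = ints s2 0 vu" "p < ints s2 0 vn" "ints s2 apos p = 0" "ints s2 0 vbest = 0"
        using p n True b by (simp_all add: s2)
      show "0 < ints s2 acur p \<Longrightarrow> dists s2 dtmp 0 \<le> dists s2 dkey p"
        using fr[OF p True] by (simp add: s2)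
      show "ints s2 aslot (q * ints s2 0 vn) = 0" for q using e by (simp add: s2)
      fix t assume t: "(\<exists>m'\<le>m + 7. heap_state R m' t) \<and>
        ints t acur = (ints s2 acur)(p := Suc (ints s2 0 vN)) \<and>
        dists t dkey = (dists s2 dkey)(p := dists s2 dtmp 0) \<and> ints t 0 vN = Suc (ints s2 0 vN) \<and>
        time t \<le> time s2 + 30 \<and>
        agree {acur, avert, ark, ah1, ah2, astack} {vN, vT} {dkey} s2 t"
      then obtain m' where m': "m' \<le> m + 7" "heap_state R m' t" by blast
      define t' where "t' = tick 1 (iwrite 0 vp (Suc p) t)"
      have at: "ints t' aord = ints s aord" "ints t' apos = ints s apos" "ints t' 0 vn = length xs"
        "dists t' dlink = dists s dlink" "ints t' 0 vj = j" "ints t' 0 vp = Suc p" "ints t' aslot = ints s aslot"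
        "ints t' acur = (ints s acur)(p := Suc (ints s 0 vN))" "dists t' dkey = (dists s dkey)(p := dists s2 dtmp 0)"
        "ints t' 0 vN = Suc (ints s 0 vN)" "ints t' 0 vbest = 0" "ints t 0 vp = p"
        using t n b by (simp_all add: agree_def s2 t'_def j_def p_def)
      \<comment> \<open>Before the restart this vertex was not in the heap, so all its distances
        from visited vertices are infinite; the distance from the last visited one is thus a correct
        key.\<close>
      have fp: "frontier A t' p" if "0 < j"
      proof -
        have "ints s aord (j - 1) \<in> A" using that by (simp add: A_def)
        moreover have "dst a p = \<infinity>" if "a \<in> A" for a
          using fr[OF p True] that by (simp add: frontier_def)
        ultimately show ?thesis using s2(5)[OF that] by (auto simp: frontier_def at)
      qed
      \<comment> \<open>A vertex passed by the pointer is visited or in the heap, and initially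
        neither is possible. So the first start is at vertex \<open>0\<close>, as the exception in
        \<open>prim_inv\<close> demands.\<close>
      have p0: "p = 0" if "j = 0"
      proof (rule ccontr)
        assume "p \<noteq> 0"
        then have "ints s apos 0 \<noteq> 0" using prim_invD(7)[OF P, of 0] mn[of 0] p by (fastforce simp: p_def)
        moreover have "0 < length xs" using p by linarith
        ultimately show False using prim_invD(4)[OF P, of 0] that by (simp add: j_def)
      qed
      have "prim_inv t'"
        unfolding prim_inv_def at A_def[symmetric]
      proof (intro conjI allI impI)
        fix u assume u: "u < length xs" "ints s apos u = 0"
        show "frontier A t' u \<or> j = 0 \<and> u = 0 \<and> ((ints s acur)(p := Suc (ints s 0 vN))) u \<noteq> 0"
          using fr[OF u] fp p0 by (cases "u = p") (auto simp: frontier_def at)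
      next
        fix u assume "u < Suc p"
        then show "ints s apos u \<noteq> 0 \<or> ((ints s acur)(p := Suc (ints s 0 vN))) u \<noteq> 0"
          using prim_invD(7)[OF P, of u] by (auto simp: p_def less_Suc_eq)
      qed (use po p prim_invD(3,4)[OF P] in \<open>auto simp: A_def j_def\<close>)
      moreover have "degree_sum t' = degree_sum s" by (simp add: degree_sum_def at j_def)
      moreover have "heap_state R m' t'" using m'(2) by (simp add: t'_def heap_state_def)
      moreover have "time t' \<le> time s + 40" using t by (simp add: t'_def s2)
      ultimately have "prim_state R B m' t'"
        unfolding prim_state_def using e n N tm m'(1) by (simp add: at j_def p_def)
      moreover have "prim_agree s t'"
      proof -
        have "prim_agree s s2" by (simp add: agree_def s2)
        also have "prim_agree s2 t"
          by (rule agree_mono[of "{acur, avert, ark, ah1, ah2, astack}" "{vN, vT}" "{dkey}"]) (use t in auto)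
        also have "prim_agree t t'" by (simp add: agree_def t'_def)
        finally show ?thesis .
      qed
      ultimately have "?Q t'" using at p by (auto simp: j_def p_def)
      then show "wp (vp ::= Plus (var vp) (Const 1)) ?Q t" using at(12) by (simp add: t'_def p_def)
    qed
    moreover have "ints s aord (j - 1) < length xs" if "0 < j"
    proof -
      have "ints s aord (j - 1) \<in> ints s aord ` {..<j}" using that by simp
      then show ?thesis using po unfolding prim_order_def by blast
    qed
    ultimately show ?thesis
      using True p unfolding restart_def by (cases "0 < j") (simp_all add: p_def[symmetric] j_def[symmetric] s2_def s1_def dst_def)
  qed
qed

lemma prim_step:
  assumes S: "prim_state R B m s" and j: "ints s 0 vj < length xs"
    and R: "\<And>r. 2 ^ (r div 2) \<le> length xs + length xs * length xs \<Longrightarrow> r \<le> R"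
  shows "wp prim_step (\<lambda>t. (\<exists>m'. prim_state R B m' t) \<and> prim_agree s t \<and>
    (ints t 0 vj = Suc (ints s 0 vj) \<and> ints t 0 vp = ints s 0 vp \<or>
     ints t 0 vj = ints s 0 vj \<and> ints t 0 vp = Suc (ints s 0 vp) \<and> ints t 0 vp \<le> length xs)) (tick 1 s)" (is "wp _ ?Q _")
proof -
  note P = S[unfolded prim_state_def, THEN conjunct2, THEN conjunct1]
  have h: "heap_state R m s" and b: "ints s 0 vbest = 0" and N: "ints s 0 vN \<le> ints s 0 vp + degree_sum s"
    and tm: "time s + 40 * m \<le> B + 500 * ((ints s 0 vj + ints s 0 vp) * (R + 1) + degree_sum s)"
    using S unfolding prim_state_def by auto
  note n = prim_invD(1)[OF P]
  have R': "r \<le> R" if "2 ^ (r div 2) \<le> ints s 0 vN" for r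
    by (rule R) (use that N prim_invD(6)[OF P] degree_sum_le[OF P] in simp)
  \<comment> \<open>The term \<open>80 * (R + 1)\<close> is the cost of \<open>gather\<close>: 40
    units of time and one credit worth 40 for each slot. Consolidation pays for itself.\<close>
  let ?G = "\<lambda>s2. (\<exists>m2. heap_state R m2 s2 \<and> time s2 + 40 * m2 \<le> time s + 40 * m + 80 * (R + 1) + 4) \<and>
    (\<forall>q. ints s2 aslot (q * ints s2 0 vn) = 0) \<and>
    (\<forall>v < ints s2 0 vn. ints s2 acur v \<noteq> 0 \<and> ints s2 apos v = 0 \<longrightarrow> 0 < ints s2 0 vbest \<and>
       dists s2 dkey (ints s2 avert (ints s2 0 vbest)) \<le> dists s2 dkey v) \<and>
    agree {ark, akid, astack, aslot} {vT, vmax, vbest, vx, vy, vv, vt, vr} {} s s2"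
  have "wp (consolidate ;; gather) ?G (tick 1 s)"
    unfolding wp_Seq
  proof (rule wp_conseq[OF consolidate[of R m]])
    show "heap_state R m (tick 1 s)" "ints (tick 1 s) 0 vbest = 0" using h b by simp_all
    show "2 ^ (r div 2) \<le> ints (tick 1 s) 0 vN \<Longrightarrow> r \<le> R" for r using R' by simp
    fix s1 assume s1: "(\<exists>m'. heap_state R m' s1 \<and> time s1 + 40 * m' \<le> time (tick 1 s) + 40 * m + 1) \<and>
      ints s1 0 vT = 0 \<and> agree {ark, akid, astack, aslot} {vT, vmax, vx, vy, vv, vt, vr} {} (tick 1 s) s1"
    then obtain m1 where m1: "heap_state R m1 s1" "time s1 + 40 * m1 \<le> time s + 40 * m + 2" by auto
    show "wp gather ?G s1"
    proof (rule wp_conseq[OF gather[OF m1(1)]])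
      have "0 < length xs" using j by linarith
      then show "0 < ints s1 0 vn" using s1 n by (simp add: agree_def)
      show "ints s1 0 vT = 0" "ints s1 0 vbest = 0" using s1 b by (simp_all add: agree_def)
      fix s2 assume s2: "(\<exists>m'\<le>m1 + R + 1. heap_state R m' s2) \<and>
        (\<forall>q. ints s2 aslot (q * ints s2 0 vn) = 0) \<and>
        (\<forall>v < ints s2 0 vn. ints s2 acur v \<noteq> 0 \<and> ints s2 apos v = 0 \<longrightarrow> 0 < ints s2 0 vbest \<and>
           dists s2 dkey (ints s2 avert (ints s2 0 vbest)) \<le> dists s2 dkey v) \<and>
        time s2 \<le> time s1 + 40 * (R + 1) + 2 \<and>
        agree {astack, aslot} {vT, vbest, vx, vr} {} s1 s2"
      then obtain m2 where m2: "m2 \<le> m1 + R + 1" "heap_state R m2 s2" by blast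
      have "time s2 + 40 * m2 \<le> time s + 40 * m + 80 * (R + 1) + 4"
        using s2 m1(2) m2(1) by simp
      moreover have "agree {ark, akid, astack, aslot} {vT, vmax, vbest, vx, vy, vv, vt, vr} {} s s2"
      proof -
        have "agree {ark, akid, astack, aslot} {vT, vmax, vbest, vx, vy, vv, vt, vr} {} s (tick 1 s)"
          by (simp add: agree_def)
        also have "agree {ark, akid, astack, aslot} {vT, vmax, vbest, vx, vy, vv, vt, vr} {} (tick 1 s) s1"
          by (rule agree_mono[of "{ark, akid, astack, aslot}" "{vT, vmax, vx, vy, vv, vt, vr}" "{}"]) (use s1 in auto)
        also have "agree {ark, akid, astack, aslot} {vT, vmax, vbest, vx, vy, vv, vt, vr} {} s1 s2"
          by (rule agree_mono[of "{astack, aslot}" "{vT, vbest, vx, vr}" "{}"]) (use s2 in auto)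
        finally show ?thesis .
      qed
      ultimately show "?G s2"
        using s2 m2(2) by blast
    qed
  qed
  then have "wp (consolidate ;; gather) (wp (Cond (Less (Const 0) (var vbest)) (extract_min ;; scan) restart) ?Q) (tick 1 s)"
  proof (rule wp_conseq)
    fix s2 assume s2: "?G s2"
    then obtain m2 where m2: "heap_state R m2 s2" "time s2 + 40 * m2 \<le> time s + 40 * m + 80 * (R + 1) + 4" by blast
    define s3 where "s3 = tick 1 s2"
    have a3: "ints s3 aord = ints s aord" "ints s3 apos = ints s apos" "ints s3 acur = ints s acur"
      "dists s3 dkey = dists s dkey" "dists s3 dlink = dists s dlink"
      "ints s3 0 vn = ints s 0 vn" "ints s3 0 vj = ints s 0 vj" "ints s3 0 vp = ints s 0 vp" "ints s3 0 vN = ints s 0 vN"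
      using s2 by (simp_all add: agree_def s3_def)
    have P3: "prim_inv s3" by (rule prim_inv_cong[OF P a3(1-8)])
    have h3: "heap_state R m2 s3" using m2 by (simp add: s3_def)
    have e3: "ints s3 aslot (q * ints s3 0 vn) = 0" for q using s2 by (simp add: s3_def)
    have d3: "degree_sum s3 = degree_sum s" by (simp add: degree_sum_def a3)
    have t3: "time s3 + 40 * m2 \<le> B + 500 * ((ints s 0 vj + ints s 0 vp) * (R + 1) + degree_sum s) + 80 * (R + 1) + 5"
      using m2 tm by (simp add: s3_def)
    have ag: "prim_agree s s3"
      by (rule agree_mono[of "{ark, akid, astack, aslot}" "{vT, vmax, vbest, vx, vy, vv, vt, vr}" "{}"])
        (use s2 in \<open>auto simp: agree_def s3_def\<close>)
    have "(if 0 < ints s2 0 vbest then wp (extract_min ;; scan) ?Q s3 else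
        wp restart ?Q s3)"
    proof (cases "0 < ints s2 0 vbest")
      case True
      have "wp (extract_min ;; scan) ?Q s3"
      proof (rule wp_conseq[OF prim_extract[OF P3 h3 _ e3, where B = B]])
        show "0 < ints s3 0 vbest" using True by (simp add: s3_def)
        show "2 ^ (r div 2) \<le> ints s3 0 vN \<Longrightarrow> r \<le> R" for r using R' a3 by simp
        show "ints s3 0 vN \<le> ints s3 0 vp + degree_sum s3" using N a3 d3 by simp
        show "dists s3 dkey (ints s3 avert (ints s3 0 vbest)) \<le> dists s3 dkey v"
          if "v < length xs" "ints s3 acur v \<noteq> 0" "ints s3 apos v = 0" for v
          using s2 that a3 n by (simp add: s3_def)
        show "time s3 + 40 * m2 + 220 * (R + 1) + 23
            \<le> B + 500 * ((Suc (ints s3 0 vj) + ints s3 0 vp) * (R + 1) + degree_sum s3)"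
          using t3 a3 d3 by (simp add: algebra_simps)
      qed (use a3 agree_trans[OF ag] in auto)
      then show ?thesis using True by simp
    next
      case False
      have "wp restart ?Q s3"
      proof (rule wp_conseq[OF prim_restart[OF P3 h3 _ _ e3, where B = B]])
        show "ints s3 0 vbest = 0" using False by (simp add: s3_def)
        show "ints s3 0 vj < length xs" using j a3 by simp
        show "ints s3 0 vN \<le> ints s3 0 vp + degree_sum s3" using N a3 d3 by simp
        show "ints s3 apos v \<noteq> 0"
          if "v < length xs" "ints s3 acur v \<noteq> 0" for v
          using s2 that a3 n False by (auto simp: s3_def)
        show "time s3 + 40 * m2 + 350
            \<le> B + 500 * ((ints s3 0 vj + Suc (ints s3 0 vp)) * (R + 1) + degree_sum s3)"
          using t3 a3 d3 by (simp add: algebra_simps)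
      qed (use a3 agree_trans[OF ag] in auto)
      then show ?thesis using False by simp
    qed
    then show "wp (Cond (Less (Const 0) (var vbest)) (extract_min ;; scan) restart) ?Q s2"
      unfolding wp_Cond[of "Less (Const 0) (var vbest)"] s3_def by (simp del: wp_Seq wp_Cond)
  qed
  then show ?thesis by (simp only: prim_step_def wp_Seq)
qed

text \<open>Each iteration visits a vertex or advances \<open>vp\<close>, so there are at most
  \<open>2 * length xs\<close> of them.\<close>

lemma prim:
  assumes S: "prim_state R B m s"
    and R: "\<And>r. 2 ^ (r div 2) \<le> length xs + length xs * length xs \<Longrightarrow> r \<le> R"
  shows "wp prim (\<lambda>t. prim_inv t \<and> ints t 0 vj = length xs \<and> prim_agree s t \<and>
    time t \<le> B + 500 * (2 * length xs * (R + 1) + degree_sum t) + 1) s" (is "wp _ ?Q _")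
proof -
  let ?I = "\<lambda>t. (\<exists>m. prim_state R B m t) \<and> prim_agree s t"
  show ?thesis unfolding prim_def
  proof (rule wp_Loop[where I = ?I
        and \<mu> = "\<lambda>t. 2 * length xs - ints t 0 vj - ints t 0 vp"])
    show "?I s" using S by auto
  next
    fix t assume I: "?I t" and c: "bval t (Less (var vj) (var vn))"
    then obtain m where m: "prim_state R B m t" by blast
    have n: "ints t 0 vn = length xs" "ints t 0 vp \<le> length xs"
      using m prim_invD(1,6) unfolding prim_state_def by auto
    have j: "ints t 0 vj < length xs" using c n by simp
    show "wp prim_step (\<lambda>u. ?I u \<and>
      2 * length xs - ints u 0 vj - ints u 0 vp < 2 * length xs - ints t 0 vj - ints t 0 vp) (tick 1 t)"
      by (rule wp_conseq[OF prim_step[OF m j R]]) (use I j n(2) agree_trans in auto)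
  next
    fix t assume I: "?I t" and c: "\<not> bval t (Less (var vj) (var vn))"
    then obtain m where m: "prim_state R B m t" by blast
    then have P: "prim_inv t" unfolding prim_state_def by simp
    have j: "ints t 0 vj = length xs"
      using c prim_invD(1)[OF P] prim_order_length[OF prim_invD(2)[OF P]] by simp
    have "prim_inv (tick 1 t)" by (rule prim_inv_cong[OF P]) simp_all
    moreover have "prim_agree s (tick 1 t)" using I by (simp add: agree_def)
    moreover have "(ints t 0 vj + ints t 0 vp) * (R + 1) \<le> 2 * length xs * (R + 1)"
      using j prim_invD(6)[OF P] by (intro mult_right_mono) auto
    then have "time (tick 1 t) \<le> B + 500 * (2 * length xs * (R + 1) + degree_sum (tick 1 t)) + 1"
      using m unfolding prim_state_def by (simp add: degree_sum_def)
    ultimately show "?Q (tick 1 t)"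
      using j by simp
  qed
qed

end

section \<open>Threshold components and cluster radii\<close>

context semimetric_machine begin

abbreviation reach :: "real \<Rightarrow> 'a \<Rightarrow> 'a \<Rightarrow> bool" where
  "reach \<epsilon> x y \<equiv> \<exists>p. path_between X (adjacent X d \<epsilon>) x y p"

lemma reach_iff: "reach \<epsilon> x y \<longleftrightarrow> x \<in> X \<and> (adjacent X d \<epsilon>)\<^sup>*\<^sup>* x y"
proof
  assume "reach \<epsilon> x y"
  then obtain p where "path_between X (adjacent X d \<epsilon>) x y p" by blast
  then show "x \<in> X \<and> (adjacent X d \<epsilon>)\<^sup>*\<^sup>* x y"
  proof (induction p arbitrary: x)
    case Nil
    then show ?case by (simp add: path_between_def)
  next
    case (Cons b p)
    show ?case
    proof (cases "p = []")
      case True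
      then show ?thesis using Cons.prems by (auto simp: path_between_def)
    next
      case False
      then have "path_between X (adjacent X d \<epsilon>) (hd p) y p" and "adjacent X d \<epsilon> x (hd p)" and "x \<in> X"
        using Cons.prems by (auto simp: path_between_def successively_Cons)
      then show ?thesis using Cons.IH[of "hd p"] by (meson converse_rtranclp_into_rtranclp)
    qed
  qed
next
  assume "x \<in> X \<and> (adjacent X d \<epsilon>)\<^sup>*\<^sup>* x y"
  then have "(adjacent X d \<epsilon>)\<^sup>*\<^sup>* x y" "x \<in> X" by auto
  then show "reach \<epsilon> x y"
  proof (induction rule: rtranclp_induct)
    case base
    then show ?case by (intro exI[of _ "[x]"]) (simp add: path_between_def)
  next
    case (step y z)
    then obtain p where "path_between X (adjacent X d \<epsilon>) x y p" by blast
    then have "path_between X (adjacent X d \<epsilon>) x z (p @ [z])"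
      using step.hyps(2) by (auto simp: path_between_def successively_append_iff adjacent_def)
    then show ?case by blast
  qed
qed

lemma adjacent_sym: "adjacent X d \<epsilon> x y \<Longrightarrow> adjacent X d \<epsilon> y x"
  using semimetric by (auto simp: adjacent_def semimetric_on_def)

lemma reach_in: "reach \<epsilon> x y \<Longrightarrow> y \<in> X"
  by (auto simp: path_between_def)

lemma reach_sym: "reach \<epsilon> x y \<Longrightarrow> reach \<epsilon> y x"
proof -
  assume r: "reach \<epsilon> x y"
  have "symp (adjacent X d \<epsilon>)" using adjacent_sym by (rule sympI)
  then have "(adjacent X d \<epsilon>)\<^sup>*\<^sup>* y x" using r unfolding reach_iff by (metis symp_rtranclp sympD)
  then show ?thesis using reach_in[OF r] unfolding reach_iff by blast
qed

lemma reach_trans: "reach \<epsilon> x y \<Longrightarrow> reach \<epsilon> y z \<Longrightarrow> reach \<epsilon> x z"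
  unfolding reach_iff by (meson rtranclp_trans)

lemma reach_edge:
  assumes "u < length xs" "v < length xs" "dst u v \<le> ereal \<epsilon>"
  shows "reach \<epsilon> (xs ! u) (xs ! v)"
proof (cases "u = v")
  case True
  then show ?thesis using assms unfolding reach_iff by simp
next
  case False
  then have "adjacent X d \<epsilon> (xs ! u) (xs ! v)"
    using assms nth_eq_iff by (simp add: adjacent_def dst_def)
  then show ?thesis using assms unfolding reach_iff by auto
qed

text \<open>
  A threshold component is an interval of the order of Prim's algorithm: when \<open>w i\<close> exceeds the
  threshold, no edge below it leaves the first \<open>i\<close> vertices.
\<close>

lemma reach_prim_order:
  assumes po: "prim_order ord w j" and "a \<le> c" "c < j"
  shows "reach \<epsilon> (xs ! ord a) (xs ! ord c) \<longleftrightarrow> (\<forall>i\<in>{a<..c}. w i \<le> ereal \<epsilon>)"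
proof
  have ordn: "ord i < length xs" if "i < j" for i using po that unfolding prim_order_def by auto
  have low: "w i \<le> dst (ord b) v" if "i < j" "b < i" "v < length xs" "v \<notin> ord ` {..<i}" for i b v
    using po that unfolding prim_order_def by auto
  have notin: "ord i \<notin> ord ` {..<b}" if "b \<le> i" "i < j" for b i
  proof
    assume "ord i \<in> ord ` {..<b}"
    then obtain b' where "b' < b" "ord i = ord b'" by blast
    moreover have "inj_on ord {..<j}" using po unfolding prim_order_def by blast
    ultimately have "i = b'" using that by (simp add: inj_on_eq_iff)
    then show False using \<open>b' < b\<close> that by simp
  qed
  {
    assume r: "reach \<epsilon> (xs ! ord a) (xs ! ord c)"
    show "\<forall>i\<in>{a<..c}. w i \<le> ereal \<epsilon>"
    proof
      fix i assume i: "i \<in> {a<..c}"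
      show "w i \<le> ereal \<epsilon>"
      proof (rule ccontr)
        assume n: "\<not> w i \<le> ereal \<epsilon>"
        have "(adjacent X d \<epsilon>)\<^sup>*\<^sup>* (xs ! ord a) (xs ! ord c)" using r unfolding reach_iff by simp
        \<comment> \<open>A walk that starts among the first \<open>i\<close> vertices cannot leave
          them, because every edge across that cut weighs at least \<open>w i\<close>, which exceeds
          the threshold.\<close>
        then have "xs ! ord c \<in> (!) xs ` ord ` {..<i}"
        proof (induction rule: rtranclp_induct)
          case base
          then show ?case using i by auto
        next
          case (step y z)
          then obtain b where b: "b < i" "y = xs ! ord b" by auto
          obtain v where v: "v < length xs" "z = xs ! v"
            using step.hyps(2) represents unfolding adjacent_def represents_def by (metis in_set_conv_nth)
          have "dst (ord b) v \<le> ereal \<epsilon>" using step.hyps(2) b v by (simp add: adjacent_def dst_def)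
          then have "\<not> w i \<le> dst (ord b) v" using n order_trans by blast
          then have "v \<in> ord ` {..<i}" using low[of i b v] b(1) v(1) i assms(3) by auto
          then show ?case using v(2) by blast
        qed
        then obtain b where "b < i" "xs ! ord c = xs ! ord b" by auto
        then have "ord c = ord b" using nth_eq_iff ordn[of b] ordn[of c] i assms(3) by auto
        then show False using notin[of i c] i assms(3) \<open>b < i\<close> by auto
      qed
    qed
  }
  {
    assume "\<forall>i\<in>{a<..c}. w i \<le> ereal \<epsilon>"
    with assms(2,3) show "reach \<epsilon> (xs ! ord a) (xs ! ord c)"
    proof (induction c arbitrary: a rule: less_induct)
      case (less c)
      show ?case
      proof (cases "a = c")
        case True
        then show ?thesis using ordn[of c] less.prems unfolding reach_iff by simp
      next
        case False
        then have ac: "a < c" using less.prems by simp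
        then obtain b where b: "b < c" "w c = dst (ord b) (ord c)"
          using po less.prems unfolding prim_order_def by (metis gr_implies_not_zero neq0_conv)
        have "w c \<le> ereal \<epsilon>" using less.prems ac by simp
        then have bc: "reach \<epsilon> (xs ! ord b) (xs ! ord c)"
          using b less.prems by (intro reach_edge ordn) auto
        have "reach \<epsilon> (xs ! ord a) (xs ! ord b)"
        proof (cases "a \<le> b")
          case True
          then show ?thesis using less.IH[OF b(1)] less.prems b(1) by simp
        next
          case ba: False
          \<comment> \<open>The edge that attaches \<open>ord c\<close> may start at a position
            \<open>b\<close> before \<open>a\<close>. It then crosses the cut at every
            \<open>i\<close> in \<open>{b<..a}\<close>, so each such \<open>w i\<close> is at most
            \<open>w c\<close>.\<close>
          have "w i \<le> ereal \<epsilon>" if "i \<in> {b<..a}" for i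
          proof -
            have "w i \<le> dst (ord b) (ord c)"
              using that ac less.prems by (intro low ordn notin) auto
            then show ?thesis using b(2) \<open>w c \<le> ereal \<epsilon>\<close> by simp
          qed
          then have "reach \<epsilon> (xs ! ord b) (xs ! ord a)"
            using less.IH[OF ac, of b] ba less.prems ac by simp
          then show ?thesis by (rule reach_sym)
        qed
        then show ?thesis using bc by (rule reach_trans)
      qed
    qed
  }
qed

text \<open>The smaller end is excluded because \<open>w i\<close> belongs to the gap between the
  positions \<open>i - 1\<close> and \<open>i\<close>.\<close>

definition between :: "nat \<Rightarrow> nat \<Rightarrow> nat set" where
  "between a c = {min a c<..max a c}"

lemma reach_between:
  assumes "prim_order ord w j" "a < j" "c < j"
  shows "reach \<epsilon> (xs ! ord a) (xs ! ord c) \<longleftrightarrow> (\<forall>i\<in>between a c. w i \<le> ereal \<epsilon>)"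
proof (cases "a \<le> c")
  case True
  then show ?thesis using reach_prim_order[OF assms(1) True assms(3)] by (simp add: between_def)
next
  case False
  then show ?thesis
    using reach_prim_order[OF assms(1) _ assms(2), of c] reach_sym[of \<epsilon> "xs ! ord a" "xs ! ord c"]
      reach_sym[of \<epsilon> "xs ! ord c" "xs ! ord a"] by (auto simp: between_def)
qed

text \<open>By symmetry and transitivity of \<open>reach\<close>, a threshold connects all pairs of
  the cluster iff it connects the seed to each point. Since \<open>M\<close> is antitone, the first
  index of a cluster point decides.\<close>

lemma radius_eq:
  assumes C: "C \<subseteq> X" "xs ! s \<in> C" and conn: "\<And>x y. x \<in> C \<Longrightarrow> y \<in> C \<Longrightarrow> reach \<epsilon>0 x y" "0 \<le> \<epsilon>0"
    and F: "F ` {..<length xs} = {..<length xs}"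
    and M: "\<And>x. x < length xs \<Longrightarrow> 0 \<le> M x"
      "\<And>x y. x \<le> y \<Longrightarrow> y < length xs \<Longrightarrow> M y \<le> M x"
      "\<And>x \<epsilon>. x < length xs \<Longrightarrow> 0 \<le> \<epsilon> \<Longrightarrow> reach \<epsilon> (xs ! s) (xs ! F x) \<longleftrightarrow> M x \<le> ereal \<epsilon>"
    and lo: "lo < length xs" "xs ! F lo \<in> C" "\<And>x. x < lo \<Longrightarrow> xs ! F x \<notin> C"
  shows "M lo = ereal (cluster_radius X d C)"
proof -
  have iff: "(\<forall>x\<in>C. \<forall>y\<in>C. reach \<epsilon> x y) \<longleftrightarrow> M lo \<le> ereal \<epsilon>" if e: "0 \<le> \<epsilon>" for \<epsilon>
  proof
    assume "\<forall>x\<in>C. \<forall>y\<in>C. reach \<epsilon> x y"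
    then show "M lo \<le> ereal \<epsilon>" using M(3)[OF lo(1) e] C(2) lo(2) by blast
  next
    assume m: "M lo \<le> ereal \<epsilon>"
    have s: "reach \<epsilon> (xs ! s) y" if y: "y \<in> C" for y
    proof -
      have "y \<in> set xs" using y C(1) represents unfolding represents_def by blast
      then obtain v where "v < length xs" "y = xs ! v" by (metis in_set_conv_nth)
      then have "v \<in> F ` {..<length xs}" using F by simp
      then obtain x where "x < length xs" "v = F x" by auto
      then have x: "x < length xs" "y = xs ! F x" using \<open>y = xs ! v\<close> by simp_all
      then have "lo \<le> x" using lo(3)[of x] y by (meson not_le)
      then have "M x \<le> ereal \<epsilon>" using M(2)[OF _ x(1)] m order_trans by blast
      then show ?thesis using M(3)[OF x(1) e] x(2) by simp
    qed
    show "\<forall>x\<in>C. \<forall>y\<in>C. reach \<epsilon> x y"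
      using reach_trans[OF reach_sym[OF s] s] by simp
  qed
  \<comment> \<open>Some threshold connects the cluster, so this bottleneck distance is finite and
    the least threshold exists as a real number.\<close>
  have "M lo \<le> ereal \<epsilon>0" using iff[OF conn(2)] conn(1) by blast
  then obtain r where r: "M lo = ereal r" "0 \<le> r"
    using M(1)[OF lo(1)] by (cases "M lo") auto
  have "cluster_radius X d C = r"
    unfolding cluster_radius_def
  proof (rule Least_equality)
    show "0 \<le> r \<and> (\<forall>x\<in>C. \<forall>y\<in>C. reach r x y)" using iff[OF r(2)] r by simp
    fix \<epsilon> assume "0 \<le> \<epsilon> \<and> (\<forall>x\<in>C. \<forall>y\<in>C. reach \<epsilon> x y)"
    then show "r \<le> \<epsilon>" using iff[of \<epsilon>] r by simp
  qed
  then show ?thesis using r by simp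
qed

text \<open>
  The interval \<open>[l, r)\<close> grows from \<open>a\<close> across the smaller of its two boundary weights; therefore the
  running maximum \<open>c\<close> is at most the bottleneck distance of either next vertex.
\<close>

definition expand_inv :: "(nat \<Rightarrow> nat) \<Rightarrow> (nat \<Rightarrow> ereal) \<Rightarrow> nat \<Rightarrow> nat \<Rightarrow> nat \<Rightarrow> nat \<Rightarrow> ereal \<Rightarrow>
    (nat \<Rightarrow> nat) \<Rightarrow> (nat \<Rightarrow> ereal) \<Rightarrow> bool" where
  "expand_inv ord w n a l r c F M \<longleftrightarrow> l \<le> a \<and> a < r \<and> r \<le> n \<and> 0 \<le> c \<and>
     (\<forall>i\<in>{l<..<r}. w i \<le> c) \<and>
     (\<forall>e\<ge>0. 0 < l \<and> (\<forall>i\<in>{l..a}. w i \<le> e) \<longrightarrow> c \<le> e) \<and>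
     (\<forall>e\<ge>0. r < n \<and> (\<forall>i\<in>{a<..r}. w i \<le> e) \<longrightarrow> c \<le> e) \<and>
     F ` {n - (r - l)..<n} = ord ` {l..<r} \<and> F (n - 1) = ord a \<and>
     (\<forall>x\<in>{n - (r - l)..<n}. 0 \<le> M x \<and> M x \<le> c) \<and>
     (\<forall>x y. n - (r - l) \<le> x \<and> x \<le> y \<and> y < n \<longrightarrow> M y \<le> M x) \<and>
     (\<forall>x\<in>{n - (r - l)..<n}. \<exists>p\<in>{l..<r}. F x = ord p \<and>
        (\<forall>e\<ge>0. M x \<le> e \<longleftrightarrow> (\<forall>i\<in>between a p. w i \<le> e)))"

lemma expand_init:
  assumes "a < n"
  shows "expand_inv ord w n a a (Suc a) 0 (F(n - 1 := ord a)) (M(n - 1 := 0))"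
  using assms unfolding expand_inv_def by (auto simp: between_def)

text \<open>The two sides are treated together: \<open>wt\<close> is the boundary weight that is
  crossed and \<open>p\<close> the position that is reached. Since the smaller boundary is crossed,
  the running maximum also bounds from below the cost of crossing the other one.\<close>

lemma expand_extend:
  assumes I: "expand_inv ord w n a l r c F M"
    and lr: "(0 < l \<and> l' = l - 1 \<and> r' = r \<and> p = l - 1 \<and> wt = w l \<and> (r < n \<longrightarrow> w l \<le> w r)) \<or>
      (r < n \<and> l' = l \<and> r' = Suc r \<and> p = r \<and> wt = w r \<and> (0 < l \<longrightarrow> w r \<le> w l))"
    and x: "x = n - (r' - l')" and c': "c' = max c wt"
  shows "expand_inv ord w n a l' r' c' (F(x := ord p)) (M(x := c'))" "r' - l' = Suc (r - l)"
proof -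
  note i = I[unfolded expand_inv_def]
  have lar: "l \<le> a" "a < r" "r \<le> n" "0 \<le> c" using i by auto
  have spec: "\<forall>x\<in>{n - (r - l)..<n}. \<exists>p\<in>{l..<r}. F x = ord p \<and>
      (\<forall>e\<ge>0. M x \<le> e \<longleftrightarrow> (\<forall>i\<in>between a p. w i \<le> e))"
    using i by (elim conjE) assumption
  have Mb: "\<forall>x\<in>{n - (r - l)..<n}. 0 \<le> M x \<and> M x \<le> c"
    using i by (elim conjE) assumption
  have Ma: "\<forall>x y. n - (r - l) \<le> x \<and> x \<le> y \<and> y < n \<longrightarrow> M y \<le> M x"
    using i by (elim conjE) assumption
  show len: "r' - l' = Suc (r - l)" using lr lar by auto
  have len_n: "r' - l' \<le> n" "r' \<le> n" "l' \<le> a" "a < r'" using lr lar by auto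
  have xs: "{n - (r' - l')..<n} = insert x {n - (r - l)..<n}" "x < n - (r - l)" "x < n - 1"
    using len len_n lar unfolding x by auto
  have ps: "{l'..<r'} = insert p {l..<r}" using lr lar by auto
  have cc: "c \<le> c'" "wt \<le> c'" by (auto simp: c')
  \<comment> \<open>If the left boundary was crossed, then \<open>wt\<close> is \<open>w l\<close>.
    Otherwise the choice of the right one gives \<open>w r \<le> w l\<close>. In both cases
    \<open>wt \<le> e\<close>; \<open>right\<close> is symmetric.\<close>
  have left: "c' \<le> e" if "0 \<le> e" "0 < l" "\<forall>i\<in>{l..a}. w i \<le> e" for e
  proof -
    have "c \<le> e" using i that by blast
    moreover have "w l \<le> e" using that lar by auto
    then have "wt \<le> e" using lr that by auto
    ultimately show ?thesis by (simp add: c')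
  qed
  have right: "c' \<le> e" if "0 \<le> e" "r < n" "\<forall>i\<in>{a<..r}. w i \<le> e" for e
  proof -
    have "c \<le> e" using i that by blast
    moreover have "w r \<le> e" using that lar by auto
    then have "wt \<le> e" using lr that by auto
    ultimately show ?thesis by (simp add: c')
  qed
  have inner: "w i \<le> c'" if "i \<in> {l'<..<r'}" for i
  proof (cases "i \<in> {l<..<r}")
    case True
    then have "w i \<le> c" using i by blast
    then show ?thesis using cc order_trans by blast
  next
    case False
    then have "w i = wt" using that lr by (auto simp: less_Suc_eq dest: Suc_lessI)
    then show ?thesis using cc by simp
  qed
  have new: "c' \<le> e \<longleftrightarrow> (\<forall>i\<in>between a p. w i \<le> e)" if e: "0 \<le> e" for e
  proof
    assume "c' \<le> e"
    moreover have "between a p \<subseteq> {l'<..<r'}" using lr lar by (auto simp: between_def)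
    ultimately show "\<forall>i\<in>between a p. w i \<le> e" using inner order_trans by blast
  next
    assume b: "\<forall>i\<in>between a p. w i \<le> e"
    from lr show "c' \<le> e"
    proof
      assume "0 < l \<and> l' = l - 1 \<and> r' = r \<and> p = l - 1 \<and> wt = w l \<and> (r < n \<longrightarrow> w l \<le> w r)"
      moreover from this have "between a p = {l..a}" using lar by (auto simp: between_def)
      ultimately show ?thesis using left[OF e] b by simp
    next
      assume "r < n \<and> l' = l \<and> r' = Suc r \<and> p = r \<and> wt = w r \<and> (0 < l \<longrightarrow> w r \<le> w l)"
      moreover from this have "between a p = {a<..r}" using lar by (auto simp: between_def)
      ultimately show ?thesis using right[OF e] b by simp
    qed
  qed
  show "expand_inv ord w n a l' r' c' (F(x := ord p)) (M(x := c'))"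
    unfolding expand_inv_def xs(1) ps
  proof (intro conjI)
    show "l' \<le> a" "a < r'" "r' \<le> n" "0 \<le> c'" using len_n lar cc by (auto intro: order_trans)
    show "\<forall>i\<in>{l'<..<r'}. w i \<le> c'" using inner by blast
    have "0 < l' \<Longrightarrow> 0 < l" "{l..a} \<subseteq> {l'..a}" "r' < n \<Longrightarrow> r < n" "{a<..r} \<subseteq> {a<..r'}"
      using lr by auto
    note mono = this
    show "\<forall>e\<ge>0. 0 < l' \<and> (\<forall>i\<in>{l'..a}. w i \<le> e) \<longrightarrow> c' \<le> e"
    proof (intro allI impI; elim conjE)
      fix e :: ereal assume e: "0 \<le> e" "0 < l'" "\<forall>i\<in>{l'..a}. w i \<le> e"
      show "c' \<le> e" by (rule left[OF e(1) mono(1)[OF e(2)]]) (use e(3) mono(2) in blast)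
    qed
    show "\<forall>e\<ge>0. r' < n \<and> (\<forall>i\<in>{a<..r'}. w i \<le> e) \<longrightarrow> c' \<le> e"
    proof (intro allI impI; elim conjE)
      fix e :: ereal assume e: "0 \<le> e" "r' < n" "\<forall>i\<in>{a<..r'}. w i \<le> e"
      show "c' \<le> e" by (rule right[OF e(1) mono(3)[OF e(2)]]) (use e(3) mono(4) in blast)
    qed
    have "F ` {n - (r - l)..<n} = ord ` {l..<r}" using i by blast
    moreover have "(F(x := ord p)) ` {n - (r - l)..<n} = F ` {n - (r - l)..<n}"
      using xs(2) by (intro image_cong) auto
    ultimately show "(F(x := ord p)) ` insert x {n - (r - l)..<n} = ord ` insert p {l..<r}"
      by (simp only: image_insert fun_upd_same)
    show "(F(x := ord p)) (n - 1) = ord a" using xs(3) i by simp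
    have Mc: "0 \<le> M y \<and> M y \<le> c'" if "y \<in> {n - (r - l)..<n}" for y
      using bspec[OF Mb that] cc(1) by (auto intro: order_trans)
    then show "\<forall>y\<in>insert x {n - (r - l)..<n}. 0 \<le> (M(x := c')) y \<and> (M(x := c')) y \<le> c'"
      using cc lar by (auto intro: order_trans)
    show "\<forall>y z. n - (r' - l') \<le> y \<and> y \<le> z \<and> z < n \<longrightarrow> (M(x := c')) z \<le> (M(x := c')) y"
    proof (intro allI impI)
      fix y z assume yz: "n - (r' - l') \<le> y \<and> y \<le> z \<and> z < n"
      then have "y = x \<or> y \<in> {n - (r - l)..<n}" "z = x \<or> z \<in> {n - (r - l)..<n}" using xs(1) by auto
      then show "(M(x := c')) z \<le> (M(x := c')) y"
        using yz xs(2) Mc Ma by auto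
    qed
    show "\<forall>y\<in>insert x {n - (r - l)..<n}. \<exists>q\<in>insert p {l..<r}. (F(x := ord p)) y = ord q \<and>
        (\<forall>e\<ge>0. (M(x := c')) y \<le> e \<longleftrightarrow> (\<forall>i\<in>between a q. w i \<le> e))"
    proof
      fix y assume y: "y \<in> insert x {n - (r - l)..<n}"
      show "\<exists>q\<in>insert p {l..<r}. (F(x := ord p)) y = ord q \<and>
        (\<forall>e\<ge>0. (M(x := c')) y \<le> e \<longleftrightarrow> (\<forall>i\<in>between a q. w i \<le> e))"
      proof (cases "y = x")
        case True
        then show ?thesis using new by simp
      next
        case False
        then have "y \<in> {n - (r - l)..<n}" using y by simp
        from bspec[OF spec this] obtain q where q: "q \<in> {l..<r}"
          "F y = ord q \<and> (\<forall>e\<ge>0. M y \<le> e \<longleftrightarrow> (\<forall>i\<in>between a q. w i \<le> e))"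
          by (rule bexE)
        have "q \<in> insert p {l..<r}" using q(1) by simp
        moreover have "(F(x := ord p)) y = F y" "(M(x := c')) y = M y" using False by simp_all
        ultimately show ?thesis using q(2) by metis
      qed
    qed
  qed
qed

lemma expand_final:
  assumes po: "prim_order ord w (length xs)" and I: "expand_inv ord w (length xs) a l r c F M"
    and e: "length xs \<le> r - l"
  shows "F ` {..<length xs} = {..<length xs}" "F (length xs - 1) = ord a"
    "\<And>x. x < length xs \<Longrightarrow> 0 \<le> M x"
    "\<And>x y. x \<le> y \<Longrightarrow> y < length xs \<Longrightarrow> M y \<le> M x"
    "\<And>x \<epsilon>. x < length xs \<Longrightarrow> 0 \<le> \<epsilon> \<Longrightarrow> reach \<epsilon> (xs ! ord a) (xs ! F x) \<longleftrightarrow> M x \<le> ereal \<epsilon>"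
proof -
  note i = I[unfolded expand_inv_def]
  have lr: "l = 0" "r = length xs" "a < length xs" using i e by auto
  show "F ` {..<length xs} = {..<length xs}"
    using i prim_order_image[OF po] unfolding lr by (simp add: lessThan_atLeast0)
  show "F (length xs - 1) = ord a" using i by simp
  show "0 \<le> M x" if "x < length xs" for x using i that unfolding lr by simp
  show "M y \<le> M x" if "x \<le> y" "y < length xs" for x y using i that unfolding lr by simp
  fix x \<epsilon> assume x: "x < length xs" and e: "(0::real) \<le> \<epsilon>"
  have "\<forall>x\<in>{length xs - (r - l)..<length xs}. \<exists>p\<in>{l..<r}. F x = ord p \<and>
      (\<forall>e\<ge>0. M x \<le> e \<longleftrightarrow> (\<forall>i\<in>between a p. w i \<le> e))"
    using i by (elim conjE) assumption
  then have "\<exists>p\<in>{l..<r}. F x = ord p \<and> (\<forall>e\<ge>0. M x \<le> e \<longleftrightarrow> (\<forall>i\<in>between a p. w i \<le> e))"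
    using x unfolding lr by simp
  then obtain p where p: "p \<in> {l..<r}" "F x = ord p \<and> (\<forall>e\<ge>0. M x \<le> e \<longleftrightarrow> (\<forall>i\<in>between a p. w i \<le> e))"
    by (rule bexE)
  have "0 \<le> ereal \<epsilon>" using e by simp
  then have "M x \<le> ereal \<epsilon> \<longleftrightarrow> (\<forall>i\<in>between a p. w i \<le> ereal \<epsilon>)" using p(2) by blast
  moreover have "p < length xs" using p(1) lr by simp
  ultimately show "reach \<epsilon> (xs ! ord a) (xs ! F x) \<longleftrightarrow> M x \<le> ereal \<epsilon>"
    using reach_between[OF po lr(3), of p] p(2) by simp
qed

end

section \<open>Learning the radii\<close>

context semimetric_machine begin

lemma halves:
  "wp halves (\<lambda>t. (\<forall>x<2 * ints s 0 vn. ints t ahalf x = x div 2) \<and> time t \<le> time s + 10 * ints s 0 vn + 2 \<and>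
    agree {ahalf} {vt} {} s t) s"
proof -
  define n where "n = ints s 0 vn"
  let ?I = "\<lambda>t. ints t 0 vt \<le> n \<and>
      (\<forall>x<2 * ints t 0 vt. ints t ahalf x = x div 2) \<and> time t \<le> time s + 1 + 10 * ints t 0 vt \<and> agree {ahalf} {vt} {} s t"
  have "wp (Loop (Less (var vt) (var vn))
        (ISet ahalf (Plus (var vt) (var vt)) (var vt) ;;
         ISet ahalf (Plus (Plus (var vt) (var vt)) (Const 1)) (var vt) ;;
         vt ::= Plus (var vt) (Const 1)))
     (\<lambda>t. (\<forall>x<2 * n. ints t ahalf x = x div 2) \<and> time t \<le> time s + 10 * n + 2 \<and> agree {ahalf} {vt} {} s t)
     (tick 1 (iwrite 0 vt 0 s))"
  proof (rule wp_Loop[where \<mu> = "\<lambda>t. n - ints t 0 vt" and I = ?I])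
    fix t assume I: "?I t"
      and c: "bval t (Less (var vt) (var vn))"
    have "ints t 0 vn = n" using I by (simp add: agree_def n_def)
    then have tn: "ints t 0 vt < n" using c by simp
    have "x div 2 = ints t 0 vt" if "x < Suc (Suc (2 * ints t 0 vt))" "\<not> x < 2 * ints t 0 vt" for x
      using that by presburger
    moreover have "x = 2 * ints t 0 vt \<or> x = Suc (2 * ints t 0 vt)"
      if "x < Suc (Suc (2 * ints t 0 vt))" "\<not> x < 2 * ints t 0 vt" for x
      using that by linarith
    ultimately show "wp (ISet ahalf (Plus (var vt) (var vt)) (var vt) ;;
         ISet ahalf (Plus (Plus (var vt) (var vt)) (Const 1)) (var vt) ;;
         vt ::= Plus (var vt) (Const 1))
       (\<lambda>u. ?I u \<and>
         n - ints u 0 vt < n - ints t 0 vt) (tick 1 t)"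
      using I tn by (auto simp: agree_def mult_2[symmetric])
  qed (auto simp: agree_def n_def)
  then show ?thesis unfolding halves_def n_def by simp
qed

lemma expand_step:
  assumes I: "expand_inv (ints s aord) (dists s dlink) n a (ints s 0 vleft) (ints s 0 vright) (dists s dcur 0)
      (ints s anear) (dists s dthr)"
    and n: "ints s 0 vn = n" and idx: "ints s 0 vidx = n - (ints s 0 vright - ints s 0 vleft)" "0 < ints s 0 vidx"
  shows "wp expand_step (\<lambda>t. expand_inv (ints t aord) (dists t dlink) n a (ints t 0 vleft) (ints t 0 vright) (dists t dcur 0)
      (ints t anear) (dists t dthr) \<and> ints t 0 vidx = n - (ints t 0 vright - ints t 0 vleft) \<and>
      ints t 0 vidx = ints s 0 vidx - 1 \<and> time t \<le> time s + 10 \<and>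
      agree {anear} {vleft, vright, vidx} {dthr, dcur} s t) s"
proof -
  define l where "l = ints s 0 vleft"
  define r where "r = ints s 0 vright"
  define w where "w = dists s dlink"
  have lr: "l < r" "r \<le> n" using I by (auto simp: expand_inv_def l_def r_def)
  have ix: "ints s 0 vidx = n - (r - l)" "0 < n - (r - l)" using idx by (auto simp: l_def r_def)
  note ext = expand_extend[OF I, folded l_def r_def w_def]
  show ?thesis
  proof (cases "0 < l \<and> \<not> (r < n \<and> w r < w l)")
    case True
    have x: "n - (r - l) - 1 = n - (r - (l - 1))" using ix(2) lr True by linarith
    define c where "c = (if dists s dcur 0 < w l then w l else dists s dcur 0)"
    have c': "c = max (dists s dcur 0) (w l)" by (auto simp: c_def max_def)
    have e: "expand_inv (ints s aord) w n a (l - 1) r c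
      ((ints s anear)(n - (r - l) - 1 := ints s aord (l - 1))) ((dists s dthr)(n - (r - l) - 1 := c))"
      by (rule ext(1)[OF _ x c']) (use True in auto)
    show ?thesis
      using True e x ix n lr unfolding expand_step_def
      by (cases "dists s dcur 0 < w l")
        (simp_all add: l_def[symmetric] r_def[symmetric] w_def[symmetric] agree_def c_def)
  next
    case False
    \<comment> \<open>The right side is taken only if it exists: either the comparison required it,
      or \<open>l = 0\<close> and the interval is not yet everything.\<close>
    then have rn: "r < n" using ix(2) lr by linarith
    have x: "n - (r - l) - 1 = n - (Suc r - l)" using ix(2) lr by linarith
    define c where "c = (if dists s dcur 0 < w r then w r else dists s dcur 0)"
    have c': "c = max (dists s dcur 0) (w r)" by (auto simp: c_def max_def)
    have e: "expand_inv (ints s aord) w n a l (Suc r) c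
      ((ints s anear)(n - (r - l) - 1 := ints s aord r)) ((dists s dthr)(n - (r - l) - 1 := c))"
      by (rule ext(1)[OF _ x c']) (use False rn in auto)
    show ?thesis
      using False e x ix n lr rn unfolding expand_step_def
      by (cases "dists s dcur 0 < w r")
        (auto simp add: l_def[symmetric] r_def[symmetric] w_def[symmetric] agree_def c_def)
  qed
qed

lemma expand:
  assumes n: "ints s 0 vn = n" and a: "ints s 0 va = a" "a < n"
  shows "wp expand (\<lambda>t. (\<exists>l r c. expand_inv (ints t aord) (dists t dlink) n a l r c (ints t anear) (dists t dthr) \<and> n \<le> r - l) \<and>
      time t \<le> time s + 12 * n + 10 \<and> agree {anear} {vleft, vright, vidx} {dthr, dcur} s t) s" (is "wp _ ?Q _")
proof -
  define s1 where "s1 = tick 1 (dwrite dthr (n - 1) 0 (tick 1 (iwrite anear (n - 1) (ints s aord a)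
    (tick 1 (dwrite dcur 0 0 (tick 1 (iwrite 0 vidx (n - 1) (tick 1 (iwrite 0 vright (Suc a) (tick 1 (iwrite 0 vleft a s)))))))))))"
  let ?I = "\<lambda>t. expand_inv (ints t aord) (dists t dlink) n a (ints t 0 vleft) (ints t 0 vright) (dists t dcur 0)
        (ints t anear) (dists t dthr) \<and> ints t 0 vidx = n - (ints t 0 vright - ints t 0 vleft) \<and>
      ints t 0 vidx \<le> n \<and>
      time t + 12 * ints t 0 vidx \<le> time s + 12 * n + 6 \<and> agree {anear} {vleft, vright, vidx} {dthr, dcur} s t"
  have "wp (Loop (Less (Const 0) (var vidx)) expand_step)
    ?Q s1"
  proof (rule wp_Loop[where \<mu> = "\<lambda>t. ints t 0 vidx" and I = ?I])
    show "?I s1"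
      using expand_init[OF a(2), of "ints s aord" "dists s dlink" "ints s anear" "dists s dthr"] a
      by (simp add: s1_def agree_def)
  next
    fix t assume I: "?I t"
      and c: "bval t (Less (Const 0) (var vidx))"
    show "wp expand_step (\<lambda>u. ?I u \<and>
      ints u 0 vidx < ints t 0 vidx) (tick 1 t)"
    proof (rule wp_conseq[OF expand_step[of "tick 1 t" n a]])
      show "expand_inv (ints (tick 1 t) aord) (dists (tick 1 t) dlink) n a (ints (tick 1 t) 0 vleft)
        (ints (tick 1 t) 0 vright) (dists (tick 1 t) dcur 0) (ints (tick 1 t) anear) (dists (tick 1 t) dthr)"
        using I by simp
      show "ints (tick 1 t) 0 vn = n" using I n by (simp add: agree_def)
      show "ints (tick 1 t) 0 vidx = n - (ints (tick 1 t) 0 vright - ints (tick 1 t) 0 vleft)" using I by simp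
      show "0 < ints (tick 1 t) 0 vidx" using c by simp
      fix u assume u: "expand_inv (ints u aord) (dists u dlink) n a (ints u 0 vleft) (ints u 0 vright) (dists u dcur 0)
          (ints u anear) (dists u dthr) \<and> ints u 0 vidx = n - (ints u 0 vright - ints u 0 vleft) \<and>
        ints u 0 vidx = ints (tick 1 t) 0 vidx - 1 \<and> time u \<le> time (tick 1 t) + 10 \<and>
        agree {anear} {vleft, vright, vidx} {dthr, dcur} (tick 1 t) u"
      have "agree {anear} {vleft, vright, vidx} {dthr, dcur} t u" using u by (simp add: agree_def)
      then have "agree {anear} {vleft, vright, vidx} {dthr, dcur} s u" using I agree_trans by blast
      then show "?I u \<and>
        ints u 0 vidx < ints t 0 vidx"
      proof -
        have 1: "ints u 0 vidx = ints t 0 vidx - 1" "time u \<le> time t + 1 + 10"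
          using u unfolding state_simps by blast+
        have 2: "time t + 12 * ints t 0 vidx \<le> time s + 12 * n + 6" "ints t 0 vidx \<le> n"
          using I by blast+
        have "0 < ints t 0 vidx" using c by simp
        then have "ints u 0 vidx < ints t 0 vidx" "ints u 0 vidx \<le> n"
          "time u + 12 * ints u 0 vidx \<le> time s + 12 * n + 6"
          using 1 2 by linarith+
        then show ?thesis
          using u \<open>agree {anear} {vleft, vright, vidx} {dthr, dcur} s u\<close> by blast
      qed
    qed
  next
    fix t assume I: "?I t"
      and c: "\<not> bval t (Less (Const 0) (var vidx))"
    have "n \<le> ints t 0 vright - ints t 0 vleft" using I c by auto
    then have "\<exists>l r c. expand_inv (ints t aord) (dists t dlink) n a l r c (ints t anear) (dists t dthr) \<and> n \<le> r - l"
      using I by blast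
    then show "?Q (tick 1 t)"
      using I by (simp add: agree_def)
  qed
  then show ?thesis unfolding expand_def using n a by (simp add: s1_def)
qed

abbreviation bisect_agree :: "state \<Rightarrow> state \<Rightarrow> bool" where
  "bisect_agree s t \<equiv> (\<forall>a. a \<noteq> 0 \<and> a \<noteq> ares \<longrightarrow> ints t a = ints s a) \<and>
     (\<forall>c. c \<notin> {vlo, vhi, vmid} \<longrightarrow> ints t 0 c = ints s 0 c) \<and> dists t = dists s"

text \<open>The ghost \<open>e\<close> counts the rounds left, with
  \<open>hi - lo \<le> 2 ^ e\<close>. A round spends one query, and reading its prefix takes at most
  \<open>length xs\<close> units.\<close>

lemma bisect:
  assumes n: "ints s 0 vn = length xs" and i: "ints s 0 vi < k" and so: "seed_oracle_for X k C seed"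
    and F: "\<And>x. x < length xs \<Longrightarrow> ints s anear x < length xs"
    and last: "xs ! ints s anear (length xs - 1) \<in> C (ints s 0 vi)" "0 < length xs"
    and half: "\<And>x. x \<le> length xs \<Longrightarrow> ints s ahalf x = x div 2" and L: "length xs \<le> 2 ^ L"
  shows "wp bisect (\<lambda>t. ints t 0 vlo < length xs \<and> xs ! ints s anear (ints t 0 vlo) \<in> C (ints s 0 vi) \<and>
    (\<forall>x<ints t 0 vlo. xs ! ints s anear x \<notin> C (ints s 0 vi)) \<and>
    queries t \<le> queries s + L \<and> time t \<le> time s + L * (length xs + 10) + 3 \<and> bisect_agree s t) s"
proof -
  define D where "D = C (ints s 0 vi)"
  define F where "F = ints s anear"
  define I where "I = (\<lambda>e t. ints t 0 vlo < ints t 0 vhi \<and> ints t 0 vhi \<le> length xs \<and>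
    (\<forall>x<ints t 0 vlo. xs ! F x \<notin> D) \<and> (\<exists>x<ints t 0 vhi. xs ! F x \<in> D) \<and>
    ints t 0 vhi - ints t 0 vlo \<le> 2 ^ e \<and> queries t + e \<le> queries s + L \<and>
    time t + e * (length xs + 10) \<le> time s + 2 + L * (length xs + 10) \<and> bisect_agree s t)"
  have X: "set xs = X" using represents by (simp add: represents_def)
  have "wp (Loop (Less (Plus (var vlo) (Const 1)) (var vhi)) bisect_step)
    (\<lambda>t. ints t 0 vlo < length xs \<and> xs ! F (ints t 0 vlo) \<in> D \<and> (\<forall>x<ints t 0 vlo. xs ! F x \<notin> D) \<and>
    queries t \<le> queries s + L \<and> time t \<le> time s + L * (length xs + 10) + 3 \<and> bisect_agree s t)
    (tick 1 (iwrite 0 vhi (length xs) (tick 1 (iwrite 0 vlo 0 s))))"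
  proof (rule wp_Loop_ghost[where I = I and m = L])
    \<comment> \<open>The seed itself is stored at the last index, being nearest to itself, so some
      cluster point lies below \<open>hi\<close> from the start.\<close>
    show "I L (tick 1 (iwrite 0 vhi (length xs) (tick 1 (iwrite 0 vlo 0 s))))"
      unfolding I_def using L last by (auto simp: D_def F_def intro!: exI[of _ "length xs - 1"])
  next
    fix e t assume I: "I e t" and c: "bval t (Less (Plus (var vlo) (Const 1)) (var vhi))"
    define lo where "lo = ints t 0 vlo"
    define hi where "hi = ints t 0 vhi"
    have ag: "bisect_agree s t" using I unfolding I_def by blast
    have lh: "lo + 1 < hi" "hi \<le> length xs" "hi - lo \<le> 2 ^ e"
      using I c unfolding I_def by (auto simp: lo_def hi_def)
    obtain e' where e': "e = Suc e'" using lh by (cases e) auto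
    define mid where "mid = lo + (hi - lo) div 2"
    have "2 \<le> hi - lo" "hi - lo \<le> 2 * 2 ^ e'" using lh e' by auto
    then have mid: "lo < mid" "mid < hi" "hi - mid \<le> 2 ^ e'" "mid - lo \<le> 2 ^ e'"
      unfolding mid_def by linarith+
    define s1 where "s1 = tick 1 (iwrite 0 vmid mid (tick 1 t))"
    have s1: "ints s1 0 vmid = mid" "ints s1 anear = F" "ints s1 0 vi = ints s 0 vi" "queries s1 = queries t"
      "time s1 = time t + 2" "dists s1 = dists t"
      "\<And>a. a \<noteq> 0 \<Longrightarrow> ints s1 a = ints t a" "\<And>c. c \<noteq> vmid \<Longrightarrow> ints s1 0 c = ints t 0 c"
      using ag by (auto simp: s1_def F_def)
    have "wp (Seed anear (var vmid) ares (Const 0) (var vi))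
      (wp (Cond (Less (Cell ares (Const 0)) (Const 1)) (vlo ::= var vmid) (vhi ::= var vmid)) (\<lambda>u. \<exists>e'<e. I e' u)) s1"
    proof (rule wp_Seed[OF _ _ X so])
      show "ints s1 anear j < length xs" if "j < ival s1 (var vmid)" for j
        using that F[of j] mid lh(2) s1 by (simp add: F_def)
      show "ival s1 (var vi) < k" using i s1 by simp
    next
      assume none: "\<And>j. j < ival s1 (var vmid) \<Longrightarrow> xs ! ints s1 anear j \<notin> C (ival s1 (var vi))"
      define u where "u = tick 1 (iwrite 0 vlo mid (tick 1 (tick (1 + mid) ((iwrite ares 0 0 s1)\<lparr>queries := queries s1 + 1\<rparr>))))"
      have "\<forall>x<mid. xs ! F x \<notin> D" using none s1 by (simp add: D_def)
      moreover have "mid \<le> length xs" using mid lh by simp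
      ultimately have "I e' u"
        using I mid lh ag e' unfolding I_def u_def by (auto simp: s1 lo_def[symmetric] hi_def[symmetric])
      then show "wp (Cond (Less (Cell ares (Const 0)) (Const 1)) (vlo ::= var vmid) (vhi ::= var vmid)) (\<lambda>u. \<exists>e'<e. I e' u)
        (tick (1 + ival s1 (var vmid)) ((iwrite ares (ival s1 (Const 0)) 0 s1)\<lparr>queries := queries s1 + 1\<rparr>))"
        using e' s1 by (auto simp: u_def)
    next
      fix q j assume j: "q < length xs" "j < ival s1 (var vmid)" "xs ! q = xs ! ints s1 anear j" "xs ! q \<in> C (ival s1 (var vi))"
      define u where "u = tick 1 (iwrite 0 vhi mid (tick 1 (tick (1 + mid) ((iwrite ares 0 (q + 1) s1)\<lparr>queries := queries s1 + 1\<rparr>))))"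
      have "\<exists>x<mid. xs ! F x \<in> D" using j s1 by (auto simp: D_def)
      moreover have "mid \<le> length xs" using mid lh by simp
      ultimately have "I e' u"
        using I mid lh ag e' unfolding I_def u_def by (auto simp: s1 lo_def[symmetric] hi_def[symmetric])
      then show "wp (Cond (Less (Cell ares (Const 0)) (Const 1)) (vlo ::= var vmid) (vhi ::= var vmid)) (\<lambda>u. \<exists>e'<e. I e' u)
        (tick (1 + ival s1 (var vmid)) ((iwrite ares (ival s1 (Const 0)) (q + 1) s1)\<lparr>queries := queries s1 + 1\<rparr>))"
        using e' s1 by (auto simp: u_def)
    qed
    moreover have "ints t ahalf (hi - lo) = (hi - lo) div 2"
      using half[of "hi - lo"] ag lh by simp
    ultimately show "wp bisect_step (\<lambda>u. \<exists>e'<e. I e' u) (tick 1 t)"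
      unfolding bisect_step_def by (simp add: s1_def mid_def lo_def[symmetric] hi_def[symmetric] del: wp_Cond)
  next
    fix e t assume I: "I e t" and c: "\<not> bval t (Less (Plus (var vlo) (Const 1)) (var vhi))"
    then have h: "ints t 0 vhi = Suc (ints t 0 vlo)" unfolding I_def by auto
    then obtain x where "x < Suc (ints t 0 vlo)" "xs ! F x \<in> D" using I unfolding I_def by auto
    then have "xs ! F (ints t 0 vlo) \<in> D" using I unfolding I_def by (metis less_SucE)
    then show "ints (tick 1 t) 0 vlo < length xs \<and> xs ! F (ints (tick 1 t) 0 vlo) \<in> D \<and>
      (\<forall>x<ints (tick 1 t) 0 vlo. xs ! F x \<notin> D) \<and>
      queries (tick 1 t) \<le> queries s + L \<and> time (tick 1 t) \<le> time s + L * (length xs + 10) + 3 \<and> bisect_agree s (tick 1 t)"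
      using I h unfolding I_def by auto
  qed
  then show ?thesis unfolding bisect_def D_def F_def using n by simp
qed

definition ready :: "nat \<Rightarrow> state \<Rightarrow> bool" where
  "ready L s \<longleftrightarrow> ints s 0 vn = length xs \<and> ints s 0 vk = k \<and> prim_order (ints s aord) (dists s dlink) (length xs) \<and>
     (\<forall>i<length xs. ints s apos (ints s aord i) = Suc i) \<and> (\<forall>x\<le>length xs. ints s ahalf x = x div 2) \<and>
     length xs \<le> 2 ^ L \<and> 0 < length xs"

lemma learn_radius:
  assumes r: "ready L s" and i: "ints s 0 vi < k" and so: "seed_oracle_for X k C seed"
    and C: "C (ints s 0 vi) \<subseteq> X" "C (ints s 0 vi) \<noteq> {}"
      "\<exists>\<epsilon>\<ge>0. \<forall>x\<in>C (ints s 0 vi). \<forall>y\<in>C (ints s 0 vi). reach \<epsilon> x y"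
  shows "wp learn_radius (\<lambda>t. ready L t \<and> ints t 0 vi = Suc (ints s 0 vi) \<and>
    dists t 0 = (dists s 0)(ints s 0 vi := ereal (cluster_radius X d (C (ints s 0 vi)))) \<and>
    queries t \<le> queries s + Suc L \<and> time t \<le> time s + 13 * length xs + L * (length xs + 10) + 20) s"
proof -
  define D where "D = C (ints s 0 vi)"
  have X: "set xs = X" using represents by (simp add: represents_def)
  note r' = r[unfolded ready_def]
  have po: "prim_order (ints s aord) (dists s dlink) (length xs)" using r' by blast
  note ord = prim_order_image[OF po]
  have half: "\<And>x. x \<le> length xs \<Longrightarrow> ints s ahalf x = x div 2" and L: "length xs \<le> 2 ^ L" and n0: "0 < length xs"
    and n: "ints s 0 vn = length xs" and pos: "\<And>i. i < length xs \<Longrightarrow> ints s apos (ints s aord i) = Suc i"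
    using r' by auto
  let ?Q = "\<lambda>t. ready L t \<and> ints t 0 vi = Suc (ints s 0 vi) \<and>
    dists t 0 = (dists s 0)(ints s 0 vi := ereal (cluster_radius X d D)) \<and>
    queries t \<le> queries s + Suc L \<and> time t \<le> time s + 13 * length xs + L * (length xs + 10) + 20"
  have "wp (Seed aord (var vn) ares (Const 0) (var vi))
    (wp (va ::= Minus (Cell apos (Minus (Cell ares (Const 0)) (Const 1))) (Const 1))
      (wp expand (wp bisect (wp (DSet 0 (var vi) (DCell dthr (var vlo)) ;; vi ::= Plus (var vi) (Const 1)) ?Q)))) s"
  proof (rule wp_Seed[OF _ _ X so])
    show "ints s aord j < length xs" if "j < ival s (var vn)" for j
    proof -
      have "ints s aord j \<in> ints s aord ` {..<length xs}" using that n by simp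
      then show ?thesis using ord by simp
    qed
    show "ival s (var vi) < k" using i by simp
  next
    \<comment> \<open>NIL is impossible: \<open>aord\<close> lists all points and the cluster is
      nonempty.\<close>
    assume none: "\<And>j. j < ival s (var vn) \<Longrightarrow> xs ! ints s aord j \<notin> C (ival s (var vi))"
    obtain x where x: "x \<in> D" using C(2) unfolding D_def by blast
    then have "x \<in> set xs" using C(1) X by (auto simp: D_def)
    then obtain v where v: "v < length xs" "x = xs ! v" by (metis in_set_conv_nth)
    then have "v \<in> ints s aord ` {..<length xs}" using ord by simp
    then obtain j where "j < length xs" "v = ints s aord j" by auto
    then show "wp (va ::= Minus (Cell apos (Minus (Cell ares (Const 0)) (Const 1))) (Const 1))
      (wp expand (wp bisect (wp (DSet 0 (var vi) (DCell dthr (var vlo)) ;; vi ::= Plus (var vi) (Const 1)) ?Q)))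
      (tick (1 + ival s (var vn)) ((iwrite ares (ival s (Const 0)) 0 s)\<lparr>queries := queries s + 1\<rparr>))"
      using none[of j] x v n by (simp add: D_def)
  next
    fix q j assume q: "q < length xs" "xs ! q \<in> C (ival s (var vi))"
    then have "q \<in> ints s aord ` {..<length xs}" using ord by simp
    then obtain a where a: "a < length xs" "q = ints s aord a" by auto
    have pa: "ints s apos q = Suc a" using pos a by simp
    define s1 where "s1 = tick 1 (iwrite 0 va a (tick (1 + length xs) ((iwrite ares 0 (q + 1) s)\<lparr>queries := queries s + 1\<rparr>)))"
    have s1: "ints s1 b = (if b = 0 then (ints s 0)(va := a) else if b = ares then (ints s ares)(0 := q + 1) else ints s b)"
      "dists s1 = dists s" "queries s1 = queries s + 1" "time s1 = time s + length xs + 2" for b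
      by (auto simp: s1_def)
    have "wp expand (wp bisect (wp (DSet 0 (var vi) (DCell dthr (var vlo)) ;; vi ::= Plus (var vi) (Const 1)) ?Q)) s1"
    proof (rule wp_conseq[OF expand[of s1 "length xs" a]])
      show "ints s1 0 vn = length xs" "ints s1 0 va = a" "a < length xs" using n a by (simp_all add: s1)
      fix s2 assume s2: "(\<exists>l r c. expand_inv (ints s2 aord) (dists s2 dlink) (length xs) a l r c (ints s2 anear) (dists s2 dthr) \<and>
          length xs \<le> r - l) \<and>
        time s2 \<le> time s1 + 12 * length xs + 10 \<and> agree {anear} {vleft, vright, vidx} {dthr, dcur} s1 s2"
      have a2: "ints s2 aord = ints s aord" "ints s2 apos = ints s apos" "ints s2 ahalf = ints s ahalf"
        "ints s2 0 vn = length xs" "ints s2 0 vi = ints s 0 vi" "ints s2 0 vk = ints s 0 vk"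
        "dists s2 dlink = dists s dlink" "dists s2 0 = dists s 0" "queries s2 = queries s + 1"
        using s2 n by (simp_all add: agree_def s1)
      obtain l r c where e: "expand_inv (ints s aord) (dists s dlink) (length xs) a l r c (ints s2 anear) (dists s2 dthr)"
          "length xs \<le> r - l" using s2 a2 by auto
      note ef = expand_final[OF po e]
      show "wp bisect (wp (DSet 0 (var vi) (DCell dthr (var vlo)) ;; vi ::= Plus (var vi) (Const 1)) ?Q) s2"
      proof (rule wp_conseq[OF bisect[of s2 C L]])
        show "ints s2 0 vn = length xs" "ints s2 0 vi < k" using a2 i by simp_all
        show "seed_oracle_for X k C seed" by (rule so)
        show "ints s2 anear x < length xs" if "x < length xs" for x
        proof -
          have "ints s2 anear x \<in> ints s2 anear ` {..<length xs}" using that by simp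
          then show ?thesis using ef(1) by simp
        qed
        show "xs ! ints s2 anear (length xs - 1) \<in> C (ints s2 0 vi)" using ef(2) a q a2 by simp
        show "ints s2 ahalf x = x div 2" if "x \<le> length xs" for x using half[OF that] a2 by simp
        show "0 < length xs" "length xs \<le> 2 ^ L" by fact+
        fix t assume t: "ints t 0 vlo < length xs \<and> xs ! ints s2 anear (ints t 0 vlo) \<in> C (ints s2 0 vi) \<and>
          (\<forall>x<ints t 0 vlo. xs ! ints s2 anear x \<notin> C (ints s2 0 vi)) \<and>
          queries t \<le> queries s2 + L \<and> time t \<le> time s2 + L * (length xs + 10) + 3 \<and> bisect_agree s2 t"
        obtain \<epsilon> where \<epsilon>: "0 \<le> \<epsilon>" "\<And>x y. x \<in> D \<Longrightarrow> y \<in> D \<Longrightarrow> reach \<epsilon> x y" using C(3) unfolding D_def by blast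
        have sD: "xs ! ints s aord a \<in> D" using q a by (simp add: D_def)
        have DX: "D \<subseteq> X" using C(1) by (simp add: D_def)
        have rad: "dists s2 dthr (ints t 0 vlo) = ereal (cluster_radius X d D)"
          by (rule radius_eq[OF DX sD \<epsilon>(2,1) ef(1) ef(3,4,5)]) (use t a2 in \<open>auto simp: D_def\<close>)
        define u where "u = tick 1 (iwrite 0 vi (Suc (ints s 0 vi)) (tick 1 (dwrite 0 (ints s 0 vi) (ereal (cluster_radius X d D)) t)))"
        have "?Q u"
          using t r' a2 s2 unfolding ready_def u_def by (auto simp: s1)
        moreover have "dists t dthr (ints t 0 vlo) = ereal (cluster_radius X d D)" "ints t 0 vi = ints s 0 vi"
          using t rad a2 by simp_all
        ultimately show "wp (DSet 0 (var vi) (DCell dthr (var vlo)) ;; vi ::= Plus (var vi) (Const 1)) ?Q t"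
          by (simp add: u_def)
      qed
    qed
    then show "wp (va ::= Minus (Cell apos (Minus (Cell ares (Const 0)) (Const 1))) (Const 1))
      (wp expand (wp bisect (wp (DSet 0 (var vi) (DCell dthr (var vlo)) ;; vi ::= Plus (var vi) (Const 1)) ?Q)))
      (tick (1 + ival s (var vn)) ((iwrite ares (ival s (Const 0)) (q + 1) s)\<lparr>queries := queries s + 1\<rparr>))"
      using pa n by (simp add: s1_def)
  qed
  then show ?thesis unfolding learn_radius_def D_def by (simp only: wp_Seq)
qed

lemma learn_radii:
  assumes r: "ready L s" and so: "seed_oracle_for X k C seed"
    and C: "\<And>i. i < k \<Longrightarrow> C i \<subseteq> X \<and> C i \<noteq> {} \<and> (\<exists>\<epsilon>\<ge>0. \<forall>x\<in>C i. \<forall>y\<in>C i. reach \<epsilon> x y)"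
  shows "wp learn_radii (\<lambda>t. learns_radii t X d k C \<and> queries t \<le> queries s + k * Suc L \<and>
    time t \<le> time s + k * (13 * length xs + L * (length xs + 10) + 21) + 2) s"
proof -
  define B where "B = 13 * length xs + L * (length xs + 10) + 21"
  define I where "I = (\<lambda>t. ready L t \<and> ints t 0 vi \<le> k \<and>
    (\<forall>i<ints t 0 vi. dists t 0 i = ereal (cluster_radius X d (C i))) \<and>
    queries t \<le> queries s + ints t 0 vi * Suc L \<and> time t \<le> time s + ints t 0 vi * B + 1)"
  have "wp (Loop (Less (var vi) (var vk)) learn_radius)
    (\<lambda>t. learns_radii t X d k C \<and> queries t \<le> queries s + k * Suc L \<and> time t \<le> time s + k * B + 2)
    (tick 1 (iwrite 0 vi 0 s))"
  proof (rule wp_Loop[where I = I and \<mu> = "\<lambda>t. k - ints t 0 vi"])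
    show "I (tick 1 (iwrite 0 vi 0 s))" using r by (simp add: I_def ready_def)
  next
    fix t assume I: "I t" and c: "bval t (Less (var vi) (var vk))"
    then have i: "ints t 0 vi < k" by (auto simp: I_def ready_def)
    note Ci = C[OF i]
    show "wp learn_radius (\<lambda>u. I u \<and> k - ints u 0 vi < k - ints t 0 vi) (tick 1 t)"
    proof (rule wp_conseq[OF learn_radius[of L _ C]])
      show "ready L (tick 1 t)" using I by (simp add: I_def ready_def)
      show "ints (tick 1 t) 0 vi < k" "seed_oracle_for X k C seed" "C (ints (tick 1 t) 0 vi) \<subseteq> X"
        "C (ints (tick 1 t) 0 vi) \<noteq> {}"
        "\<exists>\<epsilon>\<ge>0. \<forall>x\<in>C (ints (tick 1 t) 0 vi). \<forall>y\<in>C (ints (tick 1 t) 0 vi). reach \<epsilon> x y"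
        using i so Ci by simp_all
      fix u assume "ready L u \<and> ints u 0 vi = Suc (ints (tick 1 t) 0 vi) \<and>
        dists u 0 = (dists (tick 1 t) 0)(ints (tick 1 t) 0 vi := ereal (cluster_radius X d (C (ints (tick 1 t) 0 vi)))) \<and>
        queries u \<le> queries (tick 1 t) + Suc L \<and>
        time u \<le> time (tick 1 t) + 13 * length xs + L * (length xs + 10) + 20"
      then show "I u \<and> k - ints u 0 vi < k - ints t 0 vi"
        using I i by (auto simp: I_def B_def less_Suc_eq)
    qed
  next
    fix t assume I: "I t" and c: "\<not> bval t (Less (var vi) (var vk))"
    then have "ints t 0 vi = k" by (auto simp: I_def ready_def)
    then show "learns_radii (tick 1 t) X d k C \<and> queries (tick 1 t) \<le> queries s + k * Suc L \<and>
      time (tick 1 t) \<le> time s + k * B + 2"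
      using I by (auto simp: I_def learns_radii_def)
  qed
  then show ?thesis unfolding learn_radii_def B_def by simp
qed

text \<open>Ordered pairs of adjacent positions split into increasing and decreasing ones, and
  either half maps injectively into the edges.\<close>

lemma sum_degrees_le: "(\<Sum>v<length xs. length (nbrs v)) \<le> 2 * card (edges X d)"
proof -
  define n where "n = length xs"
  have fin: "finite (edges X d)"
  proof (rule finite_subset)
    have "finite X" using represents by (auto simp: represents_def)
    then show "finite (Pow X)" by simp
  qed (auto simp: edges_def)
  have nb: "w \<in> set (nbrs v) \<longleftrightarrow> w < n \<and> {xs ! v, xs ! w} \<in> edges X d" if "v < n" for v w
    using represents that unfolding represents_def n_def by auto
  have ne: "w \<noteq> v" if "v < n" "w \<in> set (nbrs v)" for v w
    using set_nbrs[of v] that by (auto simp: n_def)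
  have inj: "{xs ! v, xs ! w} = {xs ! v', xs ! w'} \<Longrightarrow> v < n \<Longrightarrow> w < n \<Longrightarrow> v' < n \<Longrightarrow> w' < n \<Longrightarrow>
      {v, w} = {v', w'}" for v w v' w'
    using nth_eq_iff unfolding n_def by (auto simp: doubleton_eq_iff)
  let ?P = "SIGMA v:{..<n}. set (nbrs v)"
  have fP: "finite ?P" by simp
  have "(\<Sum>v<n. length (nbrs v)) = (\<Sum>v<n. card (set (nbrs v)))"
  proof (rule sum.cong[OF refl])
    fix v assume "v \<in> {..<n}"
    then have "distinct (nbrs v)" using represents by (simp add: represents_def n_def)
    then show "length (nbrs v) = card (set (nbrs v))" by (rule distinct_card[symmetric])
  qed
  also have "\<dots> = card ?P" by simp
  also have "\<dots> = card ({p\<in>?P. fst p < snd p} \<union> {p\<in>?P. snd p < fst p})"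
    using ne by (intro arg_cong[of _ _ card]) (auto, force)
  also have "\<dots> \<le> card {p\<in>?P. fst p < snd p} + card {p\<in>?P. snd p < fst p}"
    by (rule card_Un_le)
  also have "card {p\<in>?P. fst p < snd p} \<le> card (edges X d)"
  proof (rule card_inj_on_le[OF _ _ fin])
    show "inj_on (\<lambda>(v, w). {xs ! v, xs ! w}) {p\<in>?P. fst p < snd p}"
    proof (rule inj_onI, clarsimp)
      fix v w v' w' assume a: "v < n" "w \<in> set (nbrs v)" "v < w" "v' < n" "w' \<in> set (nbrs v')" "v' < w'"
        "{xs ! v, xs ! w} = {xs ! v', xs ! w'}"
      then have "{v, w} = {v', w'}" using inj nb by blast
      then show "v = v' \<and> w = w'" using a by (auto simp: doubleton_eq_iff)
    qed
  qed (use nb in auto)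
  also have "card {p\<in>?P. snd p < fst p} \<le> card (edges X d)"
  proof (rule card_inj_on_le[OF _ _ fin])
    show "inj_on (\<lambda>(v, w). {xs ! v, xs ! w}) {p\<in>?P. snd p < fst p}"
    proof (rule inj_onI, clarsimp)
      fix v w v' w' assume a: "v < n" "w \<in> set (nbrs v)" "w < v" "v' < n" "w' \<in> set (nbrs v')" "w' < v'"
        "{xs ! v, xs ! w} = {xs ! v', xs ! w'}"
      then have "{v, w} = {v', w'}" using inj nb by blast
      then show "v = v' \<and> w = w'" using a by (auto simp: doubleton_eq_iff)
    qed
  qed (use nb in auto)
  finally show ?thesis by (simp add: n_def)
qed

lemma learn:
  assumes n: "2 \<le> length xs" and L: "length xs \<le> 2 ^ L"
    and so: "seed_oracle_for X k C seed"
    and C: "\<And>i. i < k \<Longrightarrow> C i \<subseteq> X \<and> C i \<noteq> {} \<and> (\<exists>\<epsilon>\<ge>0. \<forall>x\<in>C i. \<forall>y\<in>C i. reach \<epsilon> x y)"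
  shows "wp learn (\<lambda>t. learns_radii t X d k C \<and> queries t \<le> k * Suc L \<and>
    time t \<le> 1000 * (length xs * (4 * L + 4)) + 1000 * card (edges X d) + 10 * length xs + 6 +
      k * (13 * length xs + L * (length xs + 10) + 21)) (initial_state (length xs) k)"
proof -
  define N where "N = length xs"
  \<comment> \<open>There are at most \<open>N + N * N \<le> 2 ^ (2 * L + 1)\<close> nodes, so half
    the rank is at most \<open>2 * L + 1\<close> and the rank at most
    \<open>4 * L + 3\<close>.\<close>
  define R where "R = 4 * L + 3"
  define s where "s = tick 1 (initial_state N k)"
  have s: "ints s a = (if a = 0 then (\<lambda>_. 0)(1 := k, 0 := N) else (\<lambda>_. 0))" "dists s = (\<lambda>_ _. 0)"
    "queries s = 0" "time s = 1" for a
    by (simp_all add: s_def initial_state_def iwrite_def tick_def)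
  have R: "r \<le> R" if r: "2 ^ (r div 2) \<le> N + N * N" for r
  proof -
    have "N * N \<le> 2 ^ L * 2 ^ L" using L by (intro mult_mono) (auto simp: N_def)
    moreover have "N \<le> N * N" by simp
    moreover have "(2::nat) ^ (2 * L + 1) = 2 * (2 ^ L * 2 ^ L)" by (simp add: mult_2 power_add)
    ultimately have "(2::nat) ^ (r div 2) \<le> 2 ^ (2 * L + 1)"
      using r by linarith
    then have "r div 2 \<le> 2 * L + 1" by (rule power_le_imp_le_exp[rotated]) simp
    then show ?thesis by (simp add: R_def)
  qed
  have "prim_state R 1 0 s"
    unfolding prim_state_def heap_state_def prim_inv_def
    using heap_empty[of N R "\<lambda>_. 0" "\<lambda>_. 0" "\<lambda>_. 0" "\<lambda>_. 0" "\<lambda>_. 0"]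
    by (simp add: s prim_order_def frontier_def degree_sum_def N_def)
  note prim_s = prim[OF this R[unfolded N_def]]
  let ?Q = "\<lambda>t. learns_radii t X d k C \<and> queries t \<le> k * Suc L \<and>
    time t \<le> 1000 * (N * (4 * L + 4)) + 1000 * card (edges X d) + 10 * N + 6 +
      k * (13 * N + L * (N + 10) + 21)"
  have "wp prim (wp halves (wp learn_radii ?Q)) s"
  proof (rule wp_conseq[OF prim_s])
    fix t assume t: "prim_inv t \<and> ints t 0 vj = length xs \<and> prim_agree s t \<and>
      time t \<le> 1 + 500 * (2 * length xs * (R + 1) + degree_sum t) + 1"
    then have P: "prim_inv t" and j: "ints t 0 vj = N" by (auto simp: N_def)
    have at: "ints t 0 vn = N" "ints t 0 vk = k" "queries t = 0" using t by (simp_all add: agree_def s)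
    have po: "prim_order (ints t aord) (dists t dlink) N" using prim_invD(2)[OF P] j by simp
    \<comment> \<open>In the end every vertex has been visited once, so \<open>degree_sum\<close> is
      the sum of all degrees.\<close>
    then have "bij_betw (ints t aord) {..<N} {..<N}"
      using prim_order_image unfolding prim_order_def bij_betw_def N_def by blast
    then have "degree_sum t = (\<Sum>v<N. length (nbrs v))"
      unfolding degree_sum_def j by (rule sum.reindex_bij_betw)
    then have deg: "degree_sum t \<le> 2 * card (edges X d)" using sum_degrees_le by (simp add: N_def)
    show "wp halves (wp learn_radii ?Q) t"
    proof (rule wp_conseq[OF halves])
      fix u assume u: "(\<forall>x<2 * ints t 0 vn. ints u ahalf x = x div 2) \<and>
        time u \<le> time t + 10 * ints t 0 vn + 2 \<and> agree {ahalf} {vt} {} t u"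
      have au: "ints u 0 vn = N" "ints u 0 vk = k" "queries u = 0" "ints u aord = ints t aord"
        "ints u apos = ints t apos" "dists u dlink = dists t dlink"
        using u at by (simp_all add: agree_def)
      have "ints u ahalf x = x div 2" if "x \<le> N" for x using u at that n by (simp add: N_def)
      moreover have "0 < length xs" using n by linarith
      ultimately have rd: "ready L u"
        unfolding ready_def using au po prim_invD(3)[OF P] j L by (simp add: N_def)
      show "wp learn_radii ?Q u"
      proof (rule wp_conseq[OF learn_radii[OF rd so C]])
        fix v assume v: "learns_radii v X d k C \<and> queries v \<le> queries u + k * Suc L \<and>
          time v \<le> time u + k * (13 * length xs + L * (length xs + 10) + 21) + 2"
        have "time t \<le> 2 + 1000 * (N * (4 * L + 4)) + 1000 * card (edges X d)"
          using t deg by (simp add: N_def R_def add.commute[of _ 4])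
        then show "?Q v"
          using v u at au by (simp add: N_def)
      qed
    qed
  qed
  moreover have "bval (initial_state N k) (Less (Const 1) (var vn))"
    using n by (simp add: initial_state_def N_def)
  ultimately show ?thesis
    unfolding learn_def N_def[symmetric] by (simp add: s_def)
qed

end

section \<open>The inverse Ackermann function\<close>

lemma less_ackermann: "0 < j \<Longrightarrow> j < ackermann i j"
proof (induction i arbitrary: j)
  case 0
  then show ?case by simp
next
  case (Suc i)
  from Suc.prems show ?case
  proof (induction j)
    case (Suc j)
    show ?case
    proof (cases j)
      case 0
      then show ?thesis by simp
    next
      case (Suc j')
      then have "j < ackermann (Suc i) j" using Suc.IH by simp
      moreover from this have "ackermann (Suc i) j < ackermann i (ackermann (Suc i) j)"
        by (intro \<open>\<And>j. 0 < j \<Longrightarrow> j < ackermann i j\<close>) simp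
      ultimately show ?thesis using Suc by simp
    qed
  qed simp
qed

lemma ackermann_less_Suc: "ackermann i j < ackermann i (Suc j)"
proof (cases i)
  case (Suc i')
  show ?thesis
  proof (cases j)
    case (Suc j')
    have "0 < ackermann i j" using less_ackermann[of j i] Suc by simp
    then show ?thesis using less_ackermann[of "ackermann i j" i'] \<open>i = Suc i'\<close> Suc by simp
  qed (use Suc in simp)
qed simp

lemma ackermann_mono: "j \<le> j' \<Longrightarrow> ackermann i j \<le> ackermann i j'"
  by (rule lift_Suc_mono_le[of "ackermann i"]) (use ackermann_less_Suc less_imp_le in blast)+

text \<open>From the third column on, passing to the next row increases the value, because row
  \<open>i\<close> is then evaluated at an argument of at least \<open>Suc j\<close>. Hence the
  columns are unbounded.\<close>

lemma le_ackermann: "3 \<le> j \<Longrightarrow> i \<le> ackermann i j"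
proof (induction i)
  case (Suc i)
  obtain j' where j: "j = Suc (Suc (Suc j'))"
    using Suc.prems by (metis Suc_le_D numeral_3_eq_3 Suc_le_mono)
  \<comment> \<open>The second column is constantly \<open>4\<close>. It starts the induction on
    \<open>j'\<close>, and it is the reason why the claim needs \<open>3 \<le> j\<close>.\<close>
  have two: "ackermann i' 2 = 4" for i'
    by (induction i') (simp_all add: numeral_2_eq_2)
  have "j' + 4 \<le> ackermann (Suc i) (Suc (Suc j'))"
  proof (induction j')
    case 0
    then show ?case using two[of "Suc i"] by (simp add: numeral_2_eq_2 del: ackermann.simps)
  next
    case (Suc j')
    then show ?case using ackermann_less_Suc[of "Suc i" "Suc (Suc j')"] by linarith
  qed
  then have "Suc j \<le> ackermann (Suc i) (Suc (Suc j'))" using j by simp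
  then have "ackermann i (Suc j) \<le> ackermann (Suc i) j"
    using ackermann_mono[of "Suc j" "ackermann (Suc i) (Suc (Suc j'))" i] j by simp
  moreover have "i < ackermann i (Suc j)" using Suc ackermann_less_Suc[of i j] by linarith
  ultimately show ?case by linarith
qed simp

text \<open>The \<open>LEAST\<close> says something only if a witness exists. For positive
  \<open>m\<close> the second argument is at least \<open>4\<close>, and \<open>le_ackermann\<close>
  provides one.\<close>

lemma inverse_ackermann_ge_1:
  assumes "0 < m" "0 < n"
  shows "1 \<le> inverse_ackermann m n"
proof -
  define c where "c = nat \<lceil>real m / real n\<rceil>"
  have "0 < real m / real n" using assms by simp
  then have "1 \<le> c" unfolding c_def by linarith
  obtain i where i: "log 2 (real n) < real i" using reals_Archimedean2 by blast
  have "1 \<le> Suc i \<and> log 2 (real n) < real (ackermann (Suc i) (4 * c))"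
    using i le_ackermann[of "4 * c" "Suc i"] \<open>1 \<le> c\<close> by (auto simp del: ackermann.simps)
  then show ?thesis
    unfolding inverse_ackermann_def c_def[symmetric]
    using LeastI[of "\<lambda>i. 1 \<le> i \<and> log 2 (real n) < real (ackermann i (4 * c))"] by blast
qed

lemma cluster_radius_singleton:
  assumes "x \<in> X"
  shows "cluster_radius X d {x} = 0"
  unfolding cluster_radius_def
proof (rule Least_equality)
  have "path_between X (adjacent X d 0) x x [x]" using assms by (simp add: path_between_def)
  then show "0 \<le> (0::real) \<and> (\<forall>x'\<in>{x}. \<forall>y\<in>{x}. \<exists>p. path_between X (adjacent X d 0) x' y p)" by blast
qed simp

theorem theorem12:
  "\<exists>(prog :: com) (c :: real).
     \<forall>(X :: 'a set) d xs nbrs (\<beta> :: real) (\<gamma> :: real) k C seed n m.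
       finite X \<and> semimetric_on X d \<and> represents xs nbrs X d \<and>
       n = card X \<and> m = card (edges X d) \<and>
       0 < \<beta> \<and> \<beta> \<le> 1 \<and> 0 < \<gamma> \<and> \<gamma> \<le> 1 \<and>
       convex_clustering \<beta> \<gamma> X d k C \<and> seed_oracle_for X k C seed \<longrightarrow>
       (\<exists>s. run xs d nbrs k seed prog (initial_state n k) s \<and>
            learns_radii s X d k C \<and>
            real (queries s) \<le> c * (real k * log 2 (real n)) \<and>
            real (time s) \<le> c * (real m * real (inverse_ackermann m n)
                                  + real k * real n * log 2 (real n) + 1))"
\<comment> \<open>A generous constant: the estimate below needs \<open>1000\<close> for the edges
  and about \<open>12100\<close> for the terms in \<open>n\<close> and \<open>k\<close>.\<close>
proof (rule exI[of _ learn], rule exI[of _ 20000], intro allI impI, elim conjE)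
  fix X :: "'a set" and d xs nbrs k C seed n m and \<beta> \<gamma> :: real
  assume sm: "semimetric_on X d" and rep: "represents xs nbrs X d"
    and n: "n = card X" and m: "m = card (edges X d)"
    and cc: "convex_clustering \<beta> \<gamma> X d k C" and so: "seed_oracle_for X k C seed"
  interpret semimetric_machine xs d nbrs k seed X by unfold_locales (rule rep, rule sm)
  have len: "length xs = n"
    using rep n by (auto simp: represents_def distinct_card)
  have part: "partition_on X (C ` {..<k})" using cc by (simp add: convex_clustering_def clustering_def)
  have C: "C i \<subseteq> X \<and> C i \<noteq> {} \<and> (\<exists>\<epsilon>\<ge>0. \<forall>x\<in>C i. \<forall>y\<in>C i. reach \<epsilon> x y)" if i: "i < k" for i
  proof -
    have CX: "C i \<subseteq> X" "C i \<noteq> {}" using part i unfolding partition_on_def by auto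
    obtain \<epsilon> where e: "0 < \<epsilon>" "convex_cluster \<beta> \<gamma> X d (C i) \<epsilon>"
      using cc i unfolding convex_clustering_def by blast
    have "reach \<epsilon> x y" if xy: "x \<in> C i" "y \<in> C i" for x y
    proof -
      obtain p where "path_between (C i) (adjacent X d \<epsilon>) x y p"
        using e(2) xy unfolding convex_cluster_def induced_connected_def by blast
      then have "path_between X (adjacent X d \<epsilon>) x y p"
        using CX(1) unfolding path_between_def by blast
      then show ?thesis by blast
    qed
    moreover have "0 \<le> \<epsilon>" using e(1) by simp
    ultimately show ?thesis using CX by blast
  qed
  show "\<exists>s. run xs d nbrs k seed learn (initial_state n k) s \<and>
            learns_radii s X d k C \<and>
            real (queries s) \<le> 20000 * (real k * log 2 (real n)) \<and>
            real (time s) \<le> 20000 * (real m * real (inverse_ackermann m n)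
                                  + real k * real n * log 2 (real n) + 1)"
  proof (cases "2 \<le> n")
    case False
    have "C i = {hd xs} \<and> hd xs \<in> X" if i: "i < k" for i
    proof -
      obtain x where x: "x \<in> C i" using C[OF i] by blast
      then have "x \<in> set xs" using C[OF i] rep by (auto simp: represents_def)
      moreover from this have "length xs = 1" using False len by (cases xs) auto
      then obtain y where "xs = [y]" by (auto simp: length_Suc_conv)
      ultimately show ?thesis using C[OF i] x rep by (auto simp: represents_def)
    qed
    then have rad: "cluster_radius X d (C i) = 0" if "i < k" for i
      using that cluster_radius_singleton[of "hd xs" X d] by simp
    define s where "s = tick 1 (tick 1 (initial_state n k))"
    have "wp learn (\<lambda>t. t = s) (initial_state n k)"
      using False by (simp add: learn_def s_def initial_state_def)
    then have "run xs d nbrs k seed learn (initial_state n k) s" by (simp add: wp_def)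
    moreover have "learns_radii s X d k C"
      using rad by (simp add: learns_radii_def s_def initial_state_def iwrite_def zero_ereal_def)
    \<comment> \<open>For \<open>n = 0\<close> this rests on the convention for the logarithm of
      zero. No query is asked, and the additive \<open>1\<close> of the time bound pays for the two
      steps.\<close>
    moreover have "log 2 (real n) = 0" using False by (cases "n = 0") (auto simp: log_def dest: Suc_lessI)
    ultimately show ?thesis
      by (intro exI[of _ s]) (simp add: s_def initial_state_def iwrite_def tick_def)
  next
    case True
    define l where "l = log 2 (real n)"
    have l1: "1 \<le> l" using True by (simp add: l_def le_log_iff)
    define L where "L = nat \<lceil>l\<rceil>"
    have Lr: "real L \<le> 2 * l" and lL: "l \<le> real L" using l1 by (auto simp: L_def) linarith
    have "real n = 2 powr l" using True by (simp add: l_def)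
    also have "\<dots> \<le> 2 powr real L" using lL by simp
    also have "\<dots> = real (2 ^ L)" by (simp add: powr_realpow)
    finally have nL: "n \<le> 2 ^ L" by linarith
    have "X \<noteq> {}" using True n by auto
    \<comment> \<open>This lets \<open>k * n * log n\<close> absorb the term
      \<open>n * log n\<close> of Prim's algorithm.\<close>
    then have k1: "1 \<le> k" using part by (cases k) (auto simp: partition_on_def)
    have "wp learn (\<lambda>t. learns_radii t X d k C \<and> queries t \<le> k * Suc L \<and>
      time t \<le> 1000 * (length xs * (4 * L + 4)) + 1000 * card (edges X d) + 10 * length xs + 6 +
        k * (13 * length xs + L * (length xs + 10) + 21)) (initial_state (length xs) k)"
      by (rule learn[OF _ _ so C]) (use True nL len in auto)
    then obtain t where t: "run xs d nbrs k seed learn (initial_state n k) t" "learns_radii t X d k C"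
      "queries t \<le> k * Suc L"
      "time t \<le> 1000 * (n * (4 * L + 4)) + 1000 * m + 10 * n + 6 + k * (13 * n + L * (n + 10) + 21)"
      unfolding wp_def len m by blast
    have "real (queries t) \<le> real k * (real L + 1)"
      using t(3) by (metis of_nat_Suc of_nat_le_iff of_nat_mult add.commute)
    also have "\<dots> \<le> real k * (3 * l)" using Lr l1 by (intro mult_left_mono) auto
    also have "\<dots> \<le> 20000 * (real k * l)" using l1 by simp
    finally have q: "real (queries t) \<le> 20000 * (real k * l)" .
    define A where "A = real m * real (inverse_ackermann m n)"
    have mA: "real m \<le> A"
    \<comment> \<open>Without edges the second argument of \<open>ackermann\<close> is
      \<open>0\<close>, so no \<open>i\<close> meets the definition of its inverse; but then both
      sides are \<open>0\<close>.\<close>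
    proof (cases "m = 0")
      case False
      then have "1 \<le> inverse_ackermann m n" using inverse_ackermann_ge_1 True by simp
      then have "real m * 1 \<le> A" unfolding A_def by (intro mult_left_mono) auto
      then show ?thesis by simp
    qed (simp add: A_def)
    define P where "P = real n * l"
    have nP: "real n \<le> P" "1 \<le> P" "l \<le> P"
    proof -
      have "real n * 1 \<le> real n * l" "1 * l \<le> real n * l"
        using l1 True by (intro mult_left_mono mult_right_mono; simp)+
      then show "real n \<le> P" "1 \<le> P" "l \<le> P" using True l1 unfolding P_def by linarith+
    qed
    have LnP: "real L * real n \<le> 2 * P" using Lr mult_right_mono[of "real L" "2 * l" "real n"] by (simp add: P_def mult_ac)
    have kP: "P \<le> real k * P" using k1 nP mult_right_mono[of 1 "real k" P] by simp
    have "real (time t) \<le> real (1000 * (n * (4 * L + 4)) + 1000 * m + 10 * n + 6 + k * (13 * n + L * (n + 10) + 21))"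
      using t(4) of_nat_le_iff by blast
    also have "\<dots> = 4000 * (real L * real n) + 4010 * real n + 1000 * real m + 6 +
        real k * (13 * real n + real L * real n + 10 * real L + 21)"
      by (simp add: algebra_simps)
    \<comment> \<open>The per-cluster bracket is at most \<open>13 + 2 + 20 + 21 = 56\<close> times
      \<open>P\<close>, since \<open>L\<close> is at most \<open>2 * l\<close> and \<open>n\<close>,
      \<open>l\<close> and \<open>1\<close> are at most \<open>P\<close>.\<close>
    also have "\<dots> \<le> 4000 * (2 * P) + 4010 * P + 1000 * A + 6 + real k * (60 * P)"
      using LnP nP mA Lr by (intro add_mono mult_left_mono) auto
    also have "\<dots> \<le> 20000 * (A + real k * P + 1)"
    proof -
      define Q where "Q = real k * P"
      have "real k * (60 * P) = 60 * Q" by (simp add: Q_def)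
      moreover have "0 \<le> A" by (simp add: A_def)
      ultimately show ?thesis using kP nP unfolding Q_def[symmetric] by simp
    qed
    finally have "real (time t) \<le> 20000 * (A + real k * real n * l + 1)" by (simp add: P_def mult.assoc)
    then show ?thesis using t q by (intro exI[of _ t]) (simp add: A_def l_def)
  qed
qed

end
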